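(* Let $K$ be a field of characteristic $2$, let $r$ be a positive integer, let $\mu=(\mu_1,\mu_2)$ be a partition of $r$ (with at most two parts, so $\mu_1\ge\mu_2\ge 0$ and $\mu_1+\mu_2=r$), and let $A=\operatorname{End}_{K[\Sigma_r]}(Y^\mu)$ be the endomorphism algebra of the Young module $Y^\mu$. Suppose $A$ has dimension $n$ as a $K$-vector space, and let $k$ be the unique non-negative integer such that $2^{k-1}<n\le 2^k$. Then $A$ is isomorphic as a $K$-algebra to $$B:=K[x_1,\ldots,x_k]\,/\,\bigl(\{x_i^2 : i=1,\ldots,k\}\cup R\bigr),$$ where $$R:=\{\,x=x_{r_1}x_{r_2}\cdots x_{r_l}x_k \;:\; r_i\ne r_j \text{ for } i\neq j,\ \text{and } |x|\ge n\,\},$$ the elements $x$ being monomials without repeated factors (so $r_1,\ldots,r_l\in\{1,\ldots,k-1\}$, $l\ge 0$), and $|x|$ denoting the position of $x$ in the total order $\preceq$ on square-free monomials.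
   Context: $\Sigma_r$ is the symmetric group on $r$ letters. For a partition $\mu=(\mu_1,\mu_2)$ of $r$ with at most two parts, $M^\mu$ is the permutation module over $K[\Sigma_r]$ on the cosets of the Young subgroup $\Sigma_\mu=\Sigma_{\mu_1}\times\Sigma_{\mu_2}$, and the Young module $Y^\mu$ is the unique indecomposable direct summand (in a decomposition of $M^\mu$ into indecomposables) that contains the Specht module $S^\mu\subseteq M^\mu$. Order on monomials: for a non-empty subset $I\subseteq\{1,\ldots,k\}$ and the monomial without repeated factors $x=\prod_{i\in I}x_i$, put $\phi(x):=\sum_{i\in I}2^i$. For two such monomials $x,y$ define $x\preceq y$ if and only if $\phi(x)\le\phi(y)$. This is a total order on the $2^k-1$ monomials $\prod_{i\in I}x_i$ with $\emptyset\ne I\subseteq\{1,\ldots,k\}$, and $|x|$ is the position of $x$ in the ascending chain, with positions counted from $1$. For example, for $k=3$ the chain is $x_1\preceq x_2\preceq x_1x_2\preceq x_3\preceq x_1x_3\preceq x_2x_3\preceq x_1x_2x_3$, so $|x_2x_3|=6$. When $k=0$ (i.e. $n=1$), there are no generators, $R$ is empty and $B=K$. *)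

theory Defs
  imports
    "HOL-Algebra.Sym_Groups"
    "HOL-Algebra.Left_Coset"
    "HOL-Algebra.Module"
    "HOL-Algebra.QuotRing"
    "HOL-Algebra.Algebraic_Closure_Type"
    "HOL-Library.Function_Algebras"
    "HOL-Library.Poly_Mapping"
begin

section \<open>Permutation modules over a group algebra\<close>

text \<open>
  The field \<open>K\<close> is a type \<open>'k\<close> of class \<open>field\<close>.  For a finite group \<open>G\<close>, an element
  \<open>\<Sum>g. a g \<cdot> g\<close> of \<open>K[G]\<close> is its coefficient function \<open>a\<close>, and an element
  \<open>\<Sum>C. v C \<cdot> [C]\<close> of the permutation module on the left cosets \<open>C\<close> of \<open>H\<close> is its coefficient
  function \<open>v\<close>.  Both are required to vanish off \<open>G\<close> and off the set of cosets, respectively.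
\<close>

definition scale :: "'k::field \<Rightarrow> ('b \<Rightarrow> 'k) \<Rightarrow> 'b \<Rightarrow> 'k" where
  "scale c v = (\<lambda>x. c * v x)"

lemma vector_space_scale: "vector_space (scale :: 'k::field \<Rightarrow> ('b \<Rightarrow> 'k) \<Rightarrow> 'b \<Rightarrow> 'k)"
  by unfold_locales (auto simp: scale_def fun_eq_iff algebra_simps)

definition group_algebra :: "('g, 'm) monoid_scheme \<Rightarrow> ('g \<Rightarrow> 'k::field) set" where
  "group_algebra G = {a. \<forall>g. g \<notin> carrier G \<longrightarrow> a g = 0}"

definition perm_module :: "('g, 'm) monoid_scheme \<Rightarrow> 'g set \<Rightarrow> ('g set \<Rightarrow> 'k::field) set" where
  "perm_module G H = {v. \<forall>C. C \<notin> lcosets\<^bsub>G\<^esub> H \<longrightarrow> v C = 0}"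

text \<open>
  \<open>g \<cdot> [C] = [g C]\<close>, hence the coefficient of \<open>g \<cdot> v\<close> at \<open>C\<close> is that of \<open>v\<close> at \<open>g\<^sup>-\<^sup>1 C\<close>.
\<close>

definition group_act ::
  "('g, 'm) monoid_scheme \<Rightarrow> 'g \<Rightarrow> ('g set \<Rightarrow> 'k::field) \<Rightarrow> 'g set \<Rightarrow> 'k" where
  "group_act G g v = (\<lambda>C. v (inv\<^bsub>G\<^esub> g <#\<^bsub>G\<^esub> C))"

definition algebra_act ::
  "('g, 'm) monoid_scheme \<Rightarrow> ('g \<Rightarrow> 'k::field) \<Rightarrow> ('g set \<Rightarrow> 'k) \<Rightarrow> 'g set \<Rightarrow> 'k" where
  "algebra_act G a v = (\<Sum>g\<in>carrier G. scale (a g) (group_act G g v))"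

definition is_submodule ::
  "('g, 'm) monoid_scheme \<Rightarrow> 'g set \<Rightarrow> ('g set \<Rightarrow> 'k::field) set \<Rightarrow> bool" where
  "is_submodule G H U \<longleftrightarrow>
     U \<subseteq> perm_module G H \<and> 0 \<in> U \<and> (\<forall>u\<in>U. \<forall>v\<in>U. u + v \<in> U) \<and>
     (\<forall>a\<in>group_algebra G. \<forall>u\<in>U. algebra_act G a u \<in> U)"

definition indecomposable ::
  "('g, 'm) monoid_scheme \<Rightarrow> 'g set \<Rightarrow> ('g set \<Rightarrow> 'k::field) set \<Rightarrow> bool" where
  "indecomposable G H W \<longleftrightarrow>
     is_submodule G H W \<and> W \<noteq> {0} \<and>
     \<not> (\<exists>U U'. is_submodule G H U \<and> is_submodule G H U' \<and> U \<noteq> {0} \<and> U' \<noteq> {0} \<and>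
           U \<inter> U' = {0} \<and> W = {u + u' | u u'. u \<in> U \<and> u' \<in> U'})"

text \<open>
  Distinct summands of an internal direct sum of nonzero submodules are distinct as sets, so a
  set \<open>D\<close> of submodules suffices to record a decomposition.
\<close>

definition indecomposable_decomposition ::
  "('g, 'm) monoid_scheme \<Rightarrow> 'g set \<Rightarrow> ('g set \<Rightarrow> 'k::field) set set \<Rightarrow> bool" where
  "indecomposable_decomposition G H D \<longleftrightarrow>
     finite D \<and> (\<forall>W\<in>D. indecomposable G H W) \<and>
     (\<forall>v\<in>perm_module G H. \<exists>!w. w \<in> (\<Pi>\<^sub>E W\<in>D. W) \<and> v = (\<Sum>W\<in>D. w W))"


section \<open>Endomorphism algebras\<close>

text \<open>
  An endomorphism of \<open>Y\<close> is represented by the function that agrees with it on \<open>Y\<close> and is zero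
  off \<open>Y\<close>.
\<close>

definition scale_endo ::
  "'k::field \<Rightarrow> (('b \<Rightarrow> 'k) \<Rightarrow> 'b \<Rightarrow> 'k) \<Rightarrow> ('b \<Rightarrow> 'k) \<Rightarrow> 'b \<Rightarrow> 'k" where
  "scale_endo c f = (\<lambda>v. scale c (f v))"

lemma vector_space_scale_endo:
  "vector_space (scale_endo :: 'k::field \<Rightarrow> (('b \<Rightarrow> 'k) \<Rightarrow> 'b \<Rightarrow> 'k) \<Rightarrow> ('b \<Rightarrow> 'k) \<Rightarrow> 'b \<Rightarrow> 'k)"
  by unfold_locales (auto simp: scale_endo_def scale_def fun_eq_iff algebra_simps)

definition endomorphisms ::
  "('g, 'm) monoid_scheme \<Rightarrow> ('g set \<Rightarrow> 'k::field) set
     \<Rightarrow> (('g set \<Rightarrow> 'k) \<Rightarrow> 'g set \<Rightarrow> 'k) set" where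
  "endomorphisms G Y =
     {f. (\<forall>v. v \<notin> Y \<longrightarrow> f v = 0) \<and> (\<forall>v\<in>Y. f v \<in> Y) \<and>
         (\<forall>u\<in>Y. \<forall>v\<in>Y. f (u + v) = f u + f v) \<and>
         (\<forall>a\<in>group_algebra G. \<forall>v\<in>Y. f (algebra_act G a v) = algebra_act G a (f v))}"

definition endo_algebra ::
  "('g, 'm) monoid_scheme \<Rightarrow> ('g set \<Rightarrow> 'k::field) set
     \<Rightarrow> ('k, ('g set \<Rightarrow> 'k) \<Rightarrow> 'g set \<Rightarrow> 'k) module" where
  "endo_algebra G Y =
     \<lparr>carrier = endomorphisms G Y, mult = (\<circ>), one = (\<lambda>v. if v \<in> Y then v else 0),
      zero = 0, add = (+), module.smult = scale_endo\<rparr>"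


section \<open>Specht and Young modules for partitions with at most two parts\<close>

text \<open>
  All notions refer to the \<open>\<mu>\<close>-tableau with first row \<open>1, \<dots>, \<mu>\<^sub>1\<close> and second row
  \<open>\<mu>\<^sub>1 + 1, \<dots>, \<mu>\<^sub>1 + \<mu>\<^sub>2\<close>.  Its row stabilizer is the Young subgroup, so the coset \<open>g \<Sigma>\<^sub>\<mu>\<close> is the
  tabloid of the tableau obtained by applying \<open>g\<close> to the entries.
\<close>

definition young_subgroup :: "nat \<Rightarrow> nat \<Rightarrow> (nat \<Rightarrow> nat) set" where
  "young_subgroup \<mu>\<^sub>1 \<mu>\<^sub>2 =
     {p \<in> carrier (sym_group (\<mu>\<^sub>1 + \<mu>\<^sub>2)).
        p ` {1..\<mu>\<^sub>1} = {1..\<mu>\<^sub>1} \<and> p ` {\<mu>\<^sub>1 + 1..\<mu>\<^sub>1 + \<mu>\<^sub>2} = {\<mu>\<^sub>1 + 1..\<mu>\<^sub>1 + \<mu>\<^sub>2}}"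

definition column_stabilizer :: "nat \<Rightarrow> nat \<Rightarrow> (nat \<Rightarrow> nat) set" where
  "column_stabilizer \<mu>\<^sub>1 \<mu>\<^sub>2 =
     {p \<in> carrier (sym_group (\<mu>\<^sub>1 + \<mu>\<^sub>2)).
        (\<forall>j\<in>{1..\<mu>\<^sub>2}. p ` {j, \<mu>\<^sub>1 + j} = {j, \<mu>\<^sub>1 + j}) \<and> (\<forall>j\<in>{\<mu>\<^sub>2 + 1..\<mu>\<^sub>1}. p j = j)}"

abbreviation young_perm_module :: "nat \<Rightarrow> nat \<Rightarrow> ((nat \<Rightarrow> nat) set \<Rightarrow> 'k::field) set" where
  "young_perm_module \<mu>\<^sub>1 \<mu>\<^sub>2 \<equiv> perm_module (sym_group (\<mu>\<^sub>1 + \<mu>\<^sub>2)) (young_subgroup \<mu>\<^sub>1 \<mu>\<^sub>2)"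

definition polytabloid :: "nat \<Rightarrow> nat \<Rightarrow> (nat \<Rightarrow> nat) set \<Rightarrow> 'k::field" where
  "polytabloid \<mu>\<^sub>1 \<mu>\<^sub>2 =
     algebra_act (sym_group (\<mu>\<^sub>1 + \<mu>\<^sub>2))
       (\<lambda>p. if p \<in> column_stabilizer \<mu>\<^sub>1 \<mu>\<^sub>2 then of_int (sign p) else 0)
       (\<lambda>C. if C = young_subgroup \<mu>\<^sub>1 \<mu>\<^sub>2 then 1 else 0)"

text \<open>The polytabloids of the other tableaux are the translates of \<^const>\<open>polytabloid\<close>.\<close>

definition specht_module :: "nat \<Rightarrow> nat \<Rightarrow> ((nat \<Rightarrow> nat) set \<Rightarrow> 'k::field) set" where
  "specht_module \<mu>\<^sub>1 \<mu>\<^sub>2 =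
     module.span scale
       ((\<lambda>g. group_act (sym_group (\<mu>\<^sub>1 + \<mu>\<^sub>2)) g (polytabloid \<mu>\<^sub>1 \<mu>\<^sub>2))
          ` carrier (sym_group (\<mu>\<^sub>1 + \<mu>\<^sub>2)))"

text \<open>
  As a submodule, the Young module depends on the chosen decomposition (only its isomorphism class
  does not), so it is a predicate on submodules.
\<close>

definition is_young_module :: "nat \<Rightarrow> nat \<Rightarrow> ((nat \<Rightarrow> nat) set \<Rightarrow> 'k::field) set \<Rightarrow> bool" where
  "is_young_module \<mu>\<^sub>1 \<mu>\<^sub>2 Y \<longleftrightarrow>
     (\<exists>D. indecomposable_decomposition (sym_group (\<mu>\<^sub>1 + \<mu>\<^sub>2)) (young_subgroup \<mu>\<^sub>1 \<mu>\<^sub>2) D \<and>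
          Y \<in> D \<and> specht_module \<mu>\<^sub>1 \<mu>\<^sub>2 \<subseteq> Y)"


section \<open>Truncated polynomial algebras\<close>

text \<open>
  A polynomial is a finitely supported map from exponent vectors \<open>nat \<Rightarrow>\<^sub>0 nat\<close> to \<open>K\<close>; the
  multiplication on this type is the convolution product.
\<close>

type_synonym 'k mpoly = "(nat \<Rightarrow>\<^sub>0 nat) \<Rightarrow>\<^sub>0 'k"

definition mpoly_var :: "nat \<Rightarrow> 'k::field mpoly" where
  "mpoly_var i = Poly_Mapping.single (Poly_Mapping.single i 1) 1"

definition mpoly_const :: "'k::field \<Rightarrow> 'k mpoly" where
  "mpoly_const c = Poly_Mapping.single 0 c"

definition mpoly_ring :: "nat \<Rightarrow> 'k::field mpoly ring" where
  "mpoly_ring k =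
     ring_of_type_algebra\<lparr>carrier := {p. \<forall>m\<in>Poly_Mapping.keys p. Poly_Mapping.keys m \<subseteq> {1..k}}\<rparr>"

definition quotient_algebra ::
  "nat \<Rightarrow> 'k::field mpoly set \<Rightarrow> ('k, 'k mpoly set) module" where
  "quotient_algebra k S =
     (let P = mpoly_ring k; I = Idl\<^bsub>P\<^esub> S in
      ring.extend (P Quot I) \<lparr>module.smult = (\<lambda>c C. (I +>\<^bsub>P\<^esub> mpoly_const c) \<otimes>\<^bsub>P Quot I\<^esub> C)\<rparr>)"

text \<open>A monomial without repeated factors is given by the set of indices of its factors.\<close>

definition sqfree_monomial :: "nat set \<Rightarrow> 'k::field mpoly" where
  "sqfree_monomial I = (\<Prod>i\<in>I. mpoly_var i)"

definition monomial_weight :: "nat set \<Rightarrow> nat" where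
  "monomial_weight I = (\<Sum>i\<in>I. 2 ^ i)"

definition monomial_position :: "nat \<Rightarrow> nat set \<Rightarrow> nat" where
  "monomial_position k I =
     card {J. J \<noteq> {} \<and> J \<subseteq> {1..k} \<and> monomial_weight J \<le> monomial_weight I}"

definition extra_relations :: "nat \<Rightarrow> nat \<Rightarrow> 'k::field mpoly set" where
  "extra_relations n k =
     {sqfree_monomial I | I. I \<subseteq> {1..k} \<and> k \<in> I \<and> monomial_position k I \<ge> n}"

definition truncated_algebra :: "nat \<Rightarrow> nat \<Rightarrow> ('k::field, 'k mpoly set) module" where
  "truncated_algebra n k =
     quotient_algebra k ({mpoly_var i ^ 2 | i. i \<in> {1..k}} \<union> extra_relations n k)"


section \<open>Isomorphism of algebras\<close>

definition algebra_iso ::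
  "('k::field, 'a, 'm) module_scheme \<Rightarrow> ('k, 'b, 'n) module_scheme \<Rightarrow> ('a \<Rightarrow> 'b) set" where
  "algebra_iso A B =
     {h \<in> ring_iso A B. \<forall>c. \<forall>a\<in>carrier A. h (c \<odot>\<^bsub>A\<^esub> a) = c \<odot>\<^bsub>B\<^esub> h a}"

definition algebra_isomorphic ::
  "('k::field, 'a, 'm) module_scheme \<Rightarrow> ('k, 'b, 'n) module_scheme \<Rightarrow> bool" where
  "algebra_isomorphic A B \<longleftrightarrow> algebra_iso A B \<noteq> {}"

end

theory Submission
  imports Defs "HOL-Combinatorics.Permutations" "HOL-Library.Nat_Bijection"
begin

text \<open>
  Put \<open>m = \<mu>\<^sub>1 - \<mu>\<^sub>2\<close> and \<open>s = \<mu>\<^sub>2\<close>. The permutation module \<open>M\<close> has as basis the \<open>s\<close>-element subsets (second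
  rows of tabloids) of \<open>r = m + 2 s\<close> points. Since the symmetric group is transitive on pairs of subsets
  with given intersection size, the endomorphism algebra of \<open>M\<close> is the algebra of the Johnson scheme. It
  has a basis \<open>b\<^sub>0, \<dots>, b\<^sub>s\<close>, where the matrix entry of \<open>b\<^sub>u\<close> at \<open>S, T\<close> is \<open>card (S \<inter> T) choose (s - u)\<close>
  (theorems \<open>endomorphism_of_M_eq_sum_johnson\<close> and \<open>johnson_independent\<close>). In this basis
  \<open>b\<^sub>i b\<^sub>j = (\<Sum>u\<le>s. (m + i + j choose (m + u)) (u choose i) (u choose j) b\<^sub>u)\<close> by \<open>johnson_product\<close>; in
  particular the algebra is commutative.

  In characteristic \<open>2\<close> only the parities of these coefficients matter, and by Lucas' theorem they are
  determined by binary expansions. Call \<open>a\<close> a digit of \<open>u\<close> if \<open>2 ^ a\<close> occurs in the binary expansion of \<open>u\<close>. If \<open>i\<close> and \<open>j\<close> have no common digit, then \<open>b\<^sub>i b\<^sub>j = b\<^sub>i\<^sub>+\<^sub>j\<close>, where \<open>b\<^sub>u = 0\<close>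
  for \<open>u > s\<close>. Hence \<open>b\<^sub>u\<close> is the product of the \<open>b\<close> with index \<open>2 ^ a\<close> over the digits \<open>a\<close> of \<open>u\<close>, and the
  square of the \<open>b\<close> with index \<open>2 ^ a\<close> is known up to elements with a digit \<open>c < a\<close> that is also a digit of \<open>m\<close>.

  The Young module \<open>Y\<close> is a direct summand of \<open>M\<close>. The projection onto \<open>Y\<close> is a combination of the \<open>b\<^sub>u\<close> and
  commutes with them, so they preserve \<open>Y\<close> and their restrictions span its endomorphism algebra. Since \<open>Y\<close>
  is indecomposable, its only idempotent endomorphisms are \<open>0\<close> and \<open>1\<close>. Since \<open>Y\<close> contains the Specht module,
  it contains the polytabloid, which is killed by all \<open>b\<^sub>u\<close> with \<open>u > 0\<close>. Induction on \<open>a\<close> then determines the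
  generators on \<open>Y\<close>: if \<open>a\<close> is a digit of \<open>m\<close>, the generator with index \<open>2 ^ a\<close> is idempotent and kills the
  polytabloid, so it is zero (\<open>johnson_vanishes_on_Y\<close>); otherwise its square is zero. So the endomorphism algebra
  of \<open>Y\<close> is spanned by the \<open>b\<^sub>u\<close> with \<open>u \<le> s\<close> that have no digit in common with \<open>m\<close>. These are linearly
  independent on \<open>Y\<close> (\<open>johnson_independent_on_Y\<close>), because the idempotent complementary to the projection has
  no component along them. Therefore \<open>n\<close> is the number of such \<open>u\<close>.

  Finally let \<open>a\<^sub>1 < a\<^sub>2 < \<dots>\<close> be the digits that \<open>m\<close> does not use, and let \<open>x\<^sub>i\<close> act as the generator with
  index \<open>2 ^ a\<^sub>i\<close>. A square-free monomial with index set \<open>I\<close> acts as \<open>b\<^sub>u\<close> for the number \<open>u = \<psi> I\<close> with digits \<open>a\<^sub>i\<close>,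
  \<open>i \<in> I\<close>. The order on monomials is the order of these numbers, so the monomials of position at least \<open>n\<close>
  are exactly those with \<open>\<psi> I > s\<close> (\<open>position_ge_iff\<close>), that is, those that act as zero. Together with the squares
  of the variables they generate the kernel of the action (\<open>kernel_\<Phi>\<close>).
\<close>


section \<open>Binomial coefficients modulo two\<close>

lemma zero_choose: "(0 choose k) = of_bool (k = 0)"
  by (cases k) auto

text \<open>
  Lucas' theorem modulo \<open>2\<close>, one binary digit at a time: apply Pascal's rule twice, and the middle term
  occurs twice.
\<close>
lemma choose_double_mod_2:
  "odd (2 * n choose (2 * k)) \<longleftrightarrow> odd (n choose k)"
  "even (2 * n choose Suc (2 * k))"
proof (induction n arbitrary: k)
  case (Suc n)
  {
    case 1
    show ?case
    proof (cases k)
      case (Suc j)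
      have "2 * Suc n choose (2 * k) =
        (2 * n choose (2 * j)) + 2 * (2 * n choose Suc (2 * j)) + (2 * n choose (2 * Suc j))"
        unfolding Suc by simp
      then show ?thesis
        using Suc.IH(1)[of j] Suc.IH(1)[of "Suc j"] Suc.IH(2)[of j] Suc by simp
    qed simp
  next
    case 2
    show ?case
    proof (cases k)
      case (Suc j)
      have "2 * Suc n choose Suc (2 * k) =
        (2 * n choose Suc (2 * j)) + 2 * (2 * n choose (2 * Suc j)) + (2 * n choose Suc (2 * k))"
        unfolding Suc by simp
      moreover have "even ((2 * n choose Suc (2 * j)) + 2 * (2 * n choose (2 * Suc j)) + (2 * n choose Suc (2 * k)))"
        using Suc.IH(2)[of j] Suc.IH(2)[of k] by simp
      ultimately show ?thesis by (simp only:)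
    qed simp
  }
qed (auto simp: zero_choose)

lemma choose_mod_2_rec:
  "odd (n choose k) \<longleftrightarrow> odd (n div 2 choose (k div 2)) \<and> (odd k \<longrightarrow> odd n)"
proof -
  obtain q where n: "n = 2 * q \<or> n = Suc (2 * q)" by (metis oddE evenE Suc_eq_plus1)
  obtain j where k: "k = 2 * j \<or> k = Suc (2 * j)" by (metis oddE evenE Suc_eq_plus1)
  have "odd (Suc (2 * q) choose (2 * j)) \<longleftrightarrow> odd (q choose j)"
    using choose_double_mod_2 [of q j] choose_double_mod_2(2) [of q "j - 1"] by (cases j) auto
  with n k show ?thesis
    using choose_double_mod_2 [of q j] by auto
qed

lemma nat_eq_0_iff_no_bit:
  "(k::nat) = 0 \<longleftrightarrow> (\<forall>a. \<not> bit k a)"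
  by (simp add: bit_eq_iff[of k 0])

text \<open>
  Iterating the digit step: \<open>n choose k\<close> is odd iff every binary digit of \<open>k\<close> is a digit of \<open>n\<close>.
  All parity questions below are questions about containment of sets of binary digits.
\<close>
lemma odd_choose_iff:
  "odd (n choose k) \<longleftrightarrow> (\<forall>a. bit k a \<longrightarrow> bit n a)"
proof (induction n arbitrary: k rule: less_induct)
  case (less n)
  show ?case
  proof (cases "n = 0")
    case True
    then show ?thesis
      using nat_eq_0_iff_no_bit[of k] by (auto simp: zero_choose)
  next
    case False
    have "odd (n choose k) \<longleftrightarrow> (\<forall>a. bit k (Suc a) \<longrightarrow> bit n (Suc a)) \<and> (bit k 0 \<longrightarrow> bit n 0)"
      using less[of "n div 2" "k div 2"] False
      by (subst choose_mod_2_rec) (simp add: bit_Suc bit_0)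
    also have "\<dots> \<longleftrightarrow> (\<forall>a. bit k a \<longrightarrow> bit n a)"
      by (metis nat.exhaust)
    finally show ?thesis .
  qed
qed

text \<open>
  Without carries, \<open>i + j\<close> is the least number that contains the digits of \<open>i\<close> and of \<open>j\<close>.
\<close>
lemma disjoint_bits_add_le:
  fixes i j u :: nat
  assumes "\<And>a. bit i a \<Longrightarrow> bit u a" "\<And>a. bit j a \<Longrightarrow> bit u a" "\<And>a. \<not> (bit i a \<and> bit j a)"
  shows "i + j \<le> u"
  using assms
proof (induction u arbitrary: i j rule: less_induct)
  case (less u)
  show ?case
  proof (cases "u = 0")
    case True
    then have "i = 0" "j = 0" using less.prems by (auto simp: nat_eq_0_iff_no_bit)
    then show ?thesis by simp
  next
    case False
    have 1: "i div 2 + j div 2 \<le> u div 2"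
      using False less.prems by (intro less.IH) (auto simp flip: bit_Suc)
    have 2: "(odd i \<longrightarrow> odd u) \<and> (odd j \<longrightarrow> odd u) \<and> \<not> (odd i \<and> odd j)"
      using less.prems[of 0] by (simp add: bit_0)
    show ?thesis using 1 2 by presburger
  qed
qed

text \<open>
  The lowest digit of \<open>w\<close> is a digit neither of \<open>m\<close> nor of \<open>2 * w\<close>, and below it \<open>2 * w\<close> has no
  digit that could carry into it.
\<close>
lemma even_choose_shifted:
  fixes m w :: nat
  assumes "w > 0" "\<And>a. \<not> (bit m a \<and> bit w a)"
  shows "even (m + 2 * w choose w)"
  using assms
proof (induction w arbitrary: m rule: less_induct)
  case (less w)
  show ?case
  proof (cases "odd w")
    case True
    then have "even m" using less.prems(2)[of 0] by (simp add: bit_0)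
    with True show ?thesis using choose_mod_2_rec[of "m + 2 * w" w] by simp
  next
    case False
    then obtain v where v: "w = 2 * v" by blast
    have "\<not> (bit (m div 2) a \<and> bit v a)" for a
      using less.prems(2)[of "Suc a"] v by (simp add: bit_Suc)
    then have "even (m div 2 + 2 * v choose v)"
      using less.prems v by (intro less.IH) auto
    moreover have "(m + 2 * w) div 2 = m div 2 + 2 * v" using v by presburger
    ultimately show ?thesis using choose_mod_2_rec[of "m + 2 * w" w] v by simp
  qed
qed

text \<open>
  This controls the coefficients in the square of the basis element with index \<open>2 ^ a\<close>. Write
  \<open>u = 2 ^ a + w\<close>. If \<open>w > 0\<close>, then \<open>2 ^ a - w\<close> and \<open>w\<close> have the same lowest digit \<open>c < a\<close>, and oddness of
  the second coefficient forces \<open>c\<close> to be a digit of \<open>m\<close>.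
\<close>
lemma odd_square_coefficient:
  fixes m u a :: nat
  assumes "u \<le> 2 * 2 ^ a" "odd (u choose (2 ^ a))" "odd (m + 2 * 2 ^ a choose (2 * 2 ^ a - u))"
  shows "(u = 2 ^ a \<and> bit m a) \<or> (\<exists>c<a. bit m c \<and> bit u c)"
  using assms
proof (induction a arbitrary: m u)
  case 0
  then have "u = 1" by (cases u; cases "u = 2") auto
  with 0 show ?case by (simp add: bit_0)
next
  case (Suc a)
  define k where "k = 2 * 2 ^ Suc a - u"
  have half: "(m + 4 * 2 ^ a) div 2 = m div 2 + 2 * 2 ^ a" by presburger
  have k: "odd ((m div 2 + 2 * 2 ^ a) choose (k div 2))" "odd k \<longrightarrow> odd m"
    using Suc.prems(3) choose_mod_2_rec[of "m + 2 * 2 ^ Suc a" k] half by (simp_all add: k_def)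
  show ?case
  proof (cases "odd u")
    case True
    then have "odd k" using Suc.prems(1) by (simp add: k_def)
    with True k show ?thesis by (intro disjI2 exI[of _ 0]) (simp add: bit_0)
  next
    case False
    then obtain v where v: "u = 2 * v" by blast
    have "(v = 2 ^ a \<and> bit (m div 2) a) \<or> (\<exists>c<a. bit (m div 2) c \<and> bit v c)"
    proof (rule Suc.IH)
      show "v \<le> 2 * 2 ^ a" using Suc.prems(1) v by simp
      show "odd (v choose 2 ^ a)"
        using Suc.prems(2) choose_mod_2_rec[of u "2 ^ Suc a"] v by simp
      have "k div 2 = 2 * 2 ^ a - v" using v by (simp add: k_def)
      then show "odd (m div 2 + 2 * 2 ^ a choose (2 * 2 ^ a - v))" using k by simp
    qed
    moreover have "bit (m div 2) c \<longleftrightarrow> bit m (Suc c)" "bit v c \<longleftrightarrow> bit u (Suc c)" for c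
      using v by (simp_all add: bit_Suc)
    ultimately have "(v = 2 ^ a \<and> bit m (Suc a)) \<or> (\<exists>c<a. bit m (Suc c) \<and> bit u (Suc c))"
      by simp
    then show ?thesis
      using v by (metis Suc_less_eq power_Suc)
  qed
qed

section \<open>A product formula for intersection numbers\<close>

lemma card_intermediate_subsets:
  assumes "finite \<Omega>" "P \<subseteq> \<Omega>" "s \<le> card \<Omega>"
  shows "card {T. P \<subseteq> T \<and> T \<subseteq> \<Omega> \<and> card T = s} = (card \<Omega> - card P choose (card \<Omega> - s))"
proof -
  have "bij_betw (\<lambda>T. \<Omega> - T) {T. P \<subseteq> T \<and> T \<subseteq> \<Omega> \<and> card T = s}
          {V. V \<subseteq> \<Omega> - P \<and> card V = card \<Omega> - s}"
  proof (rule bij_betw_byWitness[where f' = "\<lambda>T. \<Omega> - T"])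
    show "(\<lambda>T. \<Omega> - T) ` {T. P \<subseteq> T \<and> T \<subseteq> \<Omega> \<and> card T = s} \<subseteq> {V. V \<subseteq> \<Omega> - P \<and> card V = card \<Omega> - s}"
      using assms by (auto simp: card_Diff_subset finite_subset)
    have "card (\<Omega> - V) = s" if "V \<subseteq> \<Omega> - P" "card V = card \<Omega> - s" for V
    proof -
      have "V \<subseteq> \<Omega>" "finite V" using that assms finite_subset by blast+
      then show ?thesis using that assms by (simp add: card_Diff_subset)
    qed
    then show "(\<lambda>T. \<Omega> - T) ` {V. V \<subseteq> \<Omega> - P \<and> card V = card \<Omega> - s} \<subseteq> {T. P \<subseteq> T \<and> T \<subseteq> \<Omega> \<and> card T = s}"
      using assms by auto
  qed (use assms in auto)
  then have "card {T. P \<subseteq> T \<and> T \<subseteq> \<Omega> \<and> card T = s} = card {V. V \<subseteq> \<Omega> - P \<and> card V = card \<Omega> - s}"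
    by (rule bij_betw_same_card)
  also have "\<dots> = (card (\<Omega> - P) choose (card \<Omega> - s))"
    using assms by (intro n_subsets) auto
  finally show ?thesis using assms by (simp add: card_Diff_subset finite_subset)
qed

lemma choose_inter_eq_sum:
  assumes "finite S" "A \<subseteq> S"
  shows "(card A choose k) = (\<Sum>P | P \<subseteq> S \<and> card P = k. of_bool (P \<subseteq> A))"
proof -
  have "finite A" using assms finite_subset by blast
  have "(\<Sum>P | P \<subseteq> S \<and> card P = k. of_bool (P \<subseteq> A) :: nat) = card ({P. P \<subseteq> S \<and> card P = k} \<inter> {P. P \<subseteq> A})"
    using assms by (subst sum_of_bool_eq) auto
  also have "{P. P \<subseteq> S \<and> card P = k} \<inter> {P. P \<subseteq> A} = {P. P \<subseteq> A \<and> card P = k}"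
    using assms by auto
  finally show ?thesis using \<open>finite A\<close> by (simp add: n_subsets)
qed

text \<open>
  The form in which Vandermonde's identity is used: the summands with lower index below \<open>m\<close> vanish
  because \<open>p \<le> s\<close>.
\<close>
lemma vandermonde_shifted:
  fixes m d p s :: nat
  assumes "p \<le> s"
  shows "(d + p choose (m + s)) = (\<Sum>u\<le>s. (d choose (m + u)) * (p choose (s - u)))"
proof -
  have "(d + p choose (m + s)) = (\<Sum>k\<le>m+s. (d choose k) * (p choose (m + s - k)))"
    by (rule vandermonde[symmetric])
  also have "\<dots> = (\<Sum>k\<in>{m..m+s}. (d choose k) * (p choose (m + s - k)))"
    using assms by (intro sum.mono_neutral_right) auto
  also have "\<dots> = (\<Sum>u\<le>s. (d choose (m + u)) * (p choose (s - u)))"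
    by (rule sum.reindex_bij_witness[where j = "\<lambda>k. k - m" and i = "\<lambda>u. m + u"]) (auto simp: add.commute)
  finally show ?thesis .
qed

text \<open>
  Both sides count configurations. On the left, count triples \<open>P \<subseteq> S \<inter> T\<close>, \<open>Q \<subseteq> T \<inter> U\<close>, \<open>T\<close>: for given
  \<open>P\<close> and \<open>Q\<close> the number of sets \<open>T\<close> is a binomial coefficient in \<open>card (P \<inter> Q)\<close>. Vandermonde's identity
  expands it in the numbers \<open>card (P \<inter> Q) choose (s - u)\<close> of subsets \<open>W \<subseteq> P \<inter> Q\<close>, and for given \<open>W\<close> the
  numbers of sets \<open>P\<close> and \<open>Q\<close> above \<open>W\<close> are \<open>u choose i\<close> and \<open>u choose j\<close>.
\<close>
theorem intersection_choose_product:
  fixes \<Omega> S U :: "'a set"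
  assumes \<Omega>: "finite \<Omega>" "card \<Omega> = m + 2 * s"
    and S: "S \<subseteq> \<Omega>" "card S = s" and U: "U \<subseteq> \<Omega>" "card U = s"
    and ij: "i \<le> s" "j \<le> s"
  shows "(\<Sum>T | T \<subseteq> \<Omega> \<and> card T = s. (card (S \<inter> T) choose (s - i)) * (card (T \<inter> U) choose (s - j)))
     = (\<Sum>u\<le>s. (m + i + j choose (m + u)) * (u choose i) * (u choose j) * (card (S \<inter> U) choose (s - u)))"
proof -
  define TT where "TT = {T. T \<subseteq> \<Omega> \<and> card T = s}"
  define PP where "PP = {P. P \<subseteq> S \<and> card P = s - i}"
  define QQ where "QQ = {Q. Q \<subseteq> U \<and> card Q = s - j}"
  define WW where "WW u = {W. W \<subseteq> S \<inter> U \<and> card W = s - u}" for u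
  have finS: "finite S" "finite U" using S U \<Omega> finite_subset by blast+
  have fin: "finite TT" "finite PP" "finite QQ" "finite (WW u)" for u
    using \<Omega> finS by (auto simp: TT_def PP_def QQ_def WW_def)
  have card_WW: "card (WW u) = (card (S \<inter> U) choose (s - u))" for u
    unfolding WW_def using finS by (intro n_subsets) auto
  have T_count: "(\<Sum>T\<in>TT. of_bool (P \<subseteq> T) * of_bool (Q \<subseteq> T)) =
      (m + i + j + card (P \<inter> Q) choose (m + s))" if "P \<in> PP" "Q \<in> QQ" for P Q
  proof -
    have PQ: "P \<subseteq> \<Omega>" "Q \<subseteq> \<Omega>" "finite P" "finite Q" "card P = s - i" "card Q = s - j"
      using that S U \<Omega> finS finite_subset by (auto simp: PP_def QQ_def)
    have "(\<Sum>T\<in>TT. of_bool (P \<subseteq> T) * of_bool (Q \<subseteq> T) :: nat) = (\<Sum>T\<in>TT. of_bool (P \<union> Q \<subseteq> T))"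
      by (intro sum.cong) auto
    also have "\<dots> = card (TT \<inter> {T. P \<union> Q \<subseteq> T})"
      using fin by (subst sum_of_bool_eq) auto
    also have "TT \<inter> {T. P \<union> Q \<subseteq> T} = {T. P \<union> Q \<subseteq> T \<and> T \<subseteq> \<Omega> \<and> card T = s}"
      by (auto simp: TT_def)
    also have "card \<dots> = (card \<Omega> - card (P \<union> Q) choose (card \<Omega> - s))"
      using \<Omega> PQ by (intro card_intermediate_subsets) auto
    also have "card \<Omega> - card (P \<union> Q) = m + i + j + card (P \<inter> Q)"
      using card_Un_Int[of P Q] PQ \<Omega> ij card_mono[of P "P \<inter> Q"] by auto
    finally show ?thesis using \<Omega> by (simp add: add.commute)
  qed
  have superset_count: "(\<Sum>P | P \<subseteq> V \<and> card P = s - l. of_bool (W \<subseteq> P)) = (u choose l)"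
    if "finite V" "card V = s" "W \<subseteq> V" "card W = s - u" "u \<le> s" "l \<le> s" for V W :: "'a set" and u l
  proof -
    have "(\<Sum>P | P \<subseteq> V \<and> card P = s - l. of_bool (W \<subseteq> P) :: nat) =
      card ({P. P \<subseteq> V \<and> card P = s - l} \<inter> {P. W \<subseteq> P})"
      using that by (subst sum_of_bool_eq) auto
    also have "{P. P \<subseteq> V \<and> card P = s - l} \<inter> {P. W \<subseteq> P} = {P. W \<subseteq> P \<and> P \<subseteq> V \<and> card P = s - l}"
      by auto
    also have "card \<dots> = (card V - card W choose (card V - (s - l)))"
      using that by (intro card_intermediate_subsets) auto
    finally show ?thesis using that by simp
  qed
  have "(\<Sum>T\<in>TT. (card (S \<inter> T) choose (s - i)) * (card (T \<inter> U) choose (s - j)))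
    = (\<Sum>T\<in>TT. (\<Sum>P\<in>PP. of_bool (P \<subseteq> T)) * (\<Sum>Q\<in>QQ. of_bool (Q \<subseteq> T)))"
    using finS
    by (intro sum.cong refl arg_cong2[of _ _ _ _ "(*)"])
      (subst choose_inter_eq_sum[of S] choose_inter_eq_sum[of U]; force simp: PP_def QQ_def intro: sum.cong)+
  also have "\<dots> = (\<Sum>T\<in>TT. \<Sum>P\<in>PP. \<Sum>Q\<in>QQ. of_bool (P \<subseteq> T) * of_bool (Q \<subseteq> T))"
    by (simp add: sum_product)
  also have "\<dots> = (\<Sum>P\<in>PP. \<Sum>Q\<in>QQ. \<Sum>T\<in>TT. of_bool (P \<subseteq> T) * of_bool (Q \<subseteq> T))"
    by (subst sum.swap, rule sum.cong[OF refl], rule sum.swap)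
  also have "\<dots> = (\<Sum>P\<in>PP. \<Sum>Q\<in>QQ. (m + i + j + card (P \<inter> Q) choose (m + s)))"
    using T_count by simp
  also have "\<dots> = (\<Sum>P\<in>PP. \<Sum>Q\<in>QQ. \<Sum>u\<le>s. (m + i + j choose (m + u)) * (card (P \<inter> Q) choose (s - u)))"
  proof (intro sum.cong refl vandermonde_shifted)
    fix P Q assume "P \<in> PP"
    then show "card (P \<inter> Q) \<le> s"
      using card_mono[of S "P \<inter> Q"] finS S by (auto simp: PP_def)
  qed
  also have "\<dots> = (\<Sum>P\<in>PP. \<Sum>Q\<in>QQ. \<Sum>u\<le>s. \<Sum>W\<in>WW u. (m + i + j choose (m + u)) * (of_bool (W \<subseteq> P) * of_bool (W \<subseteq> Q)))"
  proof (intro sum.cong refl)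
    fix P Q u assume PQ: "P \<in> PP" "Q \<in> QQ"
    have "(card (P \<inter> Q) choose (s - u)) = (\<Sum>W | W \<subseteq> S \<inter> U \<and> card W = s - u. of_bool (W \<subseteq> P \<inter> Q))"
      using finS PQ by (intro choose_inter_eq_sum) (auto simp: PP_def QQ_def)
    also have "\<dots> = (\<Sum>W\<in>WW u. of_bool (W \<subseteq> P) * of_bool (W \<subseteq> Q))"
      unfolding WW_def by (intro sum.cong) auto
    finally show "(m + i + j choose (m + u)) * (card (P \<inter> Q) choose (s - u)) = 
      (\<Sum>W\<in>WW u. (m + i + j choose (m + u)) * (of_bool (W \<subseteq> P) * of_bool (W \<subseteq> Q)))"
      by (simp add: sum_distrib_left)
  qed
  also have "\<dots> = (\<Sum>P\<in>PP. \<Sum>u\<le>s. \<Sum>W\<in>WW u. \<Sum>Q\<in>QQ. (m + i + j choose (m + u)) * (of_bool (W \<subseteq> P) * of_bool (W \<subseteq> Q)))"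
    by (rule sum.cong[OF refl], subst sum.swap, rule sum.cong[OF refl], rule sum.swap)
  also have "\<dots> = (\<Sum>u\<le>s. \<Sum>W\<in>WW u. \<Sum>P\<in>PP. \<Sum>Q\<in>QQ. (m + i + j choose (m + u)) * (of_bool (W \<subseteq> P) * of_bool (W \<subseteq> Q)))"
    by (subst sum.swap, rule sum.cong[OF refl], rule sum.swap)
  also have "\<dots> = (\<Sum>u\<le>s. \<Sum>W\<in>WW u. (m + i + j choose (m + u)) * ((\<Sum>P\<in>PP. of_bool (W \<subseteq> P)) * (\<Sum>Q\<in>QQ. of_bool (W \<subseteq> Q))))"
    by (simp only: sum_product flip: sum_distrib_left)
  also have "\<dots> = (\<Sum>u\<le>s. \<Sum>W\<in>WW u. (m + i + j choose (m + u)) * ((u choose i) * (u choose j)))"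
    unfolding PP_def QQ_def
    using S U finS ij by (intro sum.cong refl arg_cong2[of _ _ _ _ "(*)"] superset_count) (auto simp: WW_def)
  also have "\<dots> = (\<Sum>u\<le>s. (m + i + j choose (m + u)) * (u choose i) * (u choose j) * (card (S \<inter> U) choose (s - u)))"
    by (simp add: card_WW mult_ac)
  finally show ?thesis by (simp add: TT_def)
qed

section \<open>Tabloids and second rows\<close>

lemma count_image_mset_set:
  assumes "finite \<Omega>"
  shows "count (image_mset f (mset_set \<Omega>)) y = card {x \<in> \<Omega>. f x = y}"
proof -
  have "f -` {y} \<inter> \<Omega> = {x \<in> \<Omega>. f x = y}" by auto
  then show ?thesis using assms by (simp add: count_image_mset)
qed

lemma card_membership_cell:
  assumes \<Omega>: "finite \<Omega>" and sub: "A \<subseteq> \<Omega>" "B \<subseteq> \<Omega>"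
  shows "card {x \<in> \<Omega>. (x \<in> A, x \<in> B) = (a, b)} =
      (if a then if b then card (A \<inter> B) else card A - card (A \<inter> B)
       else if b then card B - card (A \<inter> B) else card \<Omega> - (card A + card B - card (A \<inter> B)))"
proof -
  have fin: "finite A" "finite B" using assms finite_subset by blast+
  have un: "card (A \<union> B) = card A + card B - card (A \<inter> B)"
    using card_Un_Int[OF fin] by simp
  have d1: "card (A - A \<inter> B) = card A - card (A \<inter> B)"
    by (rule card_Diff_subset) (use fin in auto)
  have d2: "card (B - A \<inter> B) = card B - card (A \<inter> B)"
    by (rule card_Diff_subset) (use fin in auto)
  have d3: "card (\<Omega> - (A \<union> B)) = card \<Omega> - card (A \<union> B)"
    by (rule card_Diff_subset) (use fin sub in auto)
  have cell: "{x \<in> \<Omega>. (x \<in> A, x \<in> B) = (a, b)} =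
    (if a then if b then A \<inter> B else A - A \<inter> B else if b then B - A \<inter> B else \<Omega> - (A \<union> B))"
    using sub by (cases a; cases b) auto
  show ?thesis
    by (simp only: cell if_distrib[of card] d1 d2 d3 un)
qed

text \<open>
  A pair of subsets is a colouring of \<open>\<Omega>\<close> by two Booleans; two colourings whose colour classes have
  equal sizes differ by a permutation.
\<close>
lemma exists_permutation_of_pair:
  assumes \<Omega>: "finite \<Omega>" and sub: "S \<subseteq> \<Omega>" "T \<subseteq> \<Omega>" "S' \<subseteq> \<Omega>" "T' \<subseteq> \<Omega>"
    and eq: "card S = card S'" "card T = card T'" "card (S \<inter> T) = card (S' \<inter> T')"
  shows "\<exists>p. p permutes \<Omega> \<and> p ` S = S' \<and> p ` T = T'"
proof -
  define f where "f x = (x \<in> S, x \<in> T)" for x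
  define f' where "f' x = (x \<in> S', x \<in> T')" for x
  have count: "image_mset f (mset_set \<Omega>) = image_mset f' (mset_set \<Omega>)"
  proof (rule multiset_eqI)
    fix y :: "bool \<times> bool"
    obtain a b where y: "y = (a, b)" by (cases y)
    show "count (image_mset f (mset_set \<Omega>)) y = count (image_mset f' (mset_set \<Omega>)) y"
      by (simp only: count_image_mset_set[OF \<Omega>] y f_def f'_def eq
        card_membership_cell[OF \<Omega> sub(1,2)] card_membership_cell[OF \<Omega> sub(3,4)])
  qed
  obtain p where p: "p permutes \<Omega>" "\<forall>x\<in>\<Omega>. f x = f' (p x)"
    by (rule image_mset_eq_implies_permutes[OF \<Omega> count])
  have image: "p ` A = A'"
    if "A \<subseteq> \<Omega>" and A': "A' \<subseteq> \<Omega>" and iff: "\<And>x. x \<in> \<Omega> \<Longrightarrow> x \<in> A \<longleftrightarrow> p x \<in> A'" for A A'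
  proof
    show "p ` A \<subseteq> A'" using that(1) iff by (meson image_subsetI subsetD)
    show "A' \<subseteq> p ` A"
    proof
      fix y assume y: "y \<in> A'"
      then have "y \<in> p ` \<Omega>" using A' permutes_image[OF p(1)] by auto
      then obtain x where "x \<in> \<Omega>" "y = p x" by (rule imageE)
      with y iff[of x] show "y \<in> p ` A" by simp
    qed
  qed
  have "p ` S = S'" by (rule image) (use p(2) sub in \<open>simp_all add: f_def f'_def\<close>)
  moreover have "p ` T = T'" by (rule image) (use p(2) sub in \<open>simp_all add: f_def f'_def\<close>)
  ultimately show ?thesis using p(1) by blast
qed

locale two_row =
  fixes \<mu>\<^sub>1 \<mu>\<^sub>2 :: nat
  assumes \<mu>\<^sub>2_le_\<mu>\<^sub>1: "\<mu>\<^sub>2 \<le> \<mu>\<^sub>1"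
begin

abbreviation "G \<equiv> sym_group (\<mu>\<^sub>1 + \<mu>\<^sub>2)"
abbreviation "H \<equiv> young_subgroup \<mu>\<^sub>1 \<mu>\<^sub>2"

definition \<Omega> :: "nat set" where "\<Omega> = {1..\<mu>\<^sub>1 + \<mu>\<^sub>2}"
definition row :: "nat set" where "row = {\<mu>\<^sub>1 + 1..\<mu>\<^sub>1 + \<mu>\<^sub>2}"

lemma finite_\<Omega> [simp]: "finite \<Omega>"
  by (simp add: \<Omega>_def)

text \<open>
  A tabloid is determined by the set of entries of its second row, which is any set of \<open>\<mu>\<^sub>2\<close> points.
  As an element of the permutation module it is the coset of all permutations with that second row.
\<close>
definition rows :: "nat set set" where
  "rows = {S. S \<subseteq> \<Omega> \<and> card S = \<mu>\<^sub>2}"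

definition tabloid :: "nat set \<Rightarrow> (nat \<Rightarrow> nat) set" where
  "tabloid S = {q. q permutes \<Omega> \<and> q ` row = S}"

lemma finite_rows [simp]: "finite rows"
  by (simp add: rows_def)

lemma carrier_G [simp]: "carrier G = {p. p permutes \<Omega>}"
  by (simp add: sym_group_def \<Omega>_def)

lemma finite_carrier_G [simp]: "finite {p. p permutes \<Omega>}"
  by (simp add: finite_permutations)

lemma inv_G [simp]: "p permutes \<Omega> \<Longrightarrow> inv\<^bsub>G\<^esub> p = inv' p"
  using sym_group_inv_equality[of p "\<mu>\<^sub>1 + \<mu>\<^sub>2"] by simp

lemma l_coset_G: "p <#\<^bsub>G\<^esub> C = (\<lambda>q. p \<circ> q) ` C"
  by (auto simp: l_coset_def sym_group_mult)

lemma young_subgroup_eq_tabloid: "H = tabloid row"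
proof -
  have "p ` {1..\<mu>\<^sub>1} = {1..\<mu>\<^sub>1}" if "p permutes \<Omega>" "p ` row = row" for p
  proof -
    have "{1..\<mu>\<^sub>1} = \<Omega> - row" by (auto simp: \<Omega>_def row_def)
    moreover have "p ` (\<Omega> - row) = p ` \<Omega> - p ` row"
      using permutes_inj[OF that(1)] by (rule image_set_diff)
    ultimately show ?thesis using that permutes_image[OF that(1)] by simp
  qed
  moreover have "H = {p. p permutes \<Omega> \<and> p ` {1..\<mu>\<^sub>1} = {1..\<mu>\<^sub>1} \<and> p ` row = row}"
    by (simp add: young_subgroup_def row_def)
  ultimately show ?thesis by (auto simp: tabloid_def)
qed

lemma translate_tabloid:
  assumes "p permutes \<Omega>"
  shows "p <#\<^bsub>G\<^esub> tabloid S = tabloid (p ` S)"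
proof
  show "p <#\<^bsub>G\<^esub> tabloid S \<subseteq> tabloid (p ` S)"
  proof
    fix q assume "q \<in> p <#\<^bsub>G\<^esub> tabloid S"
    then obtain h where h: "h permutes \<Omega>" "h ` row = S" "q = p \<circ> h"
      by (auto simp: l_coset_G tabloid_def)
    have "q ` row = p ` (h ` row)" unfolding h(3) by (rule image_comp[symmetric])
    then show "q \<in> tabloid (p ` S)"
      using h assms by (simp add: tabloid_def permutes_compose)
  qed
  show "tabloid (p ` S) \<subseteq> p <#\<^bsub>G\<^esub> tabloid S"
  proof
    fix q assume q: "q \<in> tabloid (p ` S)"
    have "(inv' p \<circ> q) ` row = inv' p ` (q ` row)" by (rule image_comp[symmetric])
    also have "\<dots> = S"
      using q permutes_inj[OF assms] by (simp add: tabloid_def image_inv_f_f)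
    finally have "inv' p \<circ> q \<in> tabloid S"
      using q assms by (simp add: tabloid_def permutes_compose permutes_inv)
    moreover have "q = p \<circ> (inv' p \<circ> q)"
      using permutes_inv_o(1)[OF assms] by (simp add: o_assoc)
    ultimately show "q \<in> p <#\<^bsub>G\<^esub> tabloid S" unfolding l_coset_G by blast
  qed
qed

lemma row_in_rows: "row \<in> rows"
  by (auto simp: rows_def row_def \<Omega>_def)

lemma image_in_rows:
  assumes "p permutes \<Omega>" "S \<in> rows"
  shows "p ` S \<in> rows"
proof -
  have "p ` S \<subseteq> p ` \<Omega>" using assms by (auto simp: rows_def)
  moreover have "card (p ` S) = card S"
    using permutes_inj[OF assms(1)] by (intro card_image) (auto intro: inj_on_subset)
  ultimately show ?thesis using assms permutes_image[OF assms(1)] by (simp add: rows_def)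
qed

lemma rows_transitive:
  assumes "S \<in> rows" "T \<in> rows" "S' \<in> rows" "T' \<in> rows" "card (S \<inter> T) = card (S' \<inter> T')"
  shows "\<exists>p. p permutes \<Omega> \<and> p ` S = S' \<and> p ` T = T'"
  using assms by (intro exists_permutation_of_pair) (simp_all add: rows_def)

lemma permutation_to_row:
  assumes "S \<in> rows"
  shows "\<exists>p. p permutes \<Omega> \<and> p ` row = S"
  using rows_transitive[of row row S S] row_in_rows assms by (auto simp: rows_def)

text \<open>
  The Young subgroup is the stabilizer of \<open>row\<close>, and the symmetric group is transitive on sets of
  given size; so cosets and second rows correspond.
\<close>
lemma lcosets_eq_tabloids: "lcosets\<^bsub>G\<^esub> H = tabloid ` rows"
proof -
  have "lcosets\<^bsub>G\<^esub> H = (\<lambda>p. tabloid (p ` row)) ` {p. p permutes \<Omega>}"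
    by (auto simp: LCOSETS_def young_subgroup_eq_tabloid translate_tabloid)
  also have "\<dots> = tabloid ` rows"
  proof
    show "tabloid ` rows \<subseteq> (\<lambda>p. tabloid (p ` row)) ` {p. p permutes \<Omega>}"
    proof
      fix C assume "C \<in> tabloid ` rows"
      then obtain S where S: "S \<in> rows" "C = tabloid S" by blast
      obtain p where "p permutes \<Omega>" "p ` row = S" using permutation_to_row[OF S(1)] by blast
      then show "C \<in> (\<lambda>p. tabloid (p ` row)) ` {p. p permutes \<Omega>}" using S by blast
    qed
  qed (use image_in_rows[OF _ row_in_rows] in blast)
  finally show ?thesis .
qed

lemma inj_on_tabloid: "inj_on tabloid rows"
proof
  fix S T assume ST: "S \<in> rows" "T \<in> rows" "tabloid S = tabloid T"
  obtain p where "p permutes \<Omega>" "p ` row = S"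
    using permutation_to_row[OF ST(1)] by blast
  then have "p \<in> tabloid S" by (simp add: tabloid_def)
  then have "p \<in> tabloid T" using ST by simp
  then show "S = T" using \<open>p ` row = S\<close> by (simp add: tabloid_def)
qed

lemma tabloid_eq_iff [simp]: "S \<in> rows \<Longrightarrow> T \<in> rows \<Longrightarrow> tabloid S = tabloid T \<longleftrightarrow> S = T"
  using inj_on_tabloid by (auto simp: inj_on_def)

abbreviation M :: "((nat \<Rightarrow> nat) set \<Rightarrow> 'k::field) set" where
  "M \<equiv> young_perm_module \<mu>\<^sub>1 \<mu>\<^sub>2"

lemma M_iff: "v \<in> M \<longleftrightarrow> (\<forall>C. C \<notin> tabloid ` rows \<longrightarrow> v C = 0)"
  by (simp add: perm_module_def lcosets_eq_tabloids)

lemma M_eqI: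
  assumes "v \<in> M" "w \<in> M" "\<And>S. S \<in> rows \<Longrightarrow> v (tabloid S) = w (tabloid S)"
  shows "v = w"
proof
  fix C show "v C = w C" using assms by (cases "C \<in> tabloid ` rows") (auto simp: M_iff)
qed

lemma group_act_tabloid:
  "p permutes \<Omega> \<Longrightarrow> group_act G p v (tabloid S) = v (tabloid (inv' p ` S))"
  by (simp add: group_act_def translate_tabloid permutes_inv)

lemma group_act_in_M:
  assumes "p permutes \<Omega>" "v \<in> M"
  shows "group_act G p v \<in> M"
  unfolding M_iff
proof (intro allI impI)
  fix C assume C: "C \<notin> tabloid ` rows"
  have "inv' p <#\<^bsub>G\<^esub> C \<notin> tabloid ` rows"
  proof
    assume "inv' p <#\<^bsub>G\<^esub> C \<in> tabloid ` rows"
    then obtain S where S: "S \<in> rows" "inv' p <#\<^bsub>G\<^esub> C = tabloid S" by blast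
    have "C = p <#\<^bsub>G\<^esub> (inv' p <#\<^bsub>G\<^esub> C)"
      using permutes_inv_o(1)[OF assms(1)] by (simp add: l_coset_G image_image o_assoc)
    also have "\<dots> = tabloid (p ` S)" using S assms by (simp add: translate_tabloid)
    finally show False using C S image_in_rows[OF assms(1)] by blast
  qed
  then show "group_act G p v C = 0" using assms by (simp add: group_act_def M_iff)
qed

end

section \<open>Endomorphisms of the permutation module\<close>

lemma scale_apply [simp]: "scale c v C = c * v C"
  by (simp add: scale_def)

lemma sum_apply: "(\<Sum>i\<in>I. f i) C = (\<Sum>i\<in>I. f i C)"
  by (induction I rule: infinite_finite_induct) auto

text \<open>
  Newton interpolation: the matrix of the numbers \<open>x choose k\<close> is unitriangular, so the functions
  \<open>\<lambda>x. x choose k\<close> with \<open>k \<le> n\<close> are a basis of the functions on \<open>{0..n}\<close> over any field.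
\<close>
lemma newton_expansion:
  fixes g :: "nat \<Rightarrow> 'k::field"
  shows "\<exists>c. \<forall>x\<le>n. g x = (\<Sum>k\<le>n. c k * of_nat (x choose k))"
proof (induction n)
  case 0
  show ?case by (rule exI[of _ g]) simp
next
  case (Suc n)
  then obtain c where c: "\<And>x. x \<le> n \<Longrightarrow> g x = (\<Sum>k\<le>n. c k * of_nat (x choose k))" by blast
  define c' where "c' = c(Suc n := g (Suc n) - (\<Sum>k\<le>n. c k * of_nat (Suc n choose k)))"
  have split: "(\<Sum>k\<le>Suc n. c' k * of_nat (x choose k)) =
      (\<Sum>k\<le>n. c k * of_nat (x choose k)) + c' (Suc n) * of_nat (x choose Suc n)" for x
    by (simp add: c'_def)
  have "g x = (\<Sum>k\<le>Suc n. c' k * of_nat (x choose k))" if "x \<le> Suc n" for x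
  proof (cases "x = Suc n")
    case True
    then show ?thesis unfolding split by (simp add: c'_def del: binomial_Suc_Suc)
  next
    case False
    then have "x \<le> n" using that by simp
    then show ?thesis unfolding split using c by (simp add: binomial_eq_0)
  qed
  then show ?case by blast
qed

lemma newton_unique:
  fixes c :: "nat \<Rightarrow> 'k::field"
  assumes "\<And>x. x \<le> n \<Longrightarrow> (\<Sum>k\<le>n. c k * of_nat (x choose k)) = 0" "x \<le> n"
  shows "c x = 0"
  using assms(2)
proof (induction x rule: less_induct)
  case (less x)
  have "(\<Sum>k\<le>n. c k * of_nat (x choose k)) = (\<Sum>k\<in>{x}. c k * of_nat (x choose k))"
  proof (intro sum.mono_neutral_right ballI)
    fix k assume "k \<in> {..n} - {x}"
    then show "c k * of_nat (x choose k) = 0"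
      using less by (cases "k < x") (auto simp: binomial_eq_0)
  qed (use less.prems in auto)
  then show ?case using assms(1)[of x] less.prems by simp
qed

context two_row
begin

text \<open>
  The symmetric group is transitive on pairs of second rows with given intersection size, hence the
  matrix of an endomorphism of \<open>M\<close> depends only on that size. The summation over \<open>S\<close> makes the
  result vanish off the set of tabloids.
\<close>
definition invariant_op ::
  "(nat \<Rightarrow> 'k::field) \<Rightarrow> ((nat \<Rightarrow> nat) set \<Rightarrow> 'k) \<Rightarrow> (nat \<Rightarrow> nat) set \<Rightarrow> 'k" where
  "invariant_op g v = (\<lambda>C. \<Sum>S\<in>rows. if C = tabloid S
      then (\<Sum>T\<in>rows. g (card (S \<inter> T)) * v (tabloid T)) else 0)"

text \<open>
  The basis of the Johnson scheme algebra in which multiplication is simplest: remove \<open>u\<close> elements from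
  a second row in all ways, then add \<open>u\<close> elements in all ways. In terms of the Lie algebra \<open>sl\<^sub>2\<close> this is
  the product of divided powers \<open>f\<^sup>(\<^sup>u\<^sup>) e\<^sup>(\<^sup>u\<^sup>)\<close>. For \<open>u > \<mu>\<^sub>2\<close> no \<open>u\<close> elements can be removed, and the value
  must be \<open>0\<close>, whereas \<open>x choose (\<mu>\<^sub>2 - u)\<close> would be \<open>1\<close>.
\<close>
definition johnson ::
  "nat \<Rightarrow> ((nat \<Rightarrow> nat) set \<Rightarrow> 'k::field) \<Rightarrow> (nat \<Rightarrow> nat) set \<Rightarrow> 'k" where
  "johnson u = invariant_op (\<lambda>x. if u \<le> \<mu>\<^sub>2 then of_nat (x choose (\<mu>\<^sub>2 - u)) else 0)"

lemma invariant_op_tabloid: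
  assumes "S \<in> rows"
  shows "invariant_op g v (tabloid S) = (\<Sum>T\<in>rows. g (card (S \<inter> T)) * v (tabloid T))"
proof -
  have "invariant_op g v (tabloid S) = (\<Sum>S'\<in>rows. if S = S'
      then (\<Sum>T\<in>rows. g (card (S' \<inter> T)) * v (tabloid T)) else 0)"
    unfolding invariant_op_def by (intro sum.cong) (use assms in auto)
  also have "\<dots> = (\<Sum>T\<in>rows. g (card (S \<inter> T)) * v (tabloid T))"
    using assms by (simp add: sum.delta)
  finally show ?thesis .
qed

lemma invariant_op_in_M: "invariant_op g v \<in> M"
  unfolding M_iff invariant_op_def by (intro allI impI sum.neutral) auto

lemma johnson_in_M: "johnson u v \<in> M"
  by (simp add: johnson_def invariant_op_in_M)

lemma johnson_tabloid:
  assumes "S \<in> rows" "u \<le> \<mu>\<^sub>2"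
  shows "johnson u v (tabloid S) = (\<Sum>T\<in>rows. of_nat (card (S \<inter> T) choose (\<mu>\<^sub>2 - u)) * v (tabloid T))"
  unfolding johnson_def invariant_op_tabloid[OF assms(1)] using assms(2) by simp

lemma johnson_eq_0: "\<mu>\<^sub>2 < u \<Longrightarrow> johnson u v = 0"
  by (simp add: johnson_def invariant_op_def fun_eq_iff cong: if_cong)

lemma zero_in_M: "0 \<in> M" by (simp add: M_iff)

lemma add_in_M: "v \<in> M \<Longrightarrow> w \<in> M \<Longrightarrow> v + w \<in> M" by (simp add: M_iff)

lemma scale_in_M: "v \<in> M \<Longrightarrow> scale c v \<in> M" by (simp add: M_iff)

lemma invariant_op_add: "invariant_op g (v + w) = invariant_op g v + invariant_op g w"
  by (rule M_eqI)
     (auto simp: invariant_op_tabloid invariant_op_in_M add_in_M distrib_left sum.distrib)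

lemma sum_in_M: "(\<And>i. i \<in> I \<Longrightarrow> f i \<in> M) \<Longrightarrow> (\<Sum>i\<in>I. f i) \<in> M"
  by (induction I rule: infinite_finite_induct) (simp_all add: zero_in_M add_in_M del: zero_fun_def plus_fun_def)

lemma invariant_op_scale: "invariant_op g (scale c v) = scale c (invariant_op g v)"
  by (rule M_eqI) (auto simp: invariant_op_tabloid invariant_op_in_M scale_in_M sum_distrib_left mult_ac)

lemma invariant_op_0: "invariant_op g 0 = 0"
  by (rule M_eqI) (auto simp: invariant_op_tabloid invariant_op_in_M zero_in_M)

lemma invariant_op_sum: "invariant_op g (\<Sum>i\<in>I. f i) = (\<Sum>i\<in>I. invariant_op g (f i))"
  by (induction I rule: infinite_finite_induct) (simp_all only: sum.infinite sum.empty sum.insert invariant_op_0 invariant_op_add not_False_eq_True)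

lemma invariant_op_group_act:
  assumes p: "p permutes \<Omega>"
  shows "invariant_op g (group_act G p v) = group_act G p (invariant_op g v)"
proof (rule M_eqI)
  fix S assume S: "S \<in> rows"
  have p': "inv' p permutes \<Omega>" using p by (rule permutes_inv)
  have "(\<Sum>T\<in>rows. g (card (S \<inter> T)) * v (tabloid (inv' p ` T))) =
      (\<Sum>T\<in>rows. g (card (inv' p ` S \<inter> T)) * v (tabloid T))"
  proof (rule sum.reindex_bij_witness[where j = "\<lambda>T. inv' p ` T" and i = "\<lambda>T. p ` T"])
    fix T
    have "card (inv' p ` S \<inter> inv' p ` T) = card (inv' p ` (S \<inter> T))"
      by (simp add: image_Int permutes_inj[OF p'])
    also have "\<dots> = card (S \<inter> T)"
      using permutes_inj[OF p'] by (intro card_image) (auto intro: inj_on_subset)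
    finally show "g (card (inv' p ` S \<inter> inv' p ` T)) * v (tabloid (inv' p ` T)) =
      g (card (S \<inter> T)) * v (tabloid (inv' p ` T))" by simp
  next
    fix T
    show "p ` inv' p ` T = T" using permutes_surj[OF p] by (rule image_f_inv_f)
    show "inv' p ` p ` T = T" using permutes_inj[OF p] by (rule image_inv_f_f)
  qed (use image_in_rows p p' in auto)
  then show "invariant_op g (group_act G p v) (tabloid S) = group_act G p (invariant_op g v) (tabloid S)"
    using S p by (simp add: invariant_op_tabloid group_act_tabloid image_in_rows[OF p'])
qed (simp_all add: invariant_op_in_M group_act_in_M p)

lemma invariant_op_algebra_act:
  "invariant_op g (algebra_act G a v) = algebra_act G a (invariant_op g v)"
  unfolding algebra_act_def invariant_op_sum invariant_op_scale
  by (rule sum.cong[OF refl]) (simp add: invariant_op_group_act)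

lemma group_act_eq_algebra_act:
  assumes "p permutes \<Omega>"
  shows "scale c (group_act G p v) = algebra_act G (\<lambda>q. if q = p then c else 0) v"
    and "(\<lambda>q. if q = p then c else 0) \<in> group_algebra G"
proof -
  have "algebra_act G (\<lambda>q. if q = p then c else 0) v =
      (\<Sum>q\<in>carrier G. if q = p then scale c (group_act G p v) else 0)"
    unfolding algebra_act_def
  proof (rule sum.cong[OF refl])
    fix q
    show "scale (if q = p then c else 0) (group_act G q v) = (if q = p then scale c (group_act G p v) else 0)"
      by (cases "q = p") (simp_all add: scale_def zero_fun_def)
  qed
  then show "scale c (group_act G p v) = algebra_act G (\<lambda>q. if q = p then c else 0) v"
    using assms by simp
qed (use assms in \<open>auto simp: group_algebra_def\<close>)

lemma group_act_id: "v \<in> M \<Longrightarrow> group_act G id v = v"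
  by (rule M_eqI) (simp_all add: group_act_in_M permutes_id group_act_tabloid inv_id)

lemma scale_eq_algebra_act:
  "v \<in> M \<Longrightarrow> scale c v = algebra_act G (\<lambda>q. if q = id then c else 0) v"
  using group_act_eq_algebra_act(1)[OF permutes_id, of c v] by (simp add: group_act_id)

definition unit_vector :: "nat set \<Rightarrow> (nat \<Rightarrow> nat) set \<Rightarrow> 'k::field" where
  "unit_vector T = (\<lambda>C. if C = tabloid T then 1 else 0)"

lemma unit_vector_in_M: "T \<in> rows \<Longrightarrow> unit_vector T \<in> M"
  by (auto simp: M_iff unit_vector_def)

lemma unit_vector_tabloid:
  "S \<in> rows \<Longrightarrow> T \<in> rows \<Longrightarrow> unit_vector T (tabloid S) = of_bool (S = T)"
  by (auto simp: unit_vector_def)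

lemma unit_vector_expansion:
  assumes "v \<in> M"
  shows "v = (\<Sum>T\<in>rows. scale (v (tabloid T)) (unit_vector T))"
  by (rule M_eqI)
     (auto simp: assms sum_apply unit_vector_tabloid of_bool_def if_distrib sum.delta cong: if_cong
       intro!: sum_in_M scale_in_M unit_vector_in_M)

lemma invariant_op_unit_vector:
  "S \<in> rows \<Longrightarrow> T \<in> rows \<Longrightarrow> invariant_op g (unit_vector T) (tabloid S) = g (card (S \<inter> T))"
  by (simp add: invariant_op_tabloid unit_vector_tabloid of_bool_def if_distrib sum.delta cong: if_cong)

lemma group_act_unit_vector:
  assumes p: "p permutes \<Omega>" and T: "T \<in> rows"
  shows "group_act G p (unit_vector T) = unit_vector (p ` T)"
proof (rule M_eqI)
  fix S assume S: "S \<in> rows"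
  have "inv' p ` S = T \<longleftrightarrow> S = p ` T"
    using image_f_inv_f[OF permutes_surj[OF p]] image_inv_f_f[OF permutes_inj[OF p]] by metis
  then show "group_act G p (unit_vector T) (tabloid S) = unit_vector (p ` T) (tabloid S)"
    using S T p image_in_rows[OF permutes_inv[OF p] S] image_in_rows[OF p T]
    by (simp add: group_act_tabloid unit_vector_tabloid)
qed (use assms in \<open>simp_all add: group_act_in_M unit_vector_in_M image_in_rows\<close>)

lemma endomorphism_linear:
  fixes f :: "((nat \<Rightarrow> nat) set \<Rightarrow> 'k::field) \<Rightarrow> (nat \<Rightarrow> nat) set \<Rightarrow> 'k"
  assumes f: "f \<in> endomorphisms G U" and U: "is_submodule G H U"
  shows "f 0 = 0" and "\<And>c v. v \<in> U \<Longrightarrow> f (scale c v) = scale c (f v)"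
    and "\<And>p v. p permutes \<Omega> \<Longrightarrow> v \<in> U \<Longrightarrow> f (group_act G p v) = group_act G p (f v)"
    and "\<And>I w. (\<And>i. i \<in> I \<Longrightarrow> w i \<in> U) \<Longrightarrow> f (\<Sum>i\<in>I. w i) = (\<Sum>i\<in>I. f (w i))"
proof -
  have UM: "U \<subseteq> M" and U0: "0 \<in> U" and Uadd: "\<And>u v. u \<in> U \<Longrightarrow> v \<in> U \<Longrightarrow> u + v \<in> U"
    using U by (auto simp: is_submodule_def)
  have add: "\<And>u v. u \<in> U \<Longrightarrow> v \<in> U \<Longrightarrow> f (u + v) = f u + f v"
    and act: "\<And>a v. a \<in> group_algebra G \<Longrightarrow> v \<in> U \<Longrightarrow> f (algebra_act G a v) = algebra_act G a (f v)"
    and into: "\<And>v. v \<in> U \<Longrightarrow> f v \<in> U"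
    using f by (auto simp: endomorphisms_def)
  show 0: "f 0 = 0" using add[OF U0 U0] by simp
  show "f (scale c v) = scale c (f v)" if "v \<in> U" for c v
  proof -
    have "v \<in> M" "f v \<in> M" using that UM into by blast+
    then show ?thesis
      using act[OF group_act_eq_algebra_act(2)[OF permutes_id, of c] that]
      by (simp only: scale_eq_algebra_act)
  qed
  show "f (group_act G p v) = group_act G p (f v)" if "p permutes \<Omega>" "v \<in> U" for p v
  proof -
    have one: "scale 1 w = w" for w :: "(nat \<Rightarrow> nat) set \<Rightarrow> 'k" by (simp add: fun_eq_iff)
    have "f (scale 1 (group_act G p v)) = scale 1 (group_act G p (f v))"
      using act[OF group_act_eq_algebra_act(2)[OF that(1), of 1] that(2)]
      by (simp only: group_act_eq_algebra_act(1)[OF that(1)])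
    then show ?thesis by (simp only: one)
  qed
  show "f (\<Sum>i\<in>I. w i) = (\<Sum>i\<in>I. f (w i))" if w: "\<And>i. i \<in> I \<Longrightarrow> w i \<in> U" for I and w :: "'c \<Rightarrow> _"
  proof -
    have "(\<Sum>i\<in>I. w i) \<in> U \<and> f (\<Sum>i\<in>I. w i) = (\<Sum>i\<in>I. f (w i))"
      using w by (induction I rule: infinite_finite_induct) (simp_all add: 0 U0 add Uadd del: zero_fun_def plus_fun_def)
    then show ?thesis ..
  qed
qed

lemma M_is_submodule: "is_submodule G H M"
  unfolding is_submodule_def algebra_act_def
  by (auto intro!: sum_in_M scale_in_M group_act_in_M zero_in_M add_in_M)

text \<open>
  The matrix entry \<open>\<kappa> S T\<close> is invariant under simultaneous translation of \<open>S\<close> and \<open>T\<close>.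
\<close>
theorem endomorphism_of_M_eq_invariant_op:
  fixes f :: "((nat \<Rightarrow> nat) set \<Rightarrow> 'k::field) \<Rightarrow> (nat \<Rightarrow> nat) set \<Rightarrow> 'k"
  assumes f: "f \<in> endomorphisms G M"
  shows "\<exists>g. \<forall>v\<in>M. f v = invariant_op g v"
proof -
  note lin = endomorphism_linear[OF f M_is_submodule]
  define \<kappa> where "\<kappa> S T = f (unit_vector T) (tabloid S)" for S T
  \<comment> \<open>the common value of \<open>\<kappa>\<close> at all pairs with intersection size \<open>x\<close>\<close>
  define g where "g x = (SOME c. \<exists>S\<in>rows. \<exists>T\<in>rows. card (S \<inter> T) = x \<and> c = \<kappa> S T)" for x
  have \<kappa>_invariant: "\<kappa> (p ` S) (p ` T) = \<kappa> S T" if "p permutes \<Omega>" "S \<in> rows" "T \<in> rows" for p S T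
  proof -
    have "\<kappa> (p ` S) (p ` T) = group_act G p (f (unit_vector T)) (tabloid (p ` S))"
      using that by (simp add: \<kappa>_def lin(3) unit_vector_in_M flip: group_act_unit_vector)
    also have "\<dots> = \<kappa> S T"
      using that by (simp add: \<kappa>_def group_act_tabloid image_inv_f_f permutes_inj)
    finally show ?thesis .
  qed
  have g: "g (card (S \<inter> T)) = \<kappa> S T" if ST: "S \<in> rows" "T \<in> rows" for S T
  proof -
    have "\<exists>S'\<in>rows. \<exists>T'\<in>rows. card (S' \<inter> T') = card (S \<inter> T) \<and> g (card (S \<inter> T)) = \<kappa> S' T'"
      unfolding g_def by (rule someI_ex) (use ST in blast)
    then obtain S' T' where S'T': "S' \<in> rows" "T' \<in> rows" "card (S' \<inter> T') = card (S \<inter> T)"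
      "g (card (S \<inter> T)) = \<kappa> S' T'" by blast
    obtain p where "p permutes \<Omega>" "p ` S' = S" "p ` T' = T"
      using rows_transitive[OF S'T'(1,2) ST S'T'(3)] by blast
    then show ?thesis using \<kappa>_invariant[of p S' T'] S'T' by simp
  qed
  have "f v = invariant_op g v" if v: "v \<in> M" for v
  proof (rule M_eqI)
    show "f v \<in> M" using f v by (simp add: endomorphisms_def)
    fix S assume S: "S \<in> rows"
    have "f v = (\<Sum>T\<in>rows. scale (v (tabloid T)) (f (unit_vector T)))"
      by (subst unit_vector_expansion[OF v]) (simp add: lin(2,4) scale_in_M unit_vector_in_M)
    then show "f v (tabloid S) = invariant_op g v (tabloid S)"
      using S by (simp add: sum_apply invariant_op_tabloid g \<kappa>_def mult.commute)
  qed (rule invariant_op_in_M)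
  then show ?thesis by blast
qed

end

section \<open>The Johnson basis\<close>

lemma of_nat_char_2:
  assumes "CHAR('k::field) = 2"
  shows "of_nat n = (of_bool (odd n) :: 'k)"
proof (cases "even n")
  case True
  then show ?thesis using assms by (simp add: of_nat_eq_0_iff_char_dvd)
next
  case False
  then obtain k where "n = Suc (2 * k)" by (metis oddE Suc_eq_plus1)
  moreover have "(of_nat (2 * k) :: 'k) = 0" using assms by (simp only: of_nat_eq_0_iff_char_dvd) simp
  ultimately show ?thesis by simp
qed

context two_row
begin

lemma card_\<Omega>: "card \<Omega> = \<mu>\<^sub>1 - \<mu>\<^sub>2 + 2 * \<mu>\<^sub>2"
  using \<mu>\<^sub>2_le_\<mu>\<^sub>1 by (simp add: \<Omega>_def)

lemma johnson_add: "johnson u (v + w) = johnson u v + johnson u w"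
  by (simp only: johnson_def invariant_op_add)

lemma johnson_scale: "johnson u (scale c v) = scale c (johnson u v)"
  by (simp only: johnson_def invariant_op_scale)

lemma johnson_sum: "johnson u (\<Sum>i\<in>I. f i) = (\<Sum>i\<in>I. johnson u (f i))"
  by (simp only: johnson_def invariant_op_sum)

lemma johnson_zero: "johnson u 0 = 0"
  by (simp only: johnson_def invariant_op_0)

lemma johnson_algebra_act: "johnson u (algebra_act G a v) = algebra_act G a (johnson u v)"
  by (simp only: johnson_def invariant_op_algebra_act)

definition struct_const :: "nat \<Rightarrow> nat \<Rightarrow> nat \<Rightarrow> nat" where
  "struct_const i j u = (\<mu>\<^sub>1 - \<mu>\<^sub>2 + i + j choose (\<mu>\<^sub>1 - \<mu>\<^sub>2 + u)) * (u choose i) * (u choose j)"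

lemma struct_const_commute: "struct_const i j u = struct_const j i u"
  by (simp add: struct_const_def mult_ac add_ac)

text \<open>
  The product formula for intersection numbers, read as a product of matrices.
\<close>
theorem johnson_product:
  fixes v :: "(nat \<Rightarrow> nat) set \<Rightarrow> 'k::field"
  shows "johnson i (johnson j v) = (\<Sum>u\<le>\<mu>\<^sub>2. scale (of_nat (struct_const i j u)) (johnson u v))"
    (is "?l = ?r")
proof (cases "i \<le> \<mu>\<^sub>2 \<and> j \<le> \<mu>\<^sub>2")
  case True
  show ?thesis
  proof (rule M_eqI)
    fix S assume S: "S \<in> rows"
    have inner: "(\<Sum>T\<in>rows. of_nat (card (S \<inter> T) choose (\<mu>\<^sub>2 - i)) * (of_nat (card (T \<inter> U) choose (\<mu>\<^sub>2 - j)) :: 'k))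
      = (\<Sum>u\<le>\<mu>\<^sub>2. of_nat (struct_const i j u) * of_nat (card (S \<inter> U) choose (\<mu>\<^sub>2 - u)))"
      if U: "U \<in> rows" for U
    proof -
      have "(\<Sum>T | T \<subseteq> \<Omega> \<and> card T = \<mu>\<^sub>2. (card (S \<inter> T) choose (\<mu>\<^sub>2 - i)) * (card (T \<inter> U) choose (\<mu>\<^sub>2 - j)))
        = (\<Sum>u\<le>\<mu>\<^sub>2. struct_const i j u * (card (S \<inter> U) choose (\<mu>\<^sub>2 - u)))"
        unfolding struct_const_def
        using S U True by (intro intersection_choose_product card_\<Omega>) (auto simp: rows_def)
      then have "(of_nat (\<Sum>T\<in>rows. (card (S \<inter> T) choose (\<mu>\<^sub>2 - i)) * (card (T \<inter> U) choose (\<mu>\<^sub>2 - j))) :: 'k)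
        = of_nat (\<Sum>u\<le>\<mu>\<^sub>2. struct_const i j u * (card (S \<inter> U) choose (\<mu>\<^sub>2 - u)))"
        by (simp only: rows_def)
      then show ?thesis by (simp only: of_nat_sum of_nat_mult)
    qed
    have "?l (tabloid S) = (\<Sum>T\<in>rows. \<Sum>U\<in>rows. of_nat (card (S \<inter> T) choose (\<mu>\<^sub>2 - i)) *
        (of_nat (card (T \<inter> U) choose (\<mu>\<^sub>2 - j)) * v (tabloid U)))"
      using S True by (simp add: johnson_tabloid sum_distrib_left)
    also have "\<dots> = (\<Sum>U\<in>rows. (\<Sum>T\<in>rows. of_nat (card (S \<inter> T) choose (\<mu>\<^sub>2 - i)) *
        of_nat (card (T \<inter> U) choose (\<mu>\<^sub>2 - j))) * v (tabloid U))"
      by (subst sum.swap) (simp add: sum_distrib_right mult.assoc)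
    also have "\<dots> = (\<Sum>U\<in>rows. (\<Sum>u\<le>\<mu>\<^sub>2. of_nat (struct_const i j u) *
        of_nat (card (S \<inter> U) choose (\<mu>\<^sub>2 - u))) * v (tabloid U))"
      by (rule sum.cong[OF refl]) (simp only: inner)
    also have "\<dots> = (\<Sum>u\<le>\<mu>\<^sub>2. of_nat (struct_const i j u) *
        (\<Sum>U\<in>rows. of_nat (card (S \<inter> U) choose (\<mu>\<^sub>2 - u)) * v (tabloid U)))"
      by (simp only: sum_distrib_right sum_distrib_left mult.assoc) (rule sum.swap)
    also have "\<dots> = ?r (tabloid S)"
      using S by (simp add: sum_apply johnson_tabloid)
    finally show "?l (tabloid S) = ?r (tabloid S)" .
  qed (simp_all add: johnson_in_M sum_in_M scale_in_M)
next
  case False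
  have "?l = 0"
    using False by (cases "i \<le> \<mu>\<^sub>2") (simp_all only: johnson_eq_0 johnson_zero not_le simp_thms)
  moreover have "?r = 0"
  proof (rule sum.neutral, rule ballI)
    fix u assume "u \<in> {..\<mu>\<^sub>2}"
    then have "struct_const i j u = 0" using False by (auto simp: struct_const_def)
    then show "scale (of_nat (struct_const i j u)) (johnson u v) = 0" by (simp add: fun_eq_iff)
  qed
  ultimately show ?thesis by simp
qed

lemma johnson_commute: "johnson i (johnson j v) = johnson j (johnson i v)"
  by (simp only: johnson_product struct_const_commute)

lemma johnson_0:
  assumes "v \<in> M"
  shows "johnson 0 v = v"
proof (rule M_eqI)
  fix S assume S: "S \<in> rows"
  have "(card (S \<inter> T) choose \<mu>\<^sub>2) = of_bool (S = T)" if "T \<in> rows" for T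
  proof (cases "S = T")
    case True
    then show ?thesis using S by (simp add: rows_def)
  next
    case False
    have fin: "finite S" "finite T" using S that finite_subset[OF _ finite_\<Omega>] by (auto simp: rows_def)
    have "S \<inter> T \<subset> S"
    proof (rule psubsetI)
      show "S \<inter> T \<noteq> S"
      proof
        assume "S \<inter> T = S"
        then have "S \<subseteq> T" by blast
        with S that fin have "S = T" by (intro card_subset_eq) (auto simp: rows_def)
        with False show False ..
      qed
    qed simp
    then have "card (S \<inter> T) < \<mu>\<^sub>2" using psubset_card_mono[OF fin(1)] S by (simp add: rows_def)
    then show ?thesis using False by simp
  qed
  then have "johnson 0 v (tabloid S) = (\<Sum>T\<in>rows. if T = S then v (tabloid S) else 0)"
    unfolding johnson_tabloid[OF S le0] by (intro sum.cong) (auto simp del: binomial_eq_0_iff)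
  then show "johnson 0 v (tabloid S) = v (tabloid S)"
    using S by simp
qed (use assms in \<open>simp_all add: johnson_in_M\<close>)

lemma invariant_op_cong:
  assumes "\<And>x. x \<le> \<mu>\<^sub>2 \<Longrightarrow> g x = h x"
  shows "invariant_op g v = invariant_op h v"
proof (rule M_eqI)
  fix S assume S: "S \<in> rows"
  have "card (S \<inter> T) \<le> \<mu>\<^sub>2" for T
    using S card_mono[of S "S \<inter> T"] finite_subset[OF _ finite_\<Omega>, of S] by (auto simp: rows_def)
  then show "invariant_op g v (tabloid S) = invariant_op h v (tabloid S)"
    using S assms by (simp add: invariant_op_tabloid)
qed (rule invariant_op_in_M)+

lemma sum_johnson_eq_invariant_op:
  "(\<Sum>u\<le>\<mu>\<^sub>2. scale (c u) (johnson u v)) =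
    invariant_op (\<lambda>x. \<Sum>k\<le>\<mu>\<^sub>2. c (\<mu>\<^sub>2 - k) * of_nat (x choose k)) v"
proof (rule M_eqI)
  fix S assume S: "S \<in> rows"
  have reindex: "(\<Sum>k\<le>\<mu>\<^sub>2. c (\<mu>\<^sub>2 - k) * of_nat (x choose k)) = (\<Sum>u\<le>\<mu>\<^sub>2. c u * of_nat (x choose (\<mu>\<^sub>2 - u)))" for x
    by (rule sum.reindex_bij_witness[where i = "\<lambda>u. \<mu>\<^sub>2 - u" and j = "\<lambda>u. \<mu>\<^sub>2 - u"]) auto
  have "(\<Sum>u\<le>\<mu>\<^sub>2. scale (c u) (johnson u v)) (tabloid S) =
    (\<Sum>u\<le>\<mu>\<^sub>2. \<Sum>T\<in>rows. c u * (of_nat (card (S \<inter> T) choose (\<mu>\<^sub>2 - u)) * v (tabloid T)))"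
    using S by (simp add: sum_apply johnson_tabloid sum_distrib_left)
  also have "\<dots> = (\<Sum>T\<in>rows. (\<Sum>u\<le>\<mu>\<^sub>2. c u * of_nat (card (S \<inter> T) choose (\<mu>\<^sub>2 - u))) * v (tabloid T))"
    by (subst sum.swap) (simp only: sum_distrib_right mult.assoc)
  finally show "(\<Sum>u\<le>\<mu>\<^sub>2. scale (c u) (johnson u v)) (tabloid S) =
      invariant_op (\<lambda>x. \<Sum>k\<le>\<mu>\<^sub>2. c (\<mu>\<^sub>2 - k) * of_nat (x choose k)) v (tabloid S)"
    using S by (simp only: invariant_op_tabloid reindex)
qed (simp_all add: invariant_op_in_M johnson_in_M sum_in_M scale_in_M)

theorem endomorphism_of_M_eq_sum_johnson:
  fixes f :: "((nat \<Rightarrow> nat) set \<Rightarrow> 'k::field) \<Rightarrow> (nat \<Rightarrow> nat) set \<Rightarrow> 'k"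
  assumes f: "f \<in> endomorphisms G M"
  shows "\<exists>c. \<forall>v\<in>M. f v = (\<Sum>u\<le>\<mu>\<^sub>2. scale (c u) (johnson u v))"
proof -
  obtain g where g: "\<And>v. v \<in> M \<Longrightarrow> f v = invariant_op g v"
    using endomorphism_of_M_eq_invariant_op[OF f] by blast
  obtain d where d: "\<And>x. x \<le> \<mu>\<^sub>2 \<Longrightarrow> g x = (\<Sum>k\<le>\<mu>\<^sub>2. d k * of_nat (x choose k))"
    using newton_expansion[of \<mu>\<^sub>2 g] by blast
  have "f v = (\<Sum>u\<le>\<mu>\<^sub>2. scale (d (\<mu>\<^sub>2 - u)) (johnson u v))" if "v \<in> M" for v
  proof -
    have "f v = invariant_op (\<lambda>x. \<Sum>k\<le>\<mu>\<^sub>2. d (\<mu>\<^sub>2 - (\<mu>\<^sub>2 - k)) * of_nat (x choose k)) v"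
      unfolding g[OF that] by (rule invariant_op_cong) (simp add: d)
    then show ?thesis by (simp only: sum_johnson_eq_invariant_op)
  qed
  then show ?thesis by (intro exI[of _ "\<lambda>u. d (\<mu>\<^sub>2 - u)"]) blast
qed

text \<open>
  Since \<open>2 * \<mu>\<^sub>2\<close> points are available, every intersection size \<open>x \<le> \<mu>\<^sub>2\<close> occurs; then Newton
  interpolation is unique.
\<close>
theorem johnson_independent:
  fixes c :: "nat \<Rightarrow> 'k::field"
  assumes zero: "\<And>v :: (nat \<Rightarrow> nat) set \<Rightarrow> 'k. v \<in> M \<Longrightarrow> (\<Sum>u\<le>\<mu>\<^sub>2. scale (c u) (johnson u v)) = 0"
    and "u \<le> \<mu>\<^sub>2"
  shows "c u = 0"
proof -
  have "(\<Sum>k\<le>\<mu>\<^sub>2. c (\<mu>\<^sub>2 - k) * of_nat (x choose k)) = 0" if x: "x \<le> \<mu>\<^sub>2" for x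
  proof -
    \<comment> \<open>the second row \<open>{1..\<mu>\<^sub>2}\<close> shifted by \<open>\<mu>\<^sub>2 - x\<close>, so that \<open>x\<close> points remain in common\<close>
    define T where "T = {\<mu>\<^sub>2 - x + 1..2 * \<mu>\<^sub>2 - x}"
    have T: "T \<in> rows" using x \<mu>\<^sub>2_le_\<mu>\<^sub>1 by (auto simp: rows_def T_def \<Omega>_def)
    define S where "S = {1..\<mu>\<^sub>2}"
    have S: "S \<in> rows" by (auto simp: rows_def S_def \<Omega>_def)
    have "S \<inter> T = {\<mu>\<^sub>2 - x + 1..\<mu>\<^sub>2}" using x by (auto simp: S_def T_def)
    then have "card (S \<inter> T) = x" using x by simp
    then have "(\<Sum>k\<le>\<mu>\<^sub>2. c (\<mu>\<^sub>2 - k) * of_nat (x choose k)) =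
        (\<Sum>u\<le>\<mu>\<^sub>2. scale (c u) (johnson u (unit_vector T))) (tabloid S)"
      by (simp only: sum_johnson_eq_invariant_op invariant_op_unit_vector[OF S T])
    then show ?thesis
      by (simp only: zero[OF unit_vector_in_M[OF T]] zero_fun_apply)
  qed
  from newton_unique[OF this, of "\<mu>\<^sub>2 - u"] show ?thesis using assms(2) by simp
qed

end

context two_row
begin

section \<open>The polytabloid in characteristic two\<close>

abbreviation "CS \<equiv> column_stabilizer \<mu>\<^sub>1 \<mu>\<^sub>2"

lemma column_stabilizer_iff:
  "p \<in> CS \<longleftrightarrow> p permutes \<Omega> \<and> (\<forall>j\<in>{1..\<mu>\<^sub>2}. p ` {j, \<mu>\<^sub>1 + j} = {j, \<mu>\<^sub>1 + j}) \<and> (\<forall>j\<in>{\<mu>\<^sub>2 + 1..\<mu>\<^sub>1}. p j = j)"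
  by (simp add: column_stabilizer_def)

lemma finite_column_stabilizer: "finite CS"
  by (rule finite_subset[of _ "{p. p permutes \<Omega>}"]) (auto simp: column_stabilizer_iff)

lemma column_stabilizer_maps:
  assumes "p \<in> CS" "j \<in> {1..\<mu>\<^sub>2}"
  shows "p j = j \<and> p (\<mu>\<^sub>1 + j) = \<mu>\<^sub>1 + j \<or> p j = \<mu>\<^sub>1 + j \<and> p (\<mu>\<^sub>1 + j) = j"
proof -
  have "p ` {j, \<mu>\<^sub>1 + j} = {j, \<mu>\<^sub>1 + j}" using assms by (simp add: column_stabilizer_iff)
  then have "{p j, p (\<mu>\<^sub>1 + j)} = {j, \<mu>\<^sub>1 + j}" by (simp only: image_insert image_empty)
  then show ?thesis by (simp only: doubleton_eq_iff)
qed

lemma column_swap_in_column_stabilizer: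
  assumes "p \<in> CS" and j: "j \<in> {1..\<mu>\<^sub>2}"
  shows "transpose j (\<mu>\<^sub>1 + j) \<circ> p \<in> CS"
  unfolding column_stabilizer_iff
proof (intro conjI ballI)
  let ?\<tau> = "transpose j (\<mu>\<^sub>1 + j)"
  have p: "p permutes \<Omega>" "\<And>i. i \<in> {1..\<mu>\<^sub>2} \<Longrightarrow> p ` {i, \<mu>\<^sub>1 + i} = {i, \<mu>\<^sub>1 + i}"
    "\<And>i. i \<in> {\<mu>\<^sub>2 + 1..\<mu>\<^sub>1} \<Longrightarrow> p i = i"
    using assms by (auto simp: column_stabilizer_iff)
  show "?\<tau> \<circ> p permutes \<Omega>"
    using j p(1) by (intro permutes_compose permutes_swap_id) (auto simp: \<Omega>_def)
  show "(?\<tau> \<circ> p) ` {i, \<mu>\<^sub>1 + i} = {i, \<mu>\<^sub>1 + i}" if "i \<in> {1..\<mu>\<^sub>2}" for i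
  proof -
    have "(?\<tau> \<circ> p) ` {i, \<mu>\<^sub>1 + i} = ?\<tau> ` {i, \<mu>\<^sub>1 + i}"
      unfolding image_comp[symmetric] p(2)[OF that] ..
    also have "\<dots> = {i, \<mu>\<^sub>1 + i}"
      using that j \<mu>\<^sub>2_le_\<mu>\<^sub>1 by (cases "i = j") (auto simp: transpose_def)
    finally show ?thesis .
  qed
  show "(?\<tau> \<circ> p) i = i" if "i \<in> {\<mu>\<^sub>2 + 1..\<mu>\<^sub>1}" for i
    using that j p(3)[OF that] by (auto simp: transpose_def)
qed

text \<open>
  The set \<open>P\<close> is too small to meet all columns. Swapping the two entries of a missed column is a
  fixed-point-free involution.
\<close>
lemma even_card_column_stabilizer_above:
  assumes P: "finite P" "card P < \<mu>\<^sub>2"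
  shows "even (card {p \<in> CS. P \<subseteq> p ` row})"
proof -
  have "\<exists>j\<in>{1..\<mu>\<^sub>2}. j \<notin> P \<and> \<mu>\<^sub>1 + j \<notin> P"
  proof (rule ccontr)
    assume hit: "\<not> (\<exists>j\<in>{1..\<mu>\<^sub>2}. j \<notin> P \<and> \<mu>\<^sub>1 + j \<notin> P)"
    have "{1..\<mu>\<^sub>2} \<subseteq> (\<lambda>x. if x \<le> \<mu>\<^sub>1 then x else x - \<mu>\<^sub>1) ` P"
    proof
      fix j assume j: "j \<in> {1..\<mu>\<^sub>2}"
      with hit consider "j \<in> P" | "\<mu>\<^sub>1 + j \<in> P" by blast
      then show "j \<in> (\<lambda>x. if x \<le> \<mu>\<^sub>1 then x else x - \<mu>\<^sub>1) ` P"
      proof cases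
        case 1
        then show ?thesis using j \<mu>\<^sub>2_le_\<mu>\<^sub>1 by (intro image_eqI[of _ _ j]) auto
      next
        case 2
        then show ?thesis using j by (intro image_eqI[of _ _ "\<mu>\<^sub>1 + j"]) auto
      qed
    qed
    then have "card {1..\<mu>\<^sub>2} \<le> card P"
      using surj_card_le[OF P(1)] by blast
    with P(2) show False by simp
  qed
  then obtain j where j: "j \<in> {1..\<mu>\<^sub>2}" "j \<notin> P" "\<mu>\<^sub>1 + j \<notin> P" by blast
  let ?\<tau> = "transpose j (\<mu>\<^sub>1 + j)"
  define Q where "Q = {p \<in> CS. P \<subseteq> p ` row}"
  have finQ: "finite Q" using finite_column_stabilizer by (simp add: Q_def)
  have swapQ: "?\<tau> \<circ> p \<in> Q" if "p \<in> Q" for p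
  proof -
    have "P \<subseteq> (?\<tau> \<circ> p) ` row"
    proof
      fix x assume x: "x \<in> P"
      then have "x \<in> p ` row" using that by (auto simp: Q_def)
      then obtain y where "x = p y" "y \<in> row" by (rule imageE)
      moreover have "?\<tau> x = x" using x j by (auto simp: transpose_def)
      ultimately have "(?\<tau> \<circ> p) y = x" by simp
      with \<open>y \<in> row\<close> show "x \<in> (?\<tau> \<circ> p) ` row" by (metis imageI)
    qed
    then show ?thesis using that j column_swap_in_column_stabilizer by (simp add: Q_def)
  qed
  have invol: "?\<tau> \<circ> (?\<tau> \<circ> p) = p" for p :: "nat \<Rightarrow> nat"
    by (simp add: fun_eq_iff)
  have pj: "p j = j \<or> p j = \<mu>\<^sub>1 + j" if "p \<in> Q" for p
    using column_stabilizer_maps[of p j] that j by (auto simp: Q_def)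
  have j_ne: "\<mu>\<^sub>1 + j \<noteq> j" using j \<mu>\<^sub>2_le_\<mu>\<^sub>1 by auto
  have "bij_betw (\<lambda>p. ?\<tau> \<circ> p) {p \<in> Q. p j = j} {p \<in> Q. p j = \<mu>\<^sub>1 + j}"
    by (rule bij_betw_byWitness[where f' = "\<lambda>p. ?\<tau> \<circ> p"]) (use swapQ in \<open>auto simp: invol\<close>)
  then have "card {p \<in> Q. p j = j} = card {p \<in> Q. p j = \<mu>\<^sub>1 + j}"
    by (rule bij_betw_same_card)
  moreover have "Q = {p \<in> Q. p j = j} \<union> {p \<in> Q. p j = \<mu>\<^sub>1 + j}" using pj by blast
  then have "card Q = card {p \<in> Q. p j = j} + card {p \<in> Q. p j = \<mu>\<^sub>1 + j}"
    using finQ j_ne card_Un_disjoint[of "{p \<in> Q. p j = j}" "{p \<in> Q. p j = \<mu>\<^sub>1 + j}"] by fastforce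
  ultimately show ?thesis by (simp add: Q_def)
qed

text \<open>
  In characteristic \<open>2\<close> the signs of the column permutations disappear.
\<close>
lemma polytabloid_char_2:
  assumes char: "CHAR('k::field) = 2"
  shows "polytabloid \<mu>\<^sub>1 \<mu>\<^sub>2 = (\<Sum>p\<in>CS. unit_vector (p ` row) :: (nat \<Rightarrow> nat) set \<Rightarrow> 'k)"
proof -
  have minus_one: "(- 1 :: 'k) = 1"
  proof -
    have "(of_nat 2 :: 'k) = 0" by (simp only: of_nat_char_2[OF char]) simp
    then have "(1 + 1 :: 'k) = 0" by simp
    then show ?thesis by (rule minus_unique)
  qed
  have sign: "(of_int (sign p) :: 'k) = 1" for p :: "nat \<Rightarrow> nat"
    by (simp add: sign_def minus_one)
  have "(\<lambda>C. if C = H then 1 else 0) = (unit_vector row :: _ \<Rightarrow> 'k)"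
    by (simp add: unit_vector_def young_subgroup_eq_tabloid)
  then have "polytabloid \<mu>\<^sub>1 \<mu>\<^sub>2 = (\<Sum>p\<in>{p. p permutes \<Omega>}.
      scale (if p \<in> CS then 1 else 0 :: 'k) (group_act G p (unit_vector row)))"
    by (simp only: polytabloid_def algebra_act_def carrier_G sign)
  also have "\<dots> = (\<Sum>p\<in>CS. scale (if p \<in> CS then 1 else 0) (group_act G p (unit_vector row)))"
    by (rule sum.mono_neutral_right) (auto simp: column_stabilizer_iff fun_eq_iff)
  also have "\<dots> = (\<Sum>p\<in>CS. unit_vector (p ` row))"
  proof (rule sum.cong[OF refl])
    fix p assume p: "p \<in> CS"
    then have "group_act G p (unit_vector row) = (unit_vector (p ` row) :: _ \<Rightarrow> 'k)"
      by (intro group_act_unit_vector row_in_rows) (simp add: column_stabilizer_iff)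
    then show "scale (if p \<in> CS then 1 else 0) (group_act G p (unit_vector row)) = (unit_vector (p ` row) :: _ \<Rightarrow> 'k)"
      using p by (simp add: scale_def)
  qed
  finally show ?thesis .
qed

lemma image_row_column_stabilizer: "p \<in> CS \<Longrightarrow> p ` row \<in> rows"
  by (intro image_in_rows row_in_rows) (simp add: column_stabilizer_iff)

lemma polytabloid_in_M:
  assumes "CHAR('k::field) = 2"
  shows "(polytabloid \<mu>\<^sub>1 \<mu>\<^sub>2 :: (nat \<Rightarrow> nat) set \<Rightarrow> 'k) \<in> M"
  unfolding polytabloid_char_2[OF assms]
  by (intro sum_in_M unit_vector_in_M image_row_column_stabilizer)

text \<open>
  Each coefficient of the image counts pairs of a set \<open>P\<close> with fewer than \<open>\<mu>\<^sub>2\<close> elements and a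
  column permutation \<open>p\<close> with \<open>P \<subseteq> p ` row\<close>; for given \<open>P\<close> there are evenly many of these.
\<close>
lemma johnson_polytabloid:
  assumes char: "CHAR('k::field) = 2" and u: "0 < u" "u \<le> \<mu>\<^sub>2"
  shows "johnson u (polytabloid \<mu>\<^sub>1 \<mu>\<^sub>2) = (0 :: (nat \<Rightarrow> nat) set \<Rightarrow> 'k)"
proof (rule M_eqI)
  fix S assume S: "S \<in> rows"
  have finS: "finite S" using S finite_subset[OF _ finite_\<Omega>] by (auto simp: rows_def)
  have even: "even (\<Sum>p\<in>CS. card (S \<inter> p ` row) choose (\<mu>\<^sub>2 - u))"
  proof -
    define PP where "PP = {P. P \<subseteq> S \<and> card P = \<mu>\<^sub>2 - u}"
    have "(\<Sum>p\<in>CS. card (S \<inter> p ` row) choose (\<mu>\<^sub>2 - u)) = (\<Sum>p\<in>CS. \<Sum>P\<in>PP. of_bool (P \<subseteq> S \<inter> p ` row))"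
      unfolding PP_def by (intro sum.cong refl choose_inter_eq_sum finS) auto
    also have "\<dots> = (\<Sum>P\<in>PP. \<Sum>p\<in>CS. of_bool (P \<subseteq> S \<inter> p ` row))"
      by (rule sum.swap)
    also have "\<dots> = (\<Sum>P\<in>PP. card {p \<in> CS. P \<subseteq> p ` row})"
    proof (rule sum.cong[OF refl])
      fix P assume P: "P \<in> PP"
      have "CS \<inter> {p. P \<subseteq> S \<inter> p ` row} = {p \<in> CS. P \<subseteq> p ` row}"
        using P by (auto simp: PP_def)
      then show "(\<Sum>p\<in>CS. of_bool (P \<subseteq> S \<inter> p ` row)) = card {p \<in> CS. P \<subseteq> p ` row}"
        using finite_column_stabilizer by (simp only: sum_of_bool_eq) simp
    qed
    also have "even \<dots>"
    proof (rule dvd_sum)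
      fix P assume "P \<in> PP"
      then show "even (card {p \<in> CS. P \<subseteq> p ` row})"
        using finS u finite_subset by (intro even_card_column_stabilizer_above) (auto simp: PP_def)
    qed
    finally show ?thesis .
  qed
  have "johnson u (polytabloid \<mu>\<^sub>1 \<mu>\<^sub>2) (tabloid S) = (\<Sum>p\<in>CS. of_nat (card (S \<inter> p ` row) choose (\<mu>\<^sub>2 - u)) :: 'k)"
    unfolding polytabloid_char_2[OF char] johnson_sum sum_apply
    using S u(2) image_row_column_stabilizer
    by (intro sum.cong) (simp_all add: johnson_def invariant_op_unit_vector)
  also have "\<dots> = of_nat (\<Sum>p\<in>CS. card (S \<inter> p ` row) choose (\<mu>\<^sub>2 - u))"
    by (rule of_nat_sum[symmetric])
  also have "\<dots> = 0"
    using even by (simp only: of_nat_char_2[OF char]) simp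
  finally show "johnson u (polytabloid \<mu>\<^sub>1 \<mu>\<^sub>2) (tabloid S) = (0 :: (nat \<Rightarrow> nat) set \<Rightarrow> 'k) (tabloid S)"
    by (simp only: zero_fun_apply)
qed (simp_all add: johnson_in_M zero_in_M)

lemma column_stabilizer_fixing_row:
  assumes p: "p \<in> CS" and row: "p ` row = row"
  shows "p = id"
proof
  fix x
  have col: "p j = j" "p (\<mu>\<^sub>1 + j) = \<mu>\<^sub>1 + j" if j: "j \<in> {1..\<mu>\<^sub>2}" for j
  proof -
    have "\<mu>\<^sub>1 + j \<in> row" using j by (simp add: row_def)
    then have "p (\<mu>\<^sub>1 + j) \<in> row" using row by blast
    moreover have "j \<notin> row" using j \<mu>\<^sub>2_le_\<mu>\<^sub>1 by (simp add: row_def)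
    ultimately show "p j = j" "p (\<mu>\<^sub>1 + j) = \<mu>\<^sub>1 + j"
      using column_stabilizer_maps[OF p j] by auto
  qed
  consider "x \<in> {1..\<mu>\<^sub>2}" | "x \<in> {\<mu>\<^sub>2+1..\<mu>\<^sub>1}" | "x - \<mu>\<^sub>1 \<in> {1..\<mu>\<^sub>2}" "\<mu>\<^sub>1 + (x - \<mu>\<^sub>1) = x" | "x \<notin> \<Omega>"
    unfolding \<Omega>_def atLeastAtMost_iff by linarith
  then show "p x = id x"
  proof cases
    case 3
    then show ?thesis using col(2)[of "x - \<mu>\<^sub>1"] by simp
  next
    case 4
    then show ?thesis using p by (simp add: column_stabilizer_iff permutes_not_in[of p \<Omega> x])
  qed (use col p in \<open>simp_all add: column_stabilizer_iff\<close>)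
qed

text \<open>
  Only the identity both preserves the columns and fixes the second row, so the coefficient at the
  original tabloid is \<open>1\<close>.
\<close>
lemma polytabloid_nonzero:
  assumes char: "CHAR('k::field) = 2"
  shows "polytabloid \<mu>\<^sub>1 \<mu>\<^sub>2 \<noteq> (0 :: (nat \<Rightarrow> nat) set \<Rightarrow> 'k)"
proof -
  have id: "id \<in> CS" by (simp add: column_stabilizer_iff permutes_id)
  have "polytabloid \<mu>\<^sub>1 \<mu>\<^sub>2 (tabloid row) = (\<Sum>p\<in>CS. if p = id then 1 else 0 :: 'k)"
    unfolding polytabloid_char_2[OF char] sum_apply
  proof (rule sum.cong[OF refl])
    fix p assume p: "p \<in> CS"
    have "row = p ` row \<longleftrightarrow> p = id" using column_stabilizer_fixing_row[OF p] by auto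
    then show "unit_vector (p ` row) (tabloid row) = (if p = id then 1 else 0 :: 'k)"
      using p by (simp add: unit_vector_tabloid row_in_rows image_row_column_stabilizer)
  qed
  also have "\<dots> = 1" using id finite_column_stabilizer by simp
  finally show ?thesis by (metis zero_fun_apply zero_neq_one)
qed

lemma polytabloid_in_specht_module:
  assumes char: "CHAR('k::field) = 2"
  shows "(polytabloid \<mu>\<^sub>1 \<mu>\<^sub>2 :: (nat \<Rightarrow> nat) set \<Rightarrow> 'k) \<in> specht_module \<mu>\<^sub>1 \<mu>\<^sub>2"
proof -
  interpret vs: vector_space "scale :: 'k \<Rightarrow> ((nat \<Rightarrow> nat) set \<Rightarrow> 'k) \<Rightarrow> _"
    by (rule vector_space_scale)
  have "polytabloid \<mu>\<^sub>1 \<mu>\<^sub>2 = group_act G id (polytabloid \<mu>\<^sub>1 \<mu>\<^sub>2 :: (nat \<Rightarrow> nat) set \<Rightarrow> 'k)"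
    using polytabloid_in_M[OF char] by (simp only: group_act_id)
  then have "polytabloid \<mu>\<^sub>1 \<mu>\<^sub>2 \<in> (\<lambda>g. group_act G g (polytabloid \<mu>\<^sub>1 \<mu>\<^sub>2 :: (nat \<Rightarrow> nat) set \<Rightarrow> 'k)) ` carrier G"
    by (rule image_eqI[where x = id]) (simp add: permutes_id)
  then show ?thesis
    unfolding specht_module_def
    by (rule vs.span_base)
qed

end

section \<open>Direct summands and idempotents\<close>

lemma algebra_act_add: "algebra_act K a (u + v) = algebra_act K a u + algebra_act K a v"
  by (rule ext) (simp add: algebra_act_def group_act_def sum_apply distrib_left sum.distrib)

lemma algebra_act_0: "algebra_act K a 0 = 0"
  by (rule ext) (simp add: algebra_act_def group_act_def sum_apply)

lemma algebra_act_sum: "algebra_act K a (\<Sum>i\<in>I. f i) = (\<Sum>i\<in>I. algebra_act K a (f i))"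
  by (induction I rule: infinite_finite_induct)
     (simp_all only: sum.infinite sum.empty sum.insert algebra_act_0 algebra_act_add not_False_eq_True)

lemma algebra_act_scale: "algebra_act K a (scale c v) = scale c (algebra_act K a v)"
  by (rule ext) (simp add: algebra_act_def group_act_def sum_apply sum_distrib_left mult_ac)

lemma double_eq_0_char_2:
  fixes v :: "'b \<Rightarrow> 'k::field"
  assumes "CHAR('k) = 2"
  shows "v + v = 0"
proof
  fix x
  have "(of_nat 2 :: 'k) = 0" by (simp only: of_nat_char_2[OF assms]) simp
  then have "(1 + 1 :: 'k) = 0" by simp
  then have "v x * (1 + 1) = 0" by simp
  then show "(v + v) x = 0 x" by (auto simp: distrib_left)
qed

lemma scale_0_left: "scale 0 v = 0"
  by (simp add: fun_eq_iff)

lemma scale_1: "scale 1 v = v"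
  by (simp add: fun_eq_iff)

lemma scale_scale: "scale c (scale d v) = scale (c * d) v"
  by (simp add: fun_eq_iff mult.assoc)

lemma scale_sum: "scale c (\<Sum>i\<in>I. f i) = (\<Sum>i\<in>I. scale c (f i))"
  by (rule ext) (simp add: sum_apply sum_distrib_left)

lemma sum_scale: "(\<Sum>i\<in>I. scale (c i) v) = scale (\<Sum>i\<in>I. c i) v"
  by (rule ext) (simp add: sum_apply sum_distrib_right)

lemma le_if_odd_choose: "odd (n choose k) \<Longrightarrow> k \<le> n"
  by (rule ccontr) (simp add: binomial_eq_0)

context two_row
begin

lemma submodule_closed:
  assumes "is_submodule G H U"
  shows "U \<subseteq> M" "0 \<in> U" "\<And>u v. u \<in> U \<Longrightarrow> v \<in> U \<Longrightarrow> u + v \<in> U"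
    "\<And>a u. a \<in> group_algebra G \<Longrightarrow> u \<in> U \<Longrightarrow> algebra_act G a u \<in> U"
    "\<And>c u. u \<in> U \<Longrightarrow> scale c u \<in> U"
    "\<And>I f. (\<And>i. i \<in> I \<Longrightarrow> f i \<in> U) \<Longrightarrow> (\<Sum>i\<in>I. f i) \<in> U"
proof -
  show UM: "U \<subseteq> M" and U0: "0 \<in> U" and add: "\<And>u v. u \<in> U \<Longrightarrow> v \<in> U \<Longrightarrow> u + v \<in> U"
    and act: "\<And>a u. a \<in> group_algebra G \<Longrightarrow> u \<in> U \<Longrightarrow> algebra_act G a u \<in> U"
    using assms by (simp_all add: is_submodule_def)
  show "scale c u \<in> U" if "u \<in> U" for c u
    using act[OF group_act_eq_algebra_act(2)[OF permutes_id, of c] that] that UM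
    by (simp add: subset_iff scale_eq_algebra_act)
  show "(\<Sum>i\<in>I. f i) \<in> U" if "\<And>i. i \<in> I \<Longrightarrow> f i \<in> U" for I and f :: "'c \<Rightarrow> _"
    using that by (induction I rule: infinite_finite_induct) (simp_all add: U0 add)
qed

text \<open>
  By uniqueness, taking components commutes with sums and with the action of the group algebra.
\<close>
theorem projection_onto_summand:
  fixes Y :: "((nat \<Rightarrow> nat) set \<Rightarrow> 'k::field) set"
  assumes D: "indecomposable_decomposition G H D" and Y: "Y \<in> D"
  shows "\<exists>e. e \<in> endomorphisms G M \<and> (\<forall>v\<in>M. e v \<in> Y) \<and> (\<forall>y\<in>Y. e y = y)"
proof -
  have finD: "finite D" and sub: "\<And>W. W \<in> D \<Longrightarrow> is_submodule G H W"
    and unique: "\<And>v. v \<in> M \<Longrightarrow> \<exists>!w. w \<in> (\<Pi>\<^sub>E W\<in>D. W) \<and> v = (\<Sum>W\<in>D. w W)"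
    using D by (auto simp: indecomposable_decomposition_def indecomposable_def)
  define comps where "comps v = (THE w. w \<in> (\<Pi>\<^sub>E W\<in>D. W) \<and> v = (\<Sum>W\<in>D. w W))" for v :: "(nat \<Rightarrow> nat) set \<Rightarrow> 'k"
  have comps: "comps v \<in> (\<Pi>\<^sub>E W\<in>D. W)" "v = (\<Sum>W\<in>D. comps v W)" if "v \<in> M" for v
    using theI'[OF unique[OF that]] by (simp_all add: comps_def)
  have comps_in: "comps v W \<in> W" if "v \<in> M" "W \<in> D" for v W
    using comps(1)[OF that(1)] that(2) by auto
  have compsI: "comps v Y = w Y" if "v \<in> M" "\<And>W. W \<in> D \<Longrightarrow> w W \<in> W" "v = (\<Sum>W\<in>D. w W)" for v w
  proof -
    have "restrict w D \<in> (\<Pi>\<^sub>E W\<in>D. W) \<and> v = (\<Sum>W\<in>D. restrict w D W)"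
      using that by auto
    then have "comps v = restrict w D"
      unfolding comps_def by (rule the1_equality[OF unique[OF that(1)]])
    then show ?thesis using Y by simp
  qed
  define e where "e v = (if v \<in> M then comps v Y else 0)" for v :: "(nat \<Rightarrow> nat) set \<Rightarrow> 'k"
  have YM: "Y \<subseteq> M" using submodule_closed(1)[OF sub[OF Y]] .
  have into: "e v \<in> Y" if "v \<in> M" for v
    using comps_in[OF that Y] that by (simp add: e_def)
  have add: "e (u + v) = e u + e v" if "u \<in> M" "v \<in> M" for u v
  proof -
    have "comps (u + v) Y = comps u Y + comps v Y"
    proof (rule compsI)
      show "u + v \<in> M" using that by (rule add_in_M)
      show "comps u W + comps v W \<in> W" if "W \<in> D" for W
        using submodule_closed(3)[OF sub[OF that]] comps_in that \<open>u \<in> M\<close> \<open>v \<in> M\<close> by blast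
      show "u + v = (\<Sum>W\<in>D. comps u W + comps v W)"
        unfolding sum.distrib using comps(2)[OF that(1)] comps(2)[OF that(2)] by (rule arg_cong2)
    qed
    then show ?thesis using that add_in_M[OF that] by (simp only: e_def if_True)
  qed
  have act: "e (algebra_act G a v) = algebra_act G a (e v)" if "a \<in> group_algebra G" "v \<in> M" for a v
  proof -
    have aM: "algebra_act G a v \<in> M" using submodule_closed(4)[OF M_is_submodule that] .
    have "comps (algebra_act G a v) Y = algebra_act G a (comps v Y)"
    proof (rule compsI[OF aM])
      show "algebra_act G a (comps v W) \<in> W" if "W \<in> D" for W
        using submodule_closed(4)[OF sub[OF that]] comps_in that \<open>a \<in> group_algebra G\<close> \<open>v \<in> M\<close> by blast
      show "algebra_act G a v = (\<Sum>W\<in>D. algebra_act G a (comps v W))"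
        unfolding algebra_act_sum[symmetric] using comps(2)[OF that(2)] by (rule arg_cong)
    qed
    then show ?thesis using that aM by (simp only: e_def if_True)
  qed
  have id: "e y = y" if "y \<in> Y" for y
  proof -
    have "comps y Y = (if Y = Y then y else 0)"
    proof (rule compsI[of y "\<lambda>W. if W = Y then y else 0"])
      show "y \<in> M" using that YM by blast
      show "(if W = Y then y else 0) \<in> W" if "W \<in> D" for W
        using submodule_closed(2)[OF sub[OF that]] \<open>y \<in> Y\<close> by simp
      show "y = (\<Sum>W\<in>D. if W = Y then y else 0)" using finD Y by (simp add: sum.delta)
    qed
    then show ?thesis using that YM by (auto simp: e_def)
  qed
  have "e \<in> endomorphisms G M"
    unfolding endomorphisms_def using into YM add act by (auto simp: e_def[of "_ :: _ \<Rightarrow> 'k"])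
  then show ?thesis using into id by blast
qed

text \<open>
  An idempotent \<open>f\<close> splits \<open>Y\<close> into its image and its kernel; the kernel contains \<open>t\<close>, so the image is
  zero. In characteristic \<open>2\<close> the complementary idempotent is \<open>\<lambda>v. v + f v\<close>.
\<close>
lemma idempotent_endomorphism_of_indecomposable:
  fixes Y :: "((nat \<Rightarrow> nat) set \<Rightarrow> 'k::field) set"
  assumes char: "CHAR('k) = 2"
    and Y: "indecomposable G H Y" and f: "f \<in> endomorphisms G Y"
    and idem: "\<And>y. y \<in> Y \<Longrightarrow> f (f y) = f y"
    and kills: "t \<in> Y" "t \<noteq> 0" "f t = 0" and y: "y \<in> Y"
  shows "f y = 0"
proof (rule ccontr)
  assume nonzero: "f y \<noteq> 0"
  have subY: "is_submodule G H Y" using Y by (simp add: indecomposable_def)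
  note closed = submodule_closed[OF subY]
  note lin = endomorphism_linear[OF f subY]
  have into: "\<And>v. v \<in> Y \<Longrightarrow> f v \<in> Y" and add: "\<And>u v. u \<in> Y \<Longrightarrow> v \<in> Y \<Longrightarrow> f (u + v) = f u + f v"
    and act: "\<And>a v. a \<in> group_algebra G \<Longrightarrow> v \<in> Y \<Longrightarrow> f (algebra_act G a v) = algebra_act G a (f v)"
    using f by (simp_all add: endomorphisms_def)
  \<comment> \<open>the image of \<open>f\<close>, as the set of its fixed points\<close>
  define U where "U = {v \<in> Y. f v = v}"
  define U' where "U' = {v \<in> Y. f v = 0}"
  have "is_submodule G H U" "is_submodule G H U'"
    unfolding is_submodule_def U_def U'_def
    using closed(1-4) lin(1) by (auto simp: add act algebra_act_0)
  moreover have "U \<noteq> {0}" using nonzero y idem[OF y] into[OF y] by (auto simp: U_def)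
  moreover have "U' \<noteq> {0}" using kills by (auto simp: U'_def)
  moreover have "U \<inter> U' = {0}" using closed(2) lin(1) by (auto simp: U_def U'_def)
  moreover have "Y = {u + u' | u u'. u \<in> U \<and> u' \<in> U'}"
  proof
    show "Y \<subseteq> {u + u' | u u'. u \<in> U \<and> u' \<in> U'}"
    proof
      fix v assume v: "v \<in> Y"
      have "f v \<in> U" using v idem into by (simp add: U_def)
      moreover have "f (v + f v) = 0"
        using v into idem by (simp only: add double_eq_0_char_2[OF char])
      then have "v + f v \<in> U'" using v into closed(3) by (simp add: U'_def)
      moreover have "v = f v + (v + f v)"
      proof -
        have "f v + (v + f v) = v + (f v + f v)" by (simp only: add_ac)
        then show ?thesis by (simp only: double_eq_0_char_2[OF char] add_0_right)
      qed
      ultimately show "v \<in> {u + u' | u u'. u \<in> U \<and> u' \<in> U'}" by blast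
    qed
  qed (use closed(3) in \<open>auto simp: U_def U'_def\<close>)
  ultimately show False using Y unfolding indecomposable_def by blast
qed

lemma odd_struct_const_le:
  assumes "odd (struct_const i j u)"
  shows "\<And>a. bit i a \<Longrightarrow> bit u a" "\<And>a. bit j a \<Longrightarrow> bit u a" "u \<le> i + j" "i \<le> u" "j \<le> u"
proof -
  have odd: "odd (\<mu>\<^sub>1 - \<mu>\<^sub>2 + i + j choose (\<mu>\<^sub>1 - \<mu>\<^sub>2 + u))" "odd (u choose i)" "odd (u choose j)"
    using assms by (simp_all add: struct_const_def)
  show "\<And>a. bit i a \<Longrightarrow> bit u a" "\<And>a. bit j a \<Longrightarrow> bit u a" using odd by (auto simp: odd_choose_iff)
  show "u \<le> i + j" "i \<le> u" "j \<le> u"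
    using odd(1)[THEN le_if_odd_choose] odd(2,3)[THEN le_if_odd_choose] by simp_all
qed

text \<open>
  An odd coefficient forces \<open>u\<close> to contain the digits of \<open>i\<close> and of \<open>j\<close>, hence \<open>u \<ge> i + j\<close>, while
  coefficients with \<open>u > i + j\<close> vanish.
\<close>
lemma odd_struct_const_disjoint_iff:
  assumes disj: "\<And>a. \<not> (bit i a \<and> bit j a)"
  shows "odd (struct_const i j u) \<longleftrightarrow> u = i + j"
proof
  assume odd: "odd (struct_const i j u)"
  have "i + j \<le> u" using odd_struct_const_le(1,2)[OF odd] disj by (rule disjoint_bits_add_le)
  then show "u = i + j" using odd_struct_const_le(3)[OF odd] by simp
next
  have "i + j choose i = (i + j choose j)" using binomial_symmetric[of i "i + j"] by simp
  moreover have "bit (i + j) a \<longleftrightarrow> bit i a \<or> bit j a" for a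
    using disj by (subst disjunctive_add_eq_or) (auto simp: bit_or_iff bit_eq_iff bit_and_iff)
  then have "odd (i + j choose i)" by (simp add: odd_choose_iff)
  moreover assume "u = i + j"
  ultimately show "odd (struct_const i j u)" by (simp add: struct_const_def add.assoc)
qed

lemma even_struct_const_diagonal:
  assumes "w > 0" "\<And>a. \<not> (bit (\<mu>\<^sub>1 - \<mu>\<^sub>2) a \<and> bit w a)"
  shows "even (struct_const w w w)"
proof -
  have "(\<mu>\<^sub>1 - \<mu>\<^sub>2 + w + w choose (\<mu>\<^sub>1 - \<mu>\<^sub>2 + w)) = (\<mu>\<^sub>1 - \<mu>\<^sub>2 + 2 * w choose w)"
    using binomial_symmetric[of w "\<mu>\<^sub>1 - \<mu>\<^sub>2 + 2 * w"] by (simp add: mult_2 add.assoc)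
  then show ?thesis using even_choose_shifted[OF assms] by (simp add: struct_const_def)
qed

lemma odd_struct_const_power_2:
  assumes odd: "odd (struct_const (2 ^ a) (2 ^ a) u)"
  shows "(u = 2 ^ a \<and> bit (\<mu>\<^sub>1 - \<mu>\<^sub>2) a) \<or> (\<exists>c<a. bit (\<mu>\<^sub>1 - \<mu>\<^sub>2) c \<and> bit u c)"
proof (rule odd_square_coefficient)
  show le: "u \<le> 2 * 2 ^ a" using odd_struct_const_le(3)[OF odd] by simp
  show "odd (u choose 2 ^ a)" using odd by (simp add: struct_const_def)
  have "(\<mu>\<^sub>1 - \<mu>\<^sub>2 + 2 ^ a + 2 ^ a choose (\<mu>\<^sub>1 - \<mu>\<^sub>2 + u)) = (\<mu>\<^sub>1 - \<mu>\<^sub>2 + 2 * 2 ^ a choose (2 * 2 ^ a - u))"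
    using binomial_symmetric[of "\<mu>\<^sub>1 - \<mu>\<^sub>2 + u" "\<mu>\<^sub>1 - \<mu>\<^sub>2 + 2 * 2 ^ a"] le by (simp add: mult_2 add.assoc)
  then show "odd (\<mu>\<^sub>1 - \<mu>\<^sub>2 + 2 * 2 ^ a choose (2 * 2 ^ a - u))" using odd by (simp add: struct_const_def)
qed

lemma odd_struct_const_power_2_self:
  assumes "bit (\<mu>\<^sub>1 - \<mu>\<^sub>2) a"
  shows "odd (struct_const (2 ^ a) (2 ^ a) (2 ^ a))"
proof -
  let ?m = "\<mu>\<^sub>1 - \<mu>\<^sub>2"
  have "(?m + 2 ^ a + 2 ^ a choose (?m + 2 ^ a)) = (?m + 2 * 2 ^ a choose (2 ^ a))"
    using binomial_symmetric[of "2 ^ a" "?m + 2 * 2 ^ a"] by (simp add: mult_2 add.assoc)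
  moreover have "bit (?m + 2 * 2 ^ a) a"
    using assms by (simp add: bit_iff_odd)
  then have "odd (?m + 2 * 2 ^ a choose (2 ^ a))" by (auto simp: odd_choose_iff bit_exp_iff)
  ultimately show ?thesis by (simp add: struct_const_def)
qed

end

section \<open>The Johnson basis on the Young module\<close>

locale young_summand = two_row +
  fixes Y :: "((nat \<Rightarrow> nat) set \<Rightarrow> 'k::field) set"
  assumes char_2: "CHAR('k) = 2"
    and young_Y: "is_young_module \<mu>\<^sub>1 \<mu>\<^sub>2 Y"
begin

abbreviation "m \<equiv> \<mu>\<^sub>1 - \<mu>\<^sub>2"

text \<open>
  These are the indices of the basis elements that survive on \<open>Y\<close>.
\<close>
definition avoids :: "nat \<Rightarrow> bool" where
  "avoids u \<longleftrightarrow> (\<forall>a. \<not> (bit m a \<and> bit u a))"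

lemma indecomposable_Y: "indecomposable G H Y"
  using young_Y by (auto simp: is_young_module_def indecomposable_decomposition_def)

lemma submodule_Y: "is_submodule G H Y"
  using indecomposable_Y by (simp add: indecomposable_def)

lemmas Y_closed = submodule_closed[OF submodule_Y]

lemma Y_in_M: "y \<in> Y \<Longrightarrow> y \<in> M"
  using Y_closed(1) by blast

text \<open>
  The Specht module enters through this element: it is nonzero, lies in \<open>Y\<close>, and every
  \<open>johnson u\<close> with \<open>u > 0\<close> kills it.
\<close>
definition t :: "(nat \<Rightarrow> nat) set \<Rightarrow> 'k" where
  "t = polytabloid \<mu>\<^sub>1 \<mu>\<^sub>2"

lemma t_in_Y: "t \<in> Y"
  using young_Y polytabloid_in_specht_module[OF char_2] by (auto simp: t_def is_young_module_def)

lemma t_nonzero: "t \<noteq> 0"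
  unfolding t_def by (rule polytabloid_nonzero[OF char_2])

lemma johnson_t: "0 < u \<Longrightarrow> johnson u t = 0"
  unfolding t_def by (cases "u \<le> \<mu>\<^sub>2") (simp_all only: johnson_polytabloid[OF char_2] johnson_eq_0 not_le)

lemma of_nat_k: "of_nat n = (of_bool (odd n) :: 'k)"
  by (rule of_nat_char_2[OF char_2])

lemma double_eq_0: "v + v = (0 :: 'b \<Rightarrow> 'k)"
  by (rule double_eq_0_char_2[OF char_2])

definition jsum :: "(nat \<Rightarrow> 'k) \<Rightarrow> ((nat \<Rightarrow> nat) set \<Rightarrow> 'k) \<Rightarrow> (nat \<Rightarrow> nat) set \<Rightarrow> 'k" where
  "jsum c v = (\<Sum>u\<le>\<mu>\<^sub>2. scale (c u) (johnson u v))"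

lemma johnson_jsum: "johnson i (jsum c v) = jsum c (johnson i v)"
  by (simp only: jsum_def johnson_sum johnson_scale johnson_commute[of i])

lemma jsum_add: "jsum c (v + w) = jsum c v + jsum c w"
  by (rule ext) (simp add: jsum_def sum_apply johnson_add distrib_left sum.distrib)

lemma jsum_add_coeff: "jsum (\<lambda>u. c u + d u) v = jsum c v + jsum d v"
  by (rule ext) (simp add: jsum_def sum_apply distrib_right sum.distrib)

lemma jsum_t: "jsum c t = scale (c 0) t"
proof -
  have "jsum c t = (\<Sum>u\<in>{0}. scale (c u) (johnson u t))"
    unfolding jsum_def
  proof (rule sum.mono_neutral_right)
    show "\<forall>u\<in>{..\<mu>\<^sub>2} - {0}. scale (c u) (johnson u t) = 0"
      using johnson_t by (auto simp: fun_eq_iff)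
  qed auto
  then show ?thesis using johnson_0[OF Y_in_M[OF t_in_Y]] by simp
qed

lemma jsum_unique:
  assumes "\<And>v. v \<in> M \<Longrightarrow> jsum c v = jsum d v" "u \<le> \<mu>\<^sub>2"
  shows "c u = d u"
proof -
  \<comment> \<open>in characteristic \<open>2\<close> this is the difference of the coefficients\<close>
  have "c u + d u = 0"
  proof (rule johnson_independent[OF _ assms(2)])
    fix v :: "(nat \<Rightarrow> nat) set \<Rightarrow> 'k" assume v: "v \<in> M"
    have "jsum (\<lambda>u. c u + d u) v = jsum d v + jsum d v"
      by (simp only: jsum_add_coeff assms(1)[OF v])
    then show "(\<Sum>u\<le>\<mu>\<^sub>2. scale (c u + d u) (johnson u v)) = 0"
      by (simp only: jsum_def double_eq_0)
  qed
  moreover have "d u + d u = 0" using double_eq_0[of "\<lambda>_. d u"] by (simp add: fun_eq_iff)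
  ultimately show ?thesis by (metis add_right_cancel)
qed

text \<open>
  Coefficients of a product of two combinations; the structure constants enter only through their
  parities.
\<close>
definition conv :: "(nat \<Rightarrow> 'k) \<Rightarrow> (nat \<Rightarrow> 'k) \<Rightarrow> nat \<Rightarrow> 'k" where
  "conv c d w = (\<Sum>i\<le>\<mu>\<^sub>2. \<Sum>j\<le>\<mu>\<^sub>2. c i * d j * of_bool (odd (struct_const i j w)))"

lemma jsum_jsum: "jsum c (jsum d v) = jsum (conv c d) v"
proof -
  have "jsum c (jsum d v) = (\<Sum>i\<le>\<mu>\<^sub>2. \<Sum>j\<le>\<mu>\<^sub>2. \<Sum>w\<le>\<mu>\<^sub>2.
      scale (c i * d j * of_bool (odd (struct_const i j w))) (johnson w v))"
    unfolding jsum_def johnson_sum johnson_scale johnson_product scale_sum scale_scale of_nat_k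
    by (simp only: mult.assoc)
  also have "\<dots> = (\<Sum>i\<le>\<mu>\<^sub>2. \<Sum>w\<le>\<mu>\<^sub>2. \<Sum>j\<le>\<mu>\<^sub>2.
      scale (c i * d j * of_bool (odd (struct_const i j w))) (johnson w v))"
    by (rule sum.cong[OF refl], rule sum.swap)
  also have "\<dots> = (\<Sum>w\<le>\<mu>\<^sub>2. \<Sum>i\<le>\<mu>\<^sub>2. \<Sum>j\<le>\<mu>\<^sub>2.
      scale (c i * d j * of_bool (odd (struct_const i j w))) (johnson w v))"
    by (rule sum.swap)
  also have "\<dots> = jsum (conv c d) v"
    unfolding jsum_def conv_def by (simp only: sum_scale)
  finally show ?thesis .
qed

lemma conv_eq_0:
  assumes "\<And>i j. i \<le> \<mu>\<^sub>2 \<Longrightarrow> j \<le> \<mu>\<^sub>2 \<Longrightarrow> odd (struct_const i j w) \<Longrightarrow> c i = 0 \<or> d j = 0"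
  shows "conv c d w = 0"
  unfolding conv_def
proof (intro sum.neutral ballI)
  fix i j assume "i \<in> {..\<mu>\<^sub>2}" "j \<in> {..\<mu>\<^sub>2}"
  then show "c i * d j * of_bool (odd (struct_const i j w)) = 0"
    using assms[of i j] by (cases "odd (struct_const i j w)") auto
qed

lemma projection_jsum:
  obtains \<epsilon> where "\<And>v. v \<in> M \<Longrightarrow> jsum \<epsilon> v \<in> Y" "\<And>y. y \<in> Y \<Longrightarrow> jsum \<epsilon> y = y"
proof -
  obtain D where D: "indecomposable_decomposition G H D" "Y \<in> D"
    using young_Y by (auto simp: is_young_module_def)
  obtain e where e: "e \<in> endomorphisms G M" "\<forall>v\<in>M. e v \<in> Y" "\<forall>y\<in>Y. e y = y"
    using projection_onto_summand[OF D] by blast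
  obtain \<epsilon> where "\<forall>v\<in>M. e v = jsum \<epsilon> v"
    using endomorphism_of_M_eq_sum_johnson[OF e(1)] unfolding jsum_def by blast
  then show thesis using e(2,3) Y_in_M by (intro that[of \<epsilon>]) simp_all
qed

text \<open>
  The projection onto \<open>Y\<close> is itself a combination of the \<open>johnson u\<close>, so it commutes with them.
\<close>
lemma johnson_in_Y: "y \<in> Y \<Longrightarrow> johnson u y \<in> Y"
proof -
  assume y: "y \<in> Y"
  obtain \<epsilon> where \<epsilon>: "\<And>v. v \<in> M \<Longrightarrow> jsum \<epsilon> v \<in> Y" "\<And>y. y \<in> Y \<Longrightarrow> jsum \<epsilon> y = y"
    using projection_jsum by blast
  have "johnson u y = jsum \<epsilon> (johnson u y)"
    using johnson_jsum[of u \<epsilon> y] by (simp only: \<epsilon>(2)[OF y])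
  then show ?thesis using \<epsilon>(1)[OF johnson_in_M] by metis
qed

text \<open>
  Endomorphisms of \<open>Y\<close> are represented by functions that vanish off \<open>Y\<close>, hence the case distinction.
\<close>
definition R :: "nat \<Rightarrow> ((nat \<Rightarrow> nat) set \<Rightarrow> 'k) \<Rightarrow> (nat \<Rightarrow> nat) set \<Rightarrow> 'k" where
  "R u = (\<lambda>v. if v \<in> Y then johnson u v else 0)"

lemma R_endomorphism: "R u \<in> endomorphisms G Y"
  using Y_closed(3,4)
  by (simp add: endomorphisms_def R_def johnson_in_Y johnson_add johnson_algebra_act)

text \<open>
  An endomorphism of \<open>Y\<close> composed with the projection is an endomorphism of \<open>M\<close>.
\<close>
theorem endomorphism_of_Y_eq_jsum:
  assumes f: "f \<in> endomorphisms G Y"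
  shows "\<exists>c. \<forall>y\<in>Y. f y = jsum c y"
proof -
  obtain \<epsilon> where \<epsilon>: "\<And>v. v \<in> M \<Longrightarrow> jsum \<epsilon> v \<in> Y" "\<And>y. y \<in> Y \<Longrightarrow> jsum \<epsilon> y = y"
    using projection_jsum by blast
  have f': "\<And>v. v \<in> Y \<Longrightarrow> f v \<in> Y" "\<And>u v. u \<in> Y \<Longrightarrow> v \<in> Y \<Longrightarrow> f (u + v) = f u + f v"
    "\<And>a v. a \<in> group_algebra G \<Longrightarrow> v \<in> Y \<Longrightarrow> f (algebra_act G a v) = algebra_act G a (f v)"
    using f by (simp_all add: endomorphisms_def)
  have act: "jsum \<epsilon> (algebra_act G a v) = algebra_act G a (jsum \<epsilon> v)" for a v
    by (simp only: jsum_def algebra_act_sum algebra_act_scale johnson_algebra_act)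
  define F where "F v = (if v \<in> M then f (jsum \<epsilon> v) else 0)" for v
  have "F \<in> endomorphisms G M"
    unfolding endomorphisms_def F_def
    using \<epsilon>(1) f' Y_in_M by (auto simp: jsum_add act add_in_M submodule_closed(4)[OF M_is_submodule])
  from endomorphism_of_M_eq_sum_johnson[OF this]
  obtain c where c: "\<And>v. v \<in> M \<Longrightarrow> F v = jsum c v" unfolding jsum_def by blast
  have "f y = jsum c y" if "y \<in> Y" for y
    using c[OF Y_in_M[OF that]] Y_in_M[OF that] by (simp only: F_def if_True \<epsilon>(2)[OF that])
  then show ?thesis by blast
qed

lemma johnson_disjoint:
  assumes "\<And>a. \<not> (bit i a \<and> bit j a)"
  shows "johnson i (johnson j v) = (johnson (i + j) v :: _ \<Rightarrow> 'k)"
proof -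
  have eq: "johnson i (johnson j v) = (\<Sum>u\<le>\<mu>\<^sub>2. if u = i + j then johnson u v else 0)"
    unfolding johnson_product of_nat_k odd_struct_const_disjoint_iff[OF assms]
    by (rule sum.cong[OF refl]) (simp add: scale_0_left scale_1)
  show ?thesis
  proof (cases "i + j \<le> \<mu>\<^sub>2")
    case True
    then show ?thesis unfolding eq by simp
  next
    case False
    then show ?thesis unfolding eq by (subst johnson_eq_0) (auto intro!: sum.neutral)
  qed
qed

text \<open>
  Consequently \<open>johnson u\<close> is the product of the \<open>johnson (2 ^ a)\<close> over the digits \<open>a\<close> of \<open>u\<close>.
\<close>
lemma johnson_split_bit:
  assumes "bit u a"
  shows "johnson u v = johnson (2 ^ a) (johnson (u - 2 ^ a) v :: _ \<Rightarrow> 'k)"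
proof -
  have "2 ^ a \<le> u"
    using assms by (metis bit_iff_odd div_less even_zero not_le)
  then have "u = 2 ^ a + (u - 2 ^ a)" by simp
  moreover have "johnson (2 ^ a) (johnson (u - 2 ^ a) v) = (johnson (2 ^ a + (u - 2 ^ a)) v :: _ \<Rightarrow> 'k)"
  proof (rule johnson_disjoint)
    fix b
    have "\<not> bit (u - 2 ^ a) a"
    proof -
      have "u div 2 ^ a = (u - 2 ^ a) div 2 ^ a + 1" using \<open>2 ^ a \<le> u\<close> by (simp add: le_div_geq)
      then show ?thesis using assms by (simp add: bit_iff_odd)
    qed
    then show "\<not> (bit ((2::nat) ^ a) b \<and> bit (u - 2 ^ a) b)" by (auto simp: bit_exp_iff)
  qed
  ultimately show ?thesis by simp
qed

text \<open>
  Among the summands of the square, those with \<open>u \<noteq> 2 ^ a\<close> and odd coefficient have a factor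
  \<open>johnson (2 ^ c)\<close> with \<open>c < a\<close> a digit of \<open>m\<close>, which is zero on \<open>Y\<close> by assumption.
\<close>
lemma johnson_power_2_square:
  assumes vanish: "\<And>c y. c < a \<Longrightarrow> bit m c \<Longrightarrow> y \<in> Y \<Longrightarrow> johnson (2 ^ c) y = 0" and y: "y \<in> Y"
  shows "johnson (2 ^ a) (johnson (2 ^ a) y) = (if bit m a then johnson (2 ^ a) y else 0)"
proof (cases "2 ^ a \<le> \<mu>\<^sub>2")
  case True
  have "johnson (2 ^ a) (johnson (2 ^ a) y) =
      (\<Sum>u\<le>\<mu>\<^sub>2. if u = 2 ^ a then if bit m a then johnson (2 ^ a) y else 0 else 0)"
    unfolding johnson_product of_nat_k
  proof (rule sum.cong[OF refl])
    fix u
    show "scale (of_bool (odd (struct_const (2 ^ a) (2 ^ a) u))) (johnson u y) =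
      (if u = 2 ^ a then if bit m a then johnson (2 ^ a) y else 0 else 0)"
    proof (cases "odd (struct_const (2 ^ a) (2 ^ a) u)")
      case odd: True
      show ?thesis
      proof (cases "\<exists>c<a. bit m c \<and> bit u c")
        case True
        then obtain c where c: "c < a" "bit m c" "bit u c" by blast
        have "johnson u y = 0"
          unfolding johnson_split_bit[OF c(3)] by (rule vanish[OF c(1,2) johnson_in_Y[OF y]])
        moreover have "u \<noteq> 2 ^ a" using c by (auto simp: bit_exp_iff)
        ultimately show ?thesis by (simp add: fun_eq_iff)
      next
        case False
        then have "u = 2 ^ a \<and> bit m a" using odd_struct_const_power_2[OF odd] by blast
        then show ?thesis using odd by (simp add: scale_1)
      qed
    next
      case False
      then show ?thesis using odd_struct_const_power_2_self[of a] by (auto simp: scale_0_left)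
    qed
  qed
  then show ?thesis using True by simp
qed (simp_all add: johnson_eq_0)

text \<open>
  If \<open>a\<close> is a digit of \<open>m\<close>, then inductively \<open>johnson (2 ^ a)\<close> is idempotent on \<open>Y\<close>. It kills the
  polytabloid, and \<open>Y\<close> is indecomposable, so it is zero.
\<close>
theorem johnson_vanishes_on_Y:
  assumes "bit m a" "y \<in> Y"
  shows "johnson (2 ^ a) y = 0"
  using assms
proof (induction a arbitrary: y rule: less_induct)
  case (less a)
  have square: "johnson (2 ^ a) (johnson (2 ^ a) z) = johnson (2 ^ a) z" if "z \<in> Y" for z
    using johnson_power_2_square[OF less.IH that, of a] less.prems(1) by (simp only: if_True)
  have "R (2 ^ a) y = 0"
  proof (rule idempotent_endomorphism_of_indecomposable[OF char_2 indecomposable_Y R_endomorphism])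
    show "R (2 ^ a) (R (2 ^ a) z) = R (2 ^ a) z" if "z \<in> Y" for z
      using that by (simp add: R_def johnson_in_Y square)
    show "R (2 ^ a) t = 0" by (simp add: R_def t_in_Y johnson_t)
  qed (use t_in_Y t_nonzero less.prems in auto)
  then show ?case using less.prems by (simp add: R_def)
qed

lemma johnson_eq_0_on_Y:
  assumes "\<not> avoids u" "y \<in> Y"
  shows "johnson u y = 0"
proof -
  obtain a where a: "bit m a" "bit u a" using assms by (auto simp: avoids_def)
  show ?thesis unfolding johnson_split_bit[OF a(2)]
    by (rule johnson_vanishes_on_Y[OF a(1) johnson_in_Y[OF assms(2)]])
qed

text \<open>
  A common digit \<open>a\<close> contributes the square of \<open>johnson (2 ^ a)\<close>, which is zero on \<open>Y\<close> whether or not \<open>a\<close>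
  is a digit of \<open>m\<close>.
\<close>
lemma johnson_overlap:
  assumes a: "bit i a" "bit j a" and y: "y \<in> Y"
  shows "johnson i (johnson j y) = 0"
proof (cases "bit m a")
  case True
  then have "\<not> avoids j" using a by (auto simp: avoids_def)
  then have "johnson j y = 0" using y by (rule johnson_eq_0_on_Y)
  then show ?thesis by (simp only: johnson_zero)
next
  case False
  have "johnson i (johnson j y) =
      johnson (i - 2 ^ a) (johnson (2 ^ a) (johnson (2 ^ a) (johnson (j - 2 ^ a) y)))"
    unfolding johnson_split_bit[OF a(1)] johnson_split_bit[OF a(2)]
    by (subst johnson_commute[of "2 ^ a" "i - 2 ^ a"]) (rule refl)
  also have "johnson (2 ^ a) (johnson (2 ^ a) (johnson (j - 2 ^ a) y)) = 0"
    using johnson_power_2_square[OF johnson_vanishes_on_Y johnson_in_Y[OF y], of a] False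
    by (simp only: if_False)
  finally show ?thesis by (simp only: johnson_zero)
qed

text \<open>
  Let \<open>d\<close> be the coefficients of the idempotent complementary to the projection onto \<open>Y\<close>. The
  coefficient \<open>d 0\<close> vanishes because the polytabloid lies in \<open>Y\<close>. Comparing coefficients in
  \<open>d * d = d\<close>, the least \<open>w\<close> that avoids \<open>m\<close> and has \<open>d w \<noteq> 0\<close> would satisfy
  \<open>d w = (d w)\<^sup>2 * struct_const w w w\<close> with an even structure constant; so \<open>d\<close> vanishes at all indices that
  avoid \<open>m\<close>. A combination \<open>c\<close> that is zero on \<open>Y\<close> satisfies \<open>c = c * d\<close>, and the coefficients of a
  product at an index that avoids \<open>m\<close> involve only coefficients at such indices.
\<close>
theorem johnson_independent_on_Y:
  assumes supp: "\<And>u. u \<le> \<mu>\<^sub>2 \<Longrightarrow> \<not> avoids u \<Longrightarrow> c u = 0"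
    and zero: "\<And>y. y \<in> Y \<Longrightarrow> jsum c y = 0" and u: "u \<le> \<mu>\<^sub>2"
  shows "c u = 0"
proof -
  obtain \<epsilon> where \<epsilon>: "\<And>v. v \<in> M \<Longrightarrow> jsum \<epsilon> v \<in> Y" "\<And>y. y \<in> Y \<Longrightarrow> jsum \<epsilon> y = y"
    using projection_jsum by blast
  \<comment> \<open>the identity is \<open>johnson 0\<close>; in characteristic \<open>2\<close> the complementary idempotent is a sum\<close>
  define d where "d u = of_bool (u = 0) + \<epsilon> u" for u
  have "jsum (\<lambda>u. of_bool (u = 0)) v = v" if "v \<in> M" for v
  proof -
    have "jsum (\<lambda>u. of_bool (u = 0)) v = (\<Sum>u\<le>\<mu>\<^sub>2. if u = 0 then johnson u v else 0)"
      unfolding jsum_def by (rule sum.cong[OF refl]) (simp add: scale_0_left scale_1)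
    then show ?thesis using johnson_0[OF that] by simp
  qed
  then have d: "jsum d v = v + jsum \<epsilon> v" if "v \<in> M" for v
    using that unfolding d_def jsum_add_coeff by simp
  have d_Y: "jsum d y = 0" if "y \<in> Y" for y
    using d[OF Y_in_M[OF that]] \<epsilon>(2)[OF that] by (simp only: double_eq_0)
  have d0: "d 0 = 0"
  proof -
    have "scale (d 0) t = 0" using d_Y[OF t_in_Y] by (simp only: jsum_t)
    moreover obtain C where "t C \<noteq> 0" using t_nonzero by (auto simp: fun_eq_iff)
    ultimately show ?thesis by (auto simp: fun_eq_iff)
  qed
  have apply_d: "jsum b (jsum d v) = jsum b v + jsum b (jsum \<epsilon> v)" if "v \<in> M" for b v
    by (simp only: d[OF that] jsum_add)
  have d_idem: "d w = conv d d w" if "w \<le> \<mu>\<^sub>2" for w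
  proof (rule jsum_unique[OF _ that])
    fix v :: "(nat \<Rightarrow> nat) set \<Rightarrow> 'k" assume v: "v \<in> M"
    show "jsum d v = jsum (conv d d) v"
      using apply_d[OF v, of d] d_Y[OF \<epsilon>(1)[OF v]] by (simp only: jsum_jsum add_0_right)
  qed
  have c_conv: "c w = conv c d w" if "w \<le> \<mu>\<^sub>2" for w
  proof (rule jsum_unique[OF _ that])
    fix v :: "(nat \<Rightarrow> nat) set \<Rightarrow> 'k" assume v: "v \<in> M"
    show "jsum c v = jsum (conv c d) v"
      using apply_d[OF v, of c] zero[OF \<epsilon>(1)[OF v]] by (simp only: jsum_jsum add_0_right)
  qed
  have d_avoids: "d w = 0" if "w \<le> \<mu>\<^sub>2" "avoids w" for w
    using that
  proof (induction w rule: less_induct)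
    case (less w)
    show ?case
    proof (cases "w = 0")
      case False
      show ?thesis unfolding d_idem[OF less.prems(1)]
      proof (rule conv_eq_0)
        fix i j assume "odd (struct_const i j w)"
        note sub = odd_struct_const_le[OF this]
        have "avoids i" "avoids j" using less.prems(2) sub(1,2) by (auto simp: avoids_def)
        moreover have "i < w \<or> j < w"
        proof (rule ccontr)
          assume "\<not> (i < w \<or> j < w)"
          then have "i = w" "j = w" using sub by simp_all
          then have "odd (struct_const w w w)" using \<open>odd (struct_const i j w)\<close> by simp
          moreover have "even (struct_const w w w)"
            using False less.prems(2) by (intro even_struct_const_diagonal) (auto simp: avoids_def)
          ultimately show False by simp
        qed
        ultimately show "d i = 0 \<or> d j = 0"
          using less.IH[of i] less.IH[of j] sub(4,5) less.prems(1) by auto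
      qed
    qed (simp add: d0)
  qed
  show ?thesis
  proof (cases "avoids u")
    case True
    show ?thesis unfolding c_conv[OF u]
    proof (rule conv_eq_0)
      fix i j assume odd: "odd (struct_const i j u)" and j: "j \<le> \<mu>\<^sub>2"
      have "avoids j" using True odd_struct_const_le(2)[OF odd] by (auto simp: avoids_def)
      then show "c i = 0 \<or> d j = 0" using d_avoids j by blast
    qed
  qed (use supp u in blast)
qed

end

section \<open>Square-free monomials and binary numbers\<close>

text \<open>
  Numbers are compared at the highest digit where they differ.
\<close>
lemma set_encode_less:
  assumes fin: "finite A" "finite B"
    and d: "d \<in> B" "d \<notin> A" and above: "\<And>x. d < x \<Longrightarrow> x \<in> A \<longleftrightarrow> x \<in> B"
  shows "set_encode A < set_encode B"
proof -
  \<comment> \<open>the digits above \<open>d\<close>, common to both numbers\<close>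
  let ?hi = "{x \<in> B. d < x}"
  have "A = ?hi \<union> {x \<in> A. x < d}"
    using d above by (auto simp: not_less_iff_gr_or_eq)
  then have "set_encode A = set_encode (?hi \<union> {x \<in> A. x < d})" by simp
  also have "\<dots> = set_encode ?hi + set_encode {x \<in> A. x < d}"
    unfolding set_encode_def using fin by (intro sum.union_disjoint) auto
  also have "set_encode {x \<in> A. x < d} \<le> (\<Sum>x<d. 2 ^ x)"
    unfolding set_encode_def using fin by (intro sum_mono2) auto
  also have "(\<Sum>x<d. 2 ^ x) < (2::nat) ^ d"
    by (simp add: sum_power2[unfolded atLeast0LessThan] lessThan_atLeast0 sum_power2)
  also have "set_encode ?hi + 2 ^ d = set_encode (insert d ?hi)"
    using fin by (simp add: set_encode_insert)
  also have "\<dots> \<le> set_encode B"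
    unfolding set_encode_def using fin d by (intro sum_mono2) auto
  finally show ?thesis by simp
qed

lemma exists_max_difference:
  fixes A B :: "nat set"
  assumes "finite A" "finite B" "A \<noteq> B"
  obtains d where "d \<in> A \<longleftrightarrow> d \<notin> B" "\<And>x. d < x \<Longrightarrow> x \<in> A \<longleftrightarrow> x \<in> B"
proof -
  let ?D = "(A - B) \<union> (B - A)"
  have D: "finite ?D" "?D \<noteq> {}" using assms by auto
  have "Max ?D \<in> ?D" using D by (rule Max_in)
  moreover have "x \<notin> ?D" if "Max ?D < x" for x using Max_ge[OF D(1), of x] that by auto
  ultimately show thesis by (intro that[of "Max ?D"]) blast+
qed

text \<open>
  The numbers \<open>a 1 < a 2 < \<dots>\<close> are the positions available to binary digits, and \<open>n\<close> is the number of
  \<open>u \<le> s\<close> that use only these positions. The variable \<open>x\<^sub>i\<close> will correspond to the digit \<open>a i\<close>.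
\<close>
locale free_positions =
  fixes a :: "nat \<Rightarrow> nat" and s n k :: nat
  assumes a_mono: "\<And>i j. 1 \<le> i \<Longrightarrow> i < j \<Longrightarrow> a i < a j"
    and n_eq: "n = card {u. u \<le> s \<and> set_decode u \<subseteq> a ` {1..}}"
    and n_le: "n \<le> 2 ^ k"
    and n_gr: "k \<noteq> 0 \<Longrightarrow> 2 ^ (k - 1) < n"
begin

definition \<psi> :: "nat set \<Rightarrow> nat" where
  "\<psi> I = set_encode (a ` I)"

lemma a_less_iff: "1 \<le> i \<Longrightarrow> 1 \<le> j \<Longrightarrow> a i < a j \<longleftrightarrow> i < j"
  using a_mono[of i j] a_mono[of j i] by (metis less_asym linorder_cases)

lemma inj_on_a: "inj_on a {1..}"
  by (rule inj_onI) (metis a_less_iff atLeast_iff less_irrefl linorder_cases)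

lemma a_in_image_iff: "I \<subseteq> {1..} \<Longrightarrow> 1 \<le> i \<Longrightarrow> a i \<in> a ` I \<longleftrightarrow> i \<in> I"
  using inj_on_image_mem_iff[OF inj_on_a] by simp

lemma \<psi>_less:
  assumes I: "finite I" "I \<subseteq> {1..}" and J: "finite J" "J \<subseteq> {1..}"
    and d: "d \<in> J" "d \<notin> I" and above: "\<And>x. d < x \<Longrightarrow> x \<in> I \<longleftrightarrow> x \<in> J"
  shows "\<psi> I < \<psi> J"
  unfolding \<psi>_def
proof (rule set_encode_less)
  have d1: "1 \<le> d" using d J by auto
  show "a d \<in> a ` J" using d by simp
  show "a d \<notin> a ` I" using d d1 I by (simp add: a_in_image_iff)
  fix x assume x: "a d < x"
  show "x \<in> a ` I \<longleftrightarrow> x \<in> a ` J"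
  proof (cases "x \<in> a ` {1..}")
    case True
    then obtain i where i: "1 \<le> i" "x = a i" by auto
    then have "d < i" using x d1 by (simp add: a_less_iff)
    then show ?thesis using i I J above by (simp add: a_in_image_iff)
  qed (use I J in blast)
qed (use I J in auto)

lemma weight_less:
  assumes I: "finite I" and J: "finite J"
    and d: "d \<in> J" "d \<notin> I" and above: "\<And>x. d < x \<Longrightarrow> x \<in> I \<longleftrightarrow> x \<in> J"
  shows "monomial_weight I < monomial_weight J"
  using set_encode_less[OF assms] I J by (simp add: monomial_weight_def set_encode_def)

text \<open>
  Replacing the digit \<open>i\<close> by the digit \<open>a i\<close> preserves the order, because \<open>a\<close> is increasing.
\<close>
lemma weight_le_iff:
  assumes I: "finite I" "I \<subseteq> {1..}" and J: "finite J" "J \<subseteq> {1..}"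
  shows "monomial_weight I \<le> monomial_weight J \<longleftrightarrow> \<psi> I \<le> \<psi> J"
proof (cases "I = J")
  case False
  then obtain d where d: "d \<in> I \<longleftrightarrow> d \<notin> J" "\<And>x. d < x \<Longrightarrow> x \<in> I \<longleftrightarrow> x \<in> J"
    using exists_max_difference I J by blast
  show ?thesis
  proof (cases "d \<in> J")
    case True
    then have "\<psi> I < \<psi> J" "monomial_weight I < monomial_weight J"
      using d I J by (auto intro!: \<psi>_less[of I J d] weight_less[of I J d])
    then show ?thesis by simp
  next
    case False
    then have "\<psi> J < \<psi> I" "monomial_weight J < monomial_weight I"
      using d I J by (auto intro!: \<psi>_less[of J I d] weight_less[of J I d])
    then show ?thesis by simp
  qed
qed simp

lemma \<psi>_inj:
  assumes I: "finite I" "I \<subseteq> {1..}" and J: "finite J" "J \<subseteq> {1..}" and eq: "\<psi> I = \<psi> J"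
  shows "I = J"
proof -
  have "a ` I = a ` J"
    using eq I J set_encode_eq[of "a ` I" "a ` J"] by (simp add: \<psi>_def)
  then show ?thesis using inj_on_image_eq_iff[OF inj_on_a I(2) J(2)] by simp
qed

lemma subset_k: "J \<subseteq> {1..k} \<Longrightarrow> finite J \<and> J \<subseteq> {1..}"
  using finite_subset by auto

lemma inj_on_\<psi>: "inj_on \<psi> {J. J \<subseteq> {1..k} \<and> P J}"
  by (rule inj_onI) (use \<psi>_inj subset_k in blast)

abbreviation "U \<equiv> {u. u \<le> s \<and> set_decode u \<subseteq> a ` {1..}}"

lemma finite_U: "finite U"
  by (rule finite_subset[of _ "{..s}"]) auto

lemma \<psi>_in_U:
  assumes "finite J" "J \<subseteq> {1..}" "\<psi> J \<le> s"
  shows "\<psi> J \<in> U"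
  using assms by (auto simp: \<psi>_def)

text \<open>
  If \<open>J\<close> contained some \<open>j > k\<close>, then \<open>2 ^ a j \<le> s\<close>. All \<open>2 ^ k\<close> sums of distinct powers among
  \<open>2 ^ a 1, \<dots>, 2 ^ a k\<close> are smaller than \<open>2 ^ a j\<close>, so together with it there would be more than
  \<open>2 ^ k \<ge> n\<close> admissible numbers.
\<close>
lemma bounded_by_k:
  assumes J: "finite J" "J \<subseteq> {1..}" "\<psi> J \<le> s"
  shows "J \<subseteq> {1..k}"
proof (rule ccontr)
  assume "\<not> J \<subseteq> {1..k}"
  then obtain j where j: "j \<in> J" "k < j" using J by force
  have j1: "1 \<le> j" using j J by auto
  have \<psi>j: "\<psi> {j} \<le> \<psi> J"
    unfolding \<psi>_def set_encode_def using J j by (intro sum_mono2) auto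
  have small: "\<psi> J' < \<psi> {j}" if "J' \<subseteq> {1..k}" for J'
    by (rule \<psi>_less[where d = j]) (use that subset_k[OF that] j j1 in auto)
  let ?F = "insert {j} {J'. J' \<subseteq> {1..k}}"
  have "inj_on \<psi> ?F"
  proof (rule inj_onI)
    fix I J' assume "I \<in> ?F" "J' \<in> ?F" and eq: "\<psi> I = \<psi> J'"
    then have "finite I \<and> I \<subseteq> {1..}" "finite J' \<and> J' \<subseteq> {1..}" using subset_k j1 by auto
    then show "I = J'" using \<psi>_inj eq by blast
  qed
  moreover have "\<psi> ` ?F \<subseteq> U"
  proof (rule image_subsetI)
    fix J' assume J': "J' \<in> ?F"
    show "\<psi> J' \<in> U"
    proof (rule \<psi>_in_U)
      show "finite J'" "J' \<subseteq> {1..}" using J' subset_k j1 by auto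
      show "\<psi> J' \<le> s" using J' small[of J'] \<psi>j J(3) by auto
    qed
  qed
  ultimately have "card ?F \<le> n"
    unfolding n_eq using finite_U by (rule card_inj_on_le)
  moreover have "card ?F = Suc (2 ^ k)"
  proof -
    have "{j} \<notin> {J'. J' \<subseteq> {1..k}}" using j by auto
    moreover have "card {J'. J' \<subseteq> {1..k}} = 2 ^ k" using card_Pow[of "{1..k}"] by (simp add: Pow_def)
    moreover have "finite {J'. J' \<subseteq> {1..k}}" by simp
    ultimately show ?thesis by (simp only: card_insert_disjoint not_False_eq_True)
  qed
  ultimately show False using n_le by simp
qed

lemma bij_betw_\<psi>: "bij_betw \<psi> {J. J \<subseteq> {1..k} \<and> \<psi> J \<le> s} U"
proof (rule bij_betw_imageI)
  show "\<psi> ` {J. J \<subseteq> {1..k} \<and> \<psi> J \<le> s} = U"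
  proof
    show "\<psi> ` {J. J \<subseteq> {1..k} \<and> \<psi> J \<le> s} \<subseteq> U" using \<psi>_in_U subset_k by blast
    show "U \<subseteq> \<psi> ` {J. J \<subseteq> {1..k} \<and> \<psi> J \<le> s}"
    proof
      fix u assume u: "u \<in> U"
      then have "set_decode u \<subseteq> a ` {1..}" by simp
      then obtain J where J: "J \<subseteq> {1..}" "set_decode u = a ` J" using subset_imageE by blast
      have "finite J"
      proof (rule finite_imageD)
        show "finite (a ` J)" using J(2) finite_set_decode[of u] by simp
        show "inj_on a J" using inj_on_a J(1) by (rule inj_on_subset)
      qed
      moreover have \<psi>J: "\<psi> J = u" unfolding \<psi>_def J(2)[symmetric] by (rule set_decode_inverse)
      ultimately have "J \<subseteq> {1..k}" using bounded_by_k[of J] J(1) u by simp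
      then show "u \<in> \<psi> ` {J. J \<subseteq> {1..k} \<and> \<psi> J \<le> s}" using \<psi>J u by auto
    qed
  qed
qed (rule inj_on_\<psi>)

lemma card_bounded: "card {J. J \<subseteq> {1..k} \<and> \<psi> J \<le> s} = n"
  unfolding n_eq by (rule bij_betw_same_card[OF bij_betw_\<psi>])

lemma finite_family: "finite {J. J \<subseteq> {1..k} \<and> P J}"
  by (rule finite_subset[of _ "Pow {1..k}"]) auto

text \<open>
  Positions count nonempty sets only; the empty set accounts for the successor.
\<close>
lemma Suc_position:
  assumes I: "I \<subseteq> {1..k}"
  shows "Suc (monomial_position k I) = card {J. J \<subseteq> {1..k} \<and> \<psi> J \<le> \<psi> I}"
proof -
  let ?F = "{J. J \<noteq> {} \<and> J \<subseteq> {1..k} \<and> monomial_weight J \<le> monomial_weight I}"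
  have "{J. J \<subseteq> {1..k} \<and> \<psi> J \<le> \<psi> I} = {J. J \<subseteq> {1..k} \<and> monomial_weight J \<le> monomial_weight I}"
    using weight_le_iff subset_k I by blast
  also have "\<dots> = insert {} ?F" by (auto simp: monomial_weight_def)
  finally show ?thesis
    using finite_family[of "\<lambda>J. J \<noteq> {} \<and> monomial_weight J \<le> monomial_weight I"]
    by (simp add: monomial_position_def conj_left_commute)
qed

text \<open>
  The admissible numbers up to \<open>s\<close> form an initial segment of length \<open>n\<close> of the chain.
\<close>
theorem position_ge_iff:
  assumes I: "I \<subseteq> {1..k}"
  shows "n \<le> monomial_position k I \<longleftrightarrow> s < \<psi> I"
proof (cases "\<psi> I \<le> s")
  case True
  then have "card {J. J \<subseteq> {1..k} \<and> \<psi> J \<le> \<psi> I} \<le> card {J. J \<subseteq> {1..k} \<and> \<psi> J \<le> s}"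
    by (intro card_mono finite_family) auto
  then show ?thesis using True Suc_position[OF I] card_bounded by simp
next
  case False
  then have "insert I {J. J \<subseteq> {1..k} \<and> \<psi> J \<le> s} \<subseteq> {J. J \<subseteq> {1..k} \<and> \<psi> J \<le> \<psi> I}"
    using I by auto
  then have "card (insert I {J. J \<subseteq> {1..k} \<and> \<psi> J \<le> s}) \<le> Suc (monomial_position k I)"
    unfolding Suc_position[OF I] by (intro card_mono finite_family)
  moreover have "card (insert I {J. J \<subseteq> {1..k} \<and> \<psi> J \<le> s}) = Suc n"
    using False finite_family[of "\<lambda>J. \<psi> J \<le> s"] card_bounded by simp
  ultimately show ?thesis using False by simp
qed

text \<open>
  A set of indices below \<open>k\<close> has position less than \<open>2 ^ (k - 1) < n\<close>, so every monomial of position at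
  least \<open>n\<close> is divisible by the last variable.
\<close>
lemma last_index_mem:
  assumes I: "I \<subseteq> {1..k}" and pos: "n \<le> monomial_position k I"
  shows "k \<in> I"
proof (rule ccontr)
  assume k: "k \<notin> I"
  have sub: "{J. J \<subseteq> {1..k} \<and> \<psi> J \<le> \<psi> I} \<subseteq> Pow {1..k - 1}"
  proof
    fix J assume "J \<in> {J. J \<subseteq> {1..k} \<and> \<psi> J \<le> \<psi> I}"
    then have J: "J \<subseteq> {1..k}" "\<psi> J \<le> \<psi> I" by auto
    have "k \<notin> J"
    proof
      assume "k \<in> J"
      then have "\<psi> I < \<psi> J"
        using k I J subset_k[OF I] subset_k[OF J(1)] by (intro \<psi>_less[where d = k]) auto
      with J(2) show False by simp
    qed
    have "x \<in> {1..k - 1}" if "x \<in> J" for x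
    proof -
      have "x \<noteq> k" using that \<open>k \<notin> J\<close> by blast
      then show ?thesis using that J(1) by force
    qed
    then show "J \<in> Pow {1..k - 1}" by blast
  qed
  have "Suc (monomial_position k I) \<le> card (Pow {1..k - 1})"
    unfolding Suc_position[OF I] by (rule card_mono[OF _ sub]) simp
  then have "Suc n \<le> 2 ^ (k - 1)" using pos by (simp add: card_Pow)
  moreover have "n \<noteq> 0"
  proof -
    have "0 \<in> U" by (simp add: set_decode_zero)
    then show ?thesis unfolding n_eq using finite_U by (auto simp: card_eq_0_iff)
  qed
  ultimately show False using n_gr by (cases "k = 0") auto
qed

end

section \<open>Polynomials as finitely supported functions\<close>

lemma poly_mapping_expansion:
  fixes p :: "'a \<Rightarrow>\<^sub>0 'b::comm_monoid_add"
  shows "p = (\<Sum>x\<in>Poly_Mapping.keys p. Poly_Mapping.single x (Poly_Mapping.lookup p x))"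
proof (rule poly_mapping_eqI)
  fix x
  show "Poly_Mapping.lookup p x =
      Poly_Mapping.lookup (\<Sum>x\<in>Poly_Mapping.keys p. Poly_Mapping.single x (Poly_Mapping.lookup p x)) x"
    by (simp add: lookup_sum lookup_single when_def in_keys_iff)
qed

lemma poly_mapping_mult_expansion:
  fixes p q :: "'a::monoid_add \<Rightarrow>\<^sub>0 'b::comm_semiring_0"
  shows "p * q = (\<Sum>x\<in>Poly_Mapping.keys p. \<Sum>y\<in>Poly_Mapping.keys q.
    Poly_Mapping.single (x + y) (Poly_Mapping.lookup p x * Poly_Mapping.lookup q y))"
  by (subst poly_mapping_expansion[of p], subst poly_mapping_expansion[of q])
     (simp only: sum_product mult_single)

lemma keys_add_nat:
  fixes x y :: "'a \<Rightarrow>\<^sub>0 nat"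
  shows "Poly_Mapping.keys (x + y) = Poly_Mapping.keys x \<union> Poly_Mapping.keys y"
  by (auto simp: in_keys_iff lookup_add)

definition square_free :: "(nat \<Rightarrow>\<^sub>0 nat) \<Rightarrow> bool" where
  "square_free x \<longleftrightarrow> (\<forall>i. Poly_Mapping.lookup x i \<le> 1)"

definition support_monomial :: "nat set \<Rightarrow> nat \<Rightarrow>\<^sub>0 nat" where
  "support_monomial I = (\<Sum>i\<in>I. Poly_Mapping.single i 1)"

lemma lookup_support_monomial:
  "finite I \<Longrightarrow> Poly_Mapping.lookup (support_monomial I) j = of_bool (j \<in> I)"
  by (simp add: support_monomial_def lookup_sum lookup_single when_def)

lemma keys_support_monomial: "finite I \<Longrightarrow> Poly_Mapping.keys (support_monomial I) = I"
  by (auto simp: in_keys_iff lookup_support_monomial)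

lemma square_free_support_monomial: "finite I \<Longrightarrow> square_free (support_monomial I)"
  by (simp add: square_free_def lookup_support_monomial)

lemma square_free_eq_support_monomial:
  assumes "square_free x"
  shows "x = support_monomial (Poly_Mapping.keys x)"
proof (rule poly_mapping_eqI)
  fix i
  have "Poly_Mapping.lookup x i \<le> 1" using assms by (simp add: square_free_def)
  then show "Poly_Mapping.lookup x i = Poly_Mapping.lookup (support_monomial (Poly_Mapping.keys x)) i"
    by (auto simp: lookup_support_monomial in_keys_iff)
qed

lemma square_free_add_iff:
  "square_free (x + y) \<longleftrightarrow> square_free x \<and> square_free y \<and> Poly_Mapping.keys x \<inter> Poly_Mapping.keys y = {}"
proof -
  have le_1: "u + v \<le> 1 \<longleftrightarrow> u \<le> 1 \<and> v \<le> 1 \<and> (u = 0 \<or> v = 0)" for u v :: nat by linarith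
  have disjoint: "Poly_Mapping.keys x \<inter> Poly_Mapping.keys y = {} \<longleftrightarrow>
      (\<forall>i. Poly_Mapping.lookup x i = 0 \<or> Poly_Mapping.lookup y i = 0)"
    unfolding disjoint_iff in_keys_iff by metis
  show ?thesis unfolding square_free_def lookup_add le_1 disjoint by (simp only: all_conj_distrib)
qed

lemma sqfree_monomial_eq: "finite I \<Longrightarrow> sqfree_monomial I = Poly_Mapping.single (support_monomial I) (1 :: 'k::field)"
proof (induction I rule: finite_induct)
  case (insert i I)
  then show ?case
    by (simp add: sqfree_monomial_def support_monomial_def mpoly_var_def mult_single)
qed (simp add: sqfree_monomial_def support_monomial_def)

lemma mpoly_var_power2:
  "mpoly_var i ^ 2 = Poly_Mapping.single (Poly_Mapping.single i 2) (1 :: 'k::field)"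
proof -
  have "Poly_Mapping.single i 1 + Poly_Mapping.single i 1 = Poly_Mapping.single i (2 :: nat)"
    by (rule poly_mapping_eqI) (simp add: lookup_add lookup_single when_def)
  then show ?thesis by (simp only: mpoly_var_def power2_eq_square mult_single mult_1_left)
qed

lemma mpoly_ring_simps:
  "carrier (mpoly_ring k) = {p :: 'k::field mpoly. \<forall>x\<in>Poly_Mapping.keys p. Poly_Mapping.keys x \<subseteq> {1..k}}"
  "p \<otimes>\<^bsub>mpoly_ring k\<^esub> q = p * q" "p \<oplus>\<^bsub>mpoly_ring k\<^esub> q = p + q"
  "\<one>\<^bsub>mpoly_ring k\<^esub> = 1" "\<zero>\<^bsub>mpoly_ring k\<^esub> = 0"
  by (simp_all add: mpoly_ring_def ring_of_type_algebra_def)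

lemma mpoly_ring_is_ring: "ring (mpoly_ring k :: 'k::field mpoly ring)"
proof -
  interpret T: ring "ring_of_type_algebra :: 'k mpoly ring" by (rule ring_from_type_algebra)
  have minus: "\<ominus>\<^bsub>ring_of_type_algebra\<^esub> p = - p" for p :: "'k mpoly"
    by (rule T.minus_equality) (simp_all add: ring_of_type_algebra_def)
  have "subring {p :: 'k mpoly. \<forall>x\<in>Poly_Mapping.keys p. Poly_Mapping.keys x \<subseteq> {1..k}} ring_of_type_algebra"
  proof (rule T.subringI)
    fix p q :: "'k mpoly"
    assume p: "p \<in> {p. \<forall>x\<in>Poly_Mapping.keys p. Poly_Mapping.keys x \<subseteq> {1..k}}"
      and q: "q \<in> {p. \<forall>x\<in>Poly_Mapping.keys p. Poly_Mapping.keys x \<subseteq> {1..k}}"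
    have "Poly_Mapping.keys x \<subseteq> {1..k}" if "x \<in> Poly_Mapping.keys (p * q)" for x
    proof -
      obtain y z where "x = y + z" "y \<in> Poly_Mapping.keys p" "z \<in> Poly_Mapping.keys q"
        using \<open>x \<in> Poly_Mapping.keys (p * q)\<close> keys_mult[of p q] by blast
      then show ?thesis using p q by (auto simp: keys_add_nat)
    qed
    then show "p \<otimes>\<^bsub>ring_of_type_algebra\<^esub> q \<in> {p. \<forall>x\<in>Poly_Mapping.keys p. Poly_Mapping.keys x \<subseteq> {1..k}}"
      by (simp add: ring_of_type_algebra_def)
    show "p \<oplus>\<^bsub>ring_of_type_algebra\<^esub> q \<in> {p. \<forall>x\<in>Poly_Mapping.keys p. Poly_Mapping.keys x \<subseteq> {1..k}}"
      using p q Poly_Mapping.keys_add[of p q] by (auto simp: ring_of_type_algebra_def)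
    have "Poly_Mapping.keys (- p) = Poly_Mapping.keys p" by (auto simp: in_keys_iff)
    then show "\<ominus>\<^bsub>ring_of_type_algebra\<^esub> p \<in> {p. \<forall>x\<in>Poly_Mapping.keys p. Poly_Mapping.keys x \<subseteq> {1..k}}"
      using p by (simp add: minus)
  qed (simp_all add: ring_of_type_algebra_def)
  then show ?thesis unfolding mpoly_ring_def by (rule T.subring_is_ring)
qed

section \<open>The endomorphism algebra of the Young module\<close>

lemma (in vector_space) independent_image:
  assumes fin: "finite U" and inj: "inj_on g U"
    and zero: "\<forall>c. (\<Sum>u\<in>U. scale (c u) (g u)) = 0 \<longrightarrow> (\<forall>u\<in>U. c u = 0)"
  shows "independent (g ` U)"
proof (rule independent_if_scalars_zero)
  fix c x
  assume sum: "(\<Sum>x\<in>g ` U. scale (c x) x) = 0" and x: "x \<in> g ` U"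
  obtain u where u: "x = g u" "u \<in> U" using x by (rule imageE)
  have "(\<Sum>u\<in>U. scale (c (g u)) (g u)) = 0"
    using sum unfolding sum.reindex[OF inj] o_def .
  then show "c x = 0"
    using zero[rule_format, of "\<lambda>u. c (g u)" u] u by simp
qed (simp add: fin)

context young_summand
begin

lemma endomorphismsD:
  assumes "f \<in> endomorphisms G Y"
  shows "\<And>v. v \<notin> Y \<Longrightarrow> f v = 0" "\<And>v. v \<in> Y \<Longrightarrow> f v \<in> Y"
    "\<And>u v. u \<in> Y \<Longrightarrow> v \<in> Y \<Longrightarrow> f (u + v) = f u + f v"
    "\<And>a v. a \<in> group_algebra G \<Longrightarrow> v \<in> Y \<Longrightarrow> f (algebra_act G a v) = algebra_act G a (f v)"
    "f 0 = 0"
  using assms endomorphism_linear(1)[OF assms submodule_Y] by (simp_all add: endomorphisms_def)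

lemma endomorphismsI:
  assumes "\<And>v. v \<notin> Y \<Longrightarrow> f v = 0" "\<And>v. v \<in> Y \<Longrightarrow> f v \<in> Y"
    "\<And>u v. u \<in> Y \<Longrightarrow> v \<in> Y \<Longrightarrow> f (u + v) = f u + f v"
    "\<And>a v. a \<in> group_algebra G \<Longrightarrow> v \<in> Y \<Longrightarrow> f (algebra_act G a v) = algebra_act G a (f v)"
  shows "f \<in> endomorphisms G Y"
  using assms by (simp add: endomorphisms_def)

lemma endomorphisms_add:
  assumes f: "f \<in> endomorphisms G Y" and g: "g \<in> endomorphisms G Y"
  shows "f + g \<in> endomorphisms G Y"
proof (rule endomorphismsI)
  show "(f + g) v = 0" if "v \<notin> Y" for v
    by (simp only: plus_fun_apply endomorphismsD(1)[OF f that] endomorphismsD(1)[OF g that] add_0_right)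
  show "(f + g) v \<in> Y" if "v \<in> Y" for v
    using Y_closed(3)[OF endomorphismsD(2)[OF f that] endomorphismsD(2)[OF g that]]
    by (simp only: plus_fun_apply)
  show "(f + g) (u + v) = (f + g) u + (f + g) v" if "u \<in> Y" "v \<in> Y" for u v
    by (simp only: plus_fun_apply endomorphismsD(3)[OF f that] endomorphismsD(3)[OF g that] add_ac)
  show "(f + g) (algebra_act G a v) = algebra_act G a ((f + g) v)"
    if "a \<in> group_algebra G" "v \<in> Y" for a v
    by (simp only: plus_fun_apply endomorphismsD(4)[OF f that] endomorphismsD(4)[OF g that] algebra_act_add)
qed

lemma endomorphisms_comp:
  assumes f: "f \<in> endomorphisms G Y" and g: "g \<in> endomorphisms G Y"
  shows "f \<circ> g \<in> endomorphisms G Y"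
proof (rule endomorphismsI)
  note g_in = endomorphismsD(2)[OF g]
  show "(f \<circ> g) v = 0" if "v \<notin> Y" for v
    by (simp only: o_apply endomorphismsD(1)[OF g that] endomorphismsD(5)[OF f])
  show "(f \<circ> g) v \<in> Y" if "v \<in> Y" for v
    using endomorphismsD(2)[OF f g_in[OF that]] by (simp only: o_apply)
  show "(f \<circ> g) (u + v) = (f \<circ> g) u + (f \<circ> g) v" if "u \<in> Y" "v \<in> Y" for u v
    by (simp only: o_apply endomorphismsD(3)[OF g that] endomorphismsD(3)[OF f g_in[OF that(1)] g_in[OF that(2)]])
  show "(f \<circ> g) (algebra_act G a v) = algebra_act G a ((f \<circ> g) v)"
    if "a \<in> group_algebra G" "v \<in> Y" for a v
    by (simp only: o_apply endomorphismsD(4)[OF g that] endomorphismsD(4)[OF f that(1) g_in[OF that(2)]])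
qed

lemma endomorphisms_zero: "0 \<in> endomorphisms G Y"
  by (rule endomorphismsI) (simp_all only: zero_fun_apply Y_closed(2) algebra_act_0 add_0_right)

lemma endomorphisms_one: "(\<lambda>v. if v \<in> Y then v else 0) \<in> endomorphisms G Y"
  by (rule endomorphismsI) (simp_all add: Y_closed)

lemma endo_algebra_simps:
  "carrier (endo_algebra G Y) = endomorphisms G Y" "f \<otimes>\<^bsub>endo_algebra G Y\<^esub> g = f \<circ> g"
  "f \<oplus>\<^bsub>endo_algebra G Y\<^esub> g = f + g" "\<one>\<^bsub>endo_algebra G Y\<^esub> = (\<lambda>v. if v \<in> Y then v else 0)"
  "\<zero>\<^bsub>endo_algebra G Y\<^esub> = 0" "c \<odot>\<^bsub>endo_algebra G Y\<^esub> f = scale_endo c f"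
  by (simp_all add: endo_algebra_def)

lemma endo_algebra_is_ring: "ring (endo_algebra G Y)"
proof (rule ringI)
  show "abelian_group (endo_algebra G Y)"
  proof (rule abelian_groupI; unfold endo_algebra_simps)
    fix f assume "f \<in> endomorphisms G Y"
    moreover have "f + f = 0" by (rule ext) (simp only: plus_fun_apply zero_fun_apply double_eq_0)
    ultimately show "\<exists>g\<in>endomorphisms G Y. g + f = 0" by blast
  qed (simp_all add: endomorphisms_add endomorphisms_zero add_ac)
  show "Group.monoid (endo_algebra G Y)"
  proof (rule monoidI; unfold endo_algebra_simps)
    fix f assume f: "f \<in> endomorphisms G Y"
    have "(if f v \<in> Y then f v else 0) = f v" for v
      using endomorphismsD(1,2)[OF f] Y_closed(2) by (cases "v \<in> Y") auto
    then show "(\<lambda>v. if v \<in> Y then v else 0) \<circ> f = f" by (simp only: fun_eq_iff o_apply) simp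
    have "f (if v \<in> Y then v else 0) = f v" for v
      using endomorphismsD(1)[OF f, of v] endomorphismsD(5)[OF f] by (cases "v \<in> Y") simp_all
    then show "f \<circ> (\<lambda>v. if v \<in> Y then v else 0) = f" by (simp only: fun_eq_iff o_apply) simp
  qed (simp_all add: endomorphisms_comp endomorphisms_one o_assoc)
next
  fix f g h assume "f \<in> carrier (endo_algebra G Y)" "g \<in> carrier (endo_algebra G Y)" "h \<in> carrier (endo_algebra G Y)"
  then have f: "f \<in> endomorphisms G Y" and g: "g \<in> endomorphisms G Y" and h: "h \<in> endomorphisms G Y"
    by (simp_all add: endo_algebra_simps)
  show "(f \<oplus>\<^bsub>endo_algebra G Y\<^esub> g) \<otimes>\<^bsub>endo_algebra G Y\<^esub> h =
    f \<otimes>\<^bsub>endo_algebra G Y\<^esub> h \<oplus>\<^bsub>endo_algebra G Y\<^esub> g \<otimes>\<^bsub>endo_algebra G Y\<^esub> h"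
    unfolding endo_algebra_simps by (rule ext) (simp only: o_apply plus_fun_apply)
  show "h \<otimes>\<^bsub>endo_algebra G Y\<^esub> (f \<oplus>\<^bsub>endo_algebra G Y\<^esub> g) =
    h \<otimes>\<^bsub>endo_algebra G Y\<^esub> f \<oplus>\<^bsub>endo_algebra G Y\<^esub> h \<otimes>\<^bsub>endo_algebra G Y\<^esub> g"
    unfolding endo_algebra_simps
  proof (rule ext)
    fix v
    show "(h \<circ> (f + g)) v = ((h \<circ> f) + (h \<circ> g)) v"
    proof (cases "v \<in> Y")
      case True
      show ?thesis
        by (simp only: o_apply plus_fun_apply
            endomorphismsD(3)[OF h endomorphismsD(2)[OF f True] endomorphismsD(2)[OF g True]])
    next
      case False
      show ?thesis
        by (simp only: o_apply plus_fun_apply endomorphismsD(1)[OF f False] endomorphismsD(1)[OF g False]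
            endomorphismsD(5)[OF h] add_0_right)
    qed
  qed
qed

lemma jsum_eq_sum_avoids:
  assumes "y \<in> Y"
  shows "jsum c y = (\<Sum>u | u \<le> \<mu>\<^sub>2 \<and> avoids u. scale (c u) (johnson u y))"
  unfolding jsum_def
proof (rule sum.mono_neutral_right)
  show "\<forall>u\<in>{..\<mu>\<^sub>2} - {u. u \<le> \<mu>\<^sub>2 \<and> avoids u}. scale (c u) (johnson u y) = 0"
    using johnson_eq_0_on_Y[OF _ assms] by (auto simp: fun_eq_iff)
qed auto

text \<open>
  The restrictions of the \<open>johnson u\<close> with \<open>u \<le> \<mu>\<^sub>2\<close> avoiding \<open>m\<close> are a basis.
\<close>
theorem dim_endomorphisms:
  "vector_space.dim scale_endo (endomorphisms G Y) = card {u. u \<le> \<mu>\<^sub>2 \<and> avoids u}"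
proof -
  interpret vs: vector_space "scale_endo :: 'k \<Rightarrow> (((nat \<Rightarrow> nat) set \<Rightarrow> 'k) \<Rightarrow> (nat \<Rightarrow> nat) set \<Rightarrow> 'k) \<Rightarrow> _"
    by (rule vector_space_scale_endo)
  let ?U = "{u. u \<le> \<mu>\<^sub>2 \<and> avoids u}"
  have finU: "finite ?U" by simp
  have combo: "(\<Sum>u\<in>?U. scale_endo (c u) (R u)) = (\<lambda>y. if y \<in> Y then jsum c y else 0)" for c
  proof
    fix y
    show "(\<Sum>u\<in>?U. scale_endo (c u) (R u)) y = (if y \<in> Y then jsum c y else 0)"
    proof (cases "y \<in> Y")
      case True
      then show ?thesis by (simp add: sum_apply[of _ _ y] scale_endo_def R_def jsum_eq_sum_avoids)
    next
      case False
      then have "(\<Sum>u\<in>?U. scale_endo (c u) (R u) y) = 0"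
        by (intro sum.neutral) (simp add: scale_endo_def R_def fun_eq_iff)
      then show ?thesis using False by (simp add: sum_apply[of _ _ y])
    qed
  qed
  have independent: "\<And>c u. (\<Sum>u\<in>?U. scale_endo (c u) (R u)) = 0 \<Longrightarrow> u \<in> ?U \<Longrightarrow> c u = 0"
  proof -
    fix c :: "nat \<Rightarrow> 'k" and u
    assume zero: "(\<Sum>u\<in>?U. scale_endo (c u) (R u)) = 0" and u: "u \<in> ?U"
    define c' where "c' u = (if u \<in> ?U then c u else 0)" for u
    have "c' u = 0"
    proof (rule johnson_independent_on_Y)
      fix y assume y: "y \<in> Y"
      have "jsum c' y = jsum c y"
        unfolding jsum_eq_sum_avoids[OF y] by (rule sum.cong) (simp_all add: c'_def)
      also have "\<dots> = 0" using fun_cong[OF zero, of y] y unfolding combo by (simp only: if_True zero_fun_apply)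
      finally show "jsum c' y = 0" .
    next
      show "u \<le> \<mu>\<^sub>2" using u by simp
      show "c' u = 0" if "u \<le> \<mu>\<^sub>2" "\<not> avoids u" for u using that by (simp add: c'_def)
    qed
    then show "c u = 0" using u by (simp add: c'_def)
  qed
  have inj: "inj_on R ?U"
  proof (rule inj_onI, rule ccontr)
    fix u w assume u: "u \<in> ?U" and w: "w \<in> ?U" and eq: "R u = R w" and ne: "u \<noteq> w"
    \<comment> \<open>in characteristic \<open>2\<close>, equal images of \<open>u\<close> and \<open>w\<close> would give the relation \<open>R u + R w = 0\<close>\<close>
    define c where "c x = (of_bool (x = u) + of_bool (x = w) :: 'k)" for x
    have "(\<Sum>x\<in>?U. scale_endo (c x) (R x)) = (\<Sum>x\<in>?U. (if x = u then R u else 0) + (if x = w then R w else 0))"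
    proof (rule sum.cong[OF refl])
      fix x
      show "scale_endo (c x) (R x) = (if x = u then R u else 0) + (if x = w then R w else 0)"
        using ne by (cases "x = u"; cases "x = w")
          (simp_all only: c_def of_bool_eq simp_thms if_True if_False add_0_left add_0_right
            vs.scale_one vs.scale_zero_left)
    qed
    also have "\<dots> = R u + R w" using u w finU by (simp only: sum.distrib sum.delta' sum.delta if_True)
    also have "\<dots> = 0" unfolding eq by (rule ext) (simp only: plus_fun_apply zero_fun_apply double_eq_0)
    finally have "c u = 0" using u by (rule independent[of c])
    then show False using ne by (simp add: c_def)
  qed
  show ?thesis
  proof (rule vs.dim_unique)
    show "R ` ?U \<subseteq> endomorphisms G Y" by (rule image_subsetI, rule R_endomorphism)
    show "endomorphisms G Y \<subseteq> vs.span (R ` ?U)"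
    proof
      fix f assume f: "f \<in> endomorphisms G Y"
      obtain c where c: "\<forall>y\<in>Y. f y = jsum c y" using endomorphism_of_Y_eq_jsum[OF f] by blast
      have f_eq: "f = (\<Sum>u\<in>?U. scale_endo (c u) (R u))"
        unfolding combo
      proof (rule ext)
        fix y
        show "f y = (if y \<in> Y then jsum c y else 0)"
          using bspec[OF c, of y] endomorphismsD(1)[OF f, of y]
          by (cases "y \<in> Y") (simp_all only: if_True if_False not_False_eq_True)
      qed
      have "scale_endo (c u) (R u) \<in> vs.span (R ` ?U)" if "u \<in> ?U" for u
        using that by (rule vs.span_scale[OF vs.span_base[OF imageI]])
      then have "(\<Sum>u\<in>?U. scale_endo (c u) (R u)) \<in> vs.span (R ` ?U)" by (rule vs.span_sum)
      then show "f \<in> vs.span (R ` ?U)" unfolding f_eq .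
    qed
    show "vs.independent (R ` ?U)"
    proof (rule vs.independent_image[OF finU inj], rule allI, rule impI, rule ballI)
      fix c :: "nat \<Rightarrow> 'k" and u
      assume "(\<Sum>u\<in>?U. scale_endo (c u) (R u)) = 0" and "u \<in> ?U"
      then show "c u = 0" by (rule independent[of c])
    qed
    show "card (R ` ?U) = card ?U" using inj by (rule card_image)
  qed
qed

end

section \<open>The presentation by generators and relations\<close>

text \<open>
  Now the available digits are those that are not digits of \<open>m\<close>.
\<close>
locale presentation = young_summand \<mu>\<^sub>1 \<mu>\<^sub>2 Y + free_positions a \<mu>\<^sub>2 n k
  for \<mu>\<^sub>1 \<mu>\<^sub>2 :: nat and Y :: "((nat \<Rightarrow> nat) set \<Rightarrow> 'k::field) set" and a :: "nat \<Rightarrow> nat" and n k :: nat +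
  assumes range_a: "a ` {1..} = {c. \<not> bit m c}"
begin

lemma set_decode_eq_bits: "set_decode u = {c. bit u c}"
  by (simp add: set_decode_def bit_iff_odd)

lemma avoids_iff: "avoids u \<longleftrightarrow> set_decode u \<subseteq> a ` {1..}"
  unfolding avoids_def range_a set_decode_eq_bits by blast

lemma bit_\<psi>: "finite I \<Longrightarrow> bit (\<psi> I) c \<longleftrightarrow> c \<in> a ` I"
proof -
  assume "finite I"
  then have "set_decode (\<psi> I) = a ` I"
    unfolding \<psi>_def by (rule set_encode_inverse[OF finite_imageI])
  then have "{c. bit (\<psi> I) c} = a ` I" unfolding set_decode_eq_bits .
  then show ?thesis by (metis mem_Collect_eq)
qed

lemma \<psi>_disjoint_union:
  assumes "finite I" "finite J" "I \<subseteq> {1..}" "J \<subseteq> {1..}" "I \<inter> J = {}"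
  shows "\<psi> (I \<union> J) = \<psi> I + \<psi> J"
proof -
  have "a ` I \<inter> a ` J = {}"
    using assms inj_on_image_Int[OF inj_on_a, of I J] by simp
  then show ?thesis
    using assms by (simp add: \<psi>_def set_encode_def image_Un sum.union_disjoint)
qed

text \<open>
  The variable \<open>x\<^sub>i\<close> acts as \<open>johnson (2 ^ a i)\<close>, whose square is zero.
\<close>
definition monomial_act ::
  "(nat \<Rightarrow>\<^sub>0 nat) \<Rightarrow> ((nat \<Rightarrow> nat) set \<Rightarrow> 'k) \<Rightarrow> (nat \<Rightarrow> nat) set \<Rightarrow> 'k" where
  "monomial_act x y = (if square_free x then johnson (\<psi> (Poly_Mapping.keys x)) y else 0)"

definition \<Phi> :: "'k mpoly \<Rightarrow> ((nat \<Rightarrow> nat) set \<Rightarrow> 'k) \<Rightarrow> (nat \<Rightarrow> nat) set \<Rightarrow> 'k" where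
  "\<Phi> p = (\<lambda>y. if y \<in> Y
     then \<Sum>x\<in>Poly_Mapping.keys p. scale (Poly_Mapping.lookup p x) (monomial_act x y) else 0)"

abbreviation "P \<equiv> mpoly_ring k :: 'k mpoly ring"

lemma carrier_PD:
  assumes "p \<in> carrier P" "x \<in> Poly_Mapping.keys p"
  shows "Poly_Mapping.keys x \<subseteq> {1..k}"
  using assms by (simp add: mpoly_ring_simps)

lemma monomial_act_in_Y: "y \<in> Y \<Longrightarrow> monomial_act x y \<in> Y"
  by (simp add: monomial_act_def johnson_in_Y Y_closed(2))

lemma monomial_act_zero: "monomial_act x 0 = 0"
  by (cases "square_free x") (simp_all only: monomial_act_def johnson_zero if_True if_False)

lemma monomial_act_sum: "monomial_act x (\<Sum>i\<in>I. scale (c i) (f i)) = (\<Sum>i\<in>I. scale (c i) (monomial_act x (f i)))"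
proof (cases "square_free x")
  case True
  then show ?thesis by (simp only: monomial_act_def if_True johnson_sum johnson_scale)
next
  case False
  then show ?thesis by (simp add: monomial_act_def fun_eq_iff sum_apply)
qed

text \<open>
  Monomials with disjoint supports correspond to numbers with disjoint digits; if the supports meet, both
  sides are zero.
\<close>
lemma monomial_act_add:
  assumes x: "Poly_Mapping.keys x \<subseteq> {1..k}" and x': "Poly_Mapping.keys x' \<subseteq> {1..k}" and y: "y \<in> Y"
  shows "monomial_act (x + x') y = monomial_act x (monomial_act x' y)"
proof (cases "square_free x \<and> square_free x'")
  case True
  let ?I = "Poly_Mapping.keys x" and ?J = "Poly_Mapping.keys x'"
  have IJ: "finite ?I" "finite ?J" "?I \<subseteq> {1..}" "?J \<subseteq> {1..}" using subset_k[OF x] subset_k[OF x'] by auto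
  show ?thesis
  proof (cases "?I \<inter> ?J = {}")
    case disjoint: True
    have "a ` ?I \<inter> a ` ?J = {}"
      using disjoint IJ inj_on_image_Int[OF inj_on_a, of ?I ?J] by simp
    then have "\<not> (bit (\<psi> ?I) c \<and> bit (\<psi> ?J) c)" for c
      unfolding bit_\<psi>[OF IJ(1)] bit_\<psi>[OF IJ(2)] by blast
    then have "johnson (\<psi> ?I) (johnson (\<psi> ?J) y) = johnson (\<psi> ?I + \<psi> ?J) y"
      by (rule johnson_disjoint)
    then show ?thesis
      using True disjoint by (simp add: monomial_act_def square_free_add_iff keys_add_nat
          \<psi>_disjoint_union[OF IJ disjoint])
  next
    case False
    then obtain i where i: "i \<in> ?I" "i \<in> ?J" by blast
    have "johnson (\<psi> ?I) (johnson (\<psi> ?J) y) = 0"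
      by (rule johnson_overlap[where a = "a i", OF _ _ y]) (use i IJ in \<open>simp_all add: bit_\<psi>\<close>)
    moreover have "\<not> square_free (x + x')" using False by (simp only: square_free_add_iff simp_thms)
    ultimately show ?thesis using True by (simp only: monomial_act_def if_True if_False simp_thms)
  qed
next
  case False
  then have "\<not> square_free (x + x')" by (simp only: square_free_add_iff) blast
  then have "monomial_act (x + x') y = 0" by (simp only: monomial_act_def if_False)
  moreover have "monomial_act x (monomial_act x' y) = 0"
  proof (cases "square_free x'")
    case True
    then have "\<not> square_free x" using False by blast
    then show ?thesis by (simp only: monomial_act_def if_False)
  next
    case not_square_free: False
    then have "monomial_act x' y = 0" by (simp only: monomial_act_def if_False)
    then show ?thesis by (simp only: monomial_act_zero)
  qed
  ultimately show ?thesis by (simp only:)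
qed

lemma \<Phi>_superset:
  assumes "finite S" "Poly_Mapping.keys p \<subseteq> S" "y \<in> Y"
  shows "\<Phi> p y = (\<Sum>x\<in>S. scale (Poly_Mapping.lookup p x) (monomial_act x y))"
proof -
  have "(\<Sum>x\<in>Poly_Mapping.keys p. scale (Poly_Mapping.lookup p x) (monomial_act x y)) =
      (\<Sum>x\<in>S. scale (Poly_Mapping.lookup p x) (monomial_act x y))"
  proof (rule sum.mono_neutral_left[OF assms(1,2)], rule ballI)
    fix x assume "x \<in> S - Poly_Mapping.keys p"
    then have "Poly_Mapping.lookup p x = 0" by (simp add: in_keys_iff)
    then show "scale (Poly_Mapping.lookup p x) (monomial_act x y) = 0" by (simp only: scale_0_left)
  qed
  then show ?thesis using assms(3) by (simp only: \<Phi>_def if_True)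
qed

lemma \<Phi>_outside: "y \<notin> Y \<Longrightarrow> \<Phi> p y = 0"
  by (simp only: \<Phi>_def if_False)

lemma \<Phi>_add: "\<Phi> (p + q) = \<Phi> p + \<Phi> q"
proof (rule ext)
  fix y
  show "\<Phi> (p + q) y = (\<Phi> p + \<Phi> q) y"
  proof (cases "y \<in> Y")
    case True
    let ?S = "Poly_Mapping.keys p \<union> Poly_Mapping.keys q"
    have fin: "finite ?S" by simp
    have "\<Phi> (p + q) y = (\<Sum>x\<in>?S. scale (Poly_Mapping.lookup (p + q) x) (monomial_act x y))"
      by (rule \<Phi>_superset[OF fin Poly_Mapping.keys_add True])
    also have "\<dots> = (\<Sum>x\<in>?S. scale (Poly_Mapping.lookup p x) (monomial_act x y) +
        scale (Poly_Mapping.lookup q x) (monomial_act x y))"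
      by (rule sum.cong[OF refl]) (simp add: lookup_add fun_eq_iff distrib_right)
    also have "\<dots> = \<Phi> p y + \<Phi> q y"
      by (simp only: sum.distrib \<Phi>_superset[OF fin Un_upper1 True] \<Phi>_superset[OF fin Un_upper2 True])
    finally show ?thesis by (simp only: plus_fun_apply)
  qed (simp only: \<Phi>_outside plus_fun_apply add_0_right not_False_eq_True)
qed

lemma \<Phi>_zero: "\<Phi> 0 = 0"
  by (rule ext) (simp add: \<Phi>_def)

lemma \<Phi>_sum: "\<Phi> (\<Sum>i\<in>I. f i) = (\<Sum>i\<in>I. \<Phi> (f i))"
  by (induction I rule: infinite_finite_induct)
     (simp_all only: sum.infinite sum.empty sum.insert \<Phi>_zero \<Phi>_add not_False_eq_True)

lemma \<Phi>_single: "y \<in> Y \<Longrightarrow> \<Phi> (Poly_Mapping.single x c) y = scale c (monomial_act x y)"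
  using \<Phi>_superset[of "{x}" "Poly_Mapping.single x c" y] by simp

lemma \<Phi>_in_Y: "y \<in> Y \<Longrightarrow> \<Phi> p y \<in> Y"
  unfolding \<Phi>_def by (simp only: if_True) (intro Y_closed(6) Y_closed(5) monomial_act_in_Y)

lemma \<Phi>_mult:
  assumes p: "p \<in> carrier P" and q: "q \<in> carrier P"
  shows "\<Phi> (p * q) = \<Phi> p \<circ> \<Phi> q"
proof (rule ext)
  fix y
  show "\<Phi> (p * q) y = (\<Phi> p \<circ> \<Phi> q) y"
  proof (cases "y \<in> Y")
    case True
    let ?lp = "Poly_Mapping.lookup p" and ?lq = "Poly_Mapping.lookup q"
    have "\<Phi> (p * q) y = (\<Sum>x\<in>Poly_Mapping.keys p. \<Sum>x'\<in>Poly_Mapping.keys q. scale (?lp x * ?lq x') (monomial_act (x + x') y))"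
      unfolding poly_mapping_mult_expansion[of p q] \<Phi>_sum
      by (simp only: sum_apply \<Phi>_single[OF True])
    also have "\<dots> = (\<Sum>x\<in>Poly_Mapping.keys p. \<Sum>x'\<in>Poly_Mapping.keys q.
        scale (?lp x) (scale (?lq x') (monomial_act x (monomial_act x' y))))"
    proof (rule sum.cong[OF refl], rule sum.cong[OF refl])
      fix x x' assume "x \<in> Poly_Mapping.keys p" "x' \<in> Poly_Mapping.keys q"
      then have "monomial_act (x + x') y = monomial_act x (monomial_act x' y)"
        by (intro monomial_act_add carrier_PD[OF p] carrier_PD[OF q] True)
      then show "scale (?lp x * ?lq x') (monomial_act (x + x') y) =
          scale (?lp x) (scale (?lq x') (monomial_act x (monomial_act x' y)))"
        by (simp only: scale_scale)
    qed
    also have "\<dots> = (\<Sum>x\<in>Poly_Mapping.keys p. scale (?lp x) (monomial_act x (\<Phi> q y)))"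
      using True by (simp only: \<Phi>_def[of q] if_True monomial_act_sum scale_sum)
    also have "\<dots> = \<Phi> p (\<Phi> q y)"
      using \<Phi>_in_Y[OF True, of q] by (simp only: \<Phi>_def[of p] if_True)
    finally show ?thesis by (simp only: o_apply)
  next
    case False
    have "\<Phi> p 0 = 0"
      using Y_closed(2) by (simp add: \<Phi>_def monomial_act_zero fun_eq_iff sum_apply del: zero_fun_def)
    then show ?thesis by (simp only: \<Phi>_outside[OF False] o_apply)
  qed
qed

definition \<psi>_inv :: "nat \<Rightarrow> nat set" where
  "\<psi>_inv u = {i \<in> {1..k}. bit u (a i)}"

lemma \<psi>_inv_\<psi>:
  assumes I: "I \<subseteq> {1..k}"
  shows "\<psi>_inv (\<psi> I) = I"
proof -
  have fin: "finite I" "I \<subseteq> {1..}" using subset_k[OF I] by auto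
  have "bit (\<psi> I) (a i) \<longleftrightarrow> i \<in> I" if "i \<in> {1..k}" for i
    unfolding bit_\<psi>[OF fin(1)] using that by (intro a_in_image_iff fin) simp
  then show ?thesis using I by (auto simp: \<psi>_inv_def)
qed

abbreviation "bounded_sets \<equiv> {I. I \<subseteq> {1..k} \<and> \<psi> I \<le> \<mu>\<^sub>2}"

lemma jsum_eq_sum_bounded_sets:
  assumes y: "y \<in> Y"
  shows "jsum c y = (\<Sum>I\<in>bounded_sets. scale (c (\<psi> I)) (johnson (\<psi> I) y))"
  unfolding jsum_eq_sum_avoids[OF y] avoids_iff
  by (rule sum.reindex_bij_betw[OF bij_betw_\<psi>, symmetric])

lemma bounded_sets_subset: "I \<in> bounded_sets \<Longrightarrow> finite I \<and> I \<subseteq> {1..k}"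
  using subset_k by blast

lemma inj_on_support_monomial: "inj_on support_monomial bounded_sets"
  by (rule inj_onI) (metis bounded_sets_subset keys_support_monomial)

lemma monomial_act_unbounded:
  assumes x: "Poly_Mapping.keys x \<subseteq> {1..k}" "x \<notin> support_monomial ` bounded_sets"
  shows "monomial_act x y = 0"
proof (cases "square_free x")
  case True
  have "Poly_Mapping.keys x \<notin> bounded_sets"
  proof
    assume "Poly_Mapping.keys x \<in> bounded_sets"
    then have "support_monomial (Poly_Mapping.keys x) \<in> support_monomial ` bounded_sets"
      by (rule imageI)
    with x(2) show False unfolding square_free_eq_support_monomial[OF True, symmetric] by (rule notE)
  qed
  then have "\<mu>\<^sub>2 < \<psi> (Poly_Mapping.keys x)" using x(1) by simp
  then show ?thesis using True by (simp only: monomial_act_def if_True johnson_eq_0)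
qed (simp only: monomial_act_def if_False)

text \<open>
  The coefficients of \<open>\<Phi> p\<close> with respect to the basis of the endomorphism algebra are coefficients of \<open>p\<close>; all
  monomials outside \<open>bounded_sets\<close> act as zero.
\<close>
lemma \<Phi>_eq_jsum:
  assumes p: "p \<in> carrier P" and y: "y \<in> Y"
  shows "\<Phi> p y = jsum (\<lambda>u. if avoids u then Poly_Mapping.lookup p (support_monomial (\<psi>_inv u)) else 0) y"
    (is "_ = jsum ?c y")
proof -
  let ?S = "support_monomial ` bounded_sets" and ?t = "\<lambda>x. scale (Poly_Mapping.lookup p x) (monomial_act x y)"
  have finS: "finite ?S" using finite_family by (rule finite_imageI)
  have "\<Phi> p y = sum ?t (Poly_Mapping.keys p \<union> ?S)"
    by (rule \<Phi>_superset) (use finS y in simp_all)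
  also have "\<dots> = sum ?t ?S"
  proof (rule sum.mono_neutral_right)
    show "\<forall>x\<in>(Poly_Mapping.keys p \<union> ?S) - ?S. ?t x = 0"
    proof
      fix x assume x: "x \<in> (Poly_Mapping.keys p \<union> ?S) - ?S"
      then have "monomial_act x y = 0"
        by (intro monomial_act_unbounded carrier_PD[OF p]) blast+
      then show "?t x = 0" by (simp add: fun_eq_iff)
    qed
  qed (use finS in simp_all)
  also have "\<dots> = (\<Sum>I\<in>bounded_sets. ?t (support_monomial I))"
    by (rule sum.reindex[OF inj_on_support_monomial, unfolded o_def])
  also have "\<dots> = (\<Sum>I\<in>bounded_sets. scale (?c (\<psi> I)) (johnson (\<psi> I) y))"
  proof (rule sum.cong[OF refl])
    fix I assume I: "I \<in> bounded_sets"
    then have fin: "finite I" "I \<subseteq> {1..k}" "I \<subseteq> {1..}" using bounded_sets_subset by auto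
    have "monomial_act (support_monomial I) y = johnson (\<psi> I) y"
      using fin by (simp add: monomial_act_def square_free_support_monomial keys_support_monomial)
    moreover have "avoids (\<psi> I)"
      unfolding avoids_iff using \<psi>_in_U[OF fin(1,3)] I by simp
    ultimately show "?t (support_monomial I) = scale (?c (\<psi> I)) (johnson (\<psi> I) y)"
      using \<psi>_inv_\<psi>[OF fin(2)] by simp
  qed
  also have "\<dots> = jsum ?c y" by (rule jsum_eq_sum_bounded_sets[OF y, symmetric])
  finally show ?thesis .
qed

lemma \<Phi>_endomorphism: "p \<in> carrier P \<Longrightarrow> \<Phi> p \<in> endomorphisms G Y"
proof (rule endomorphismsI)
  assume p: "p \<in> carrier P"
  show "\<Phi> p (u + v) = \<Phi> p u + \<Phi> p v" if "u \<in> Y" "v \<in> Y" for u v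
    by (simp only: \<Phi>_eq_jsum[OF p] that Y_closed(3)[OF that] jsum_add)
  show "\<Phi> p (algebra_act G b v) = algebra_act G b (\<Phi> p v)" if "b \<in> group_algebra G" "v \<in> Y" for b v
    by (simp only: \<Phi>_eq_jsum[OF p] that Y_closed(4)[OF that] jsum_def johnson_algebra_act
        algebra_act_sum algebra_act_scale)
qed (simp_all only: \<Phi>_outside \<Phi>_in_Y not_False_eq_True)

lemma \<Phi>_surjective:
  assumes f: "f \<in> endomorphisms G Y"
  shows "\<exists>p\<in>carrier P. \<Phi> p = f"
proof -
  obtain c where c: "\<forall>y\<in>Y. f y = jsum c y" using endomorphism_of_Y_eq_jsum[OF f] by blast
  define p where "p = (\<Sum>I\<in>bounded_sets. Poly_Mapping.single (support_monomial I) (c (\<psi> I)))"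
  have "Poly_Mapping.keys x \<subseteq> {1..k}" if "x \<in> Poly_Mapping.keys p" for x
  proof -
    have "x \<in> (\<Union>I\<in>bounded_sets. Poly_Mapping.keys (Poly_Mapping.single (support_monomial I) (c (\<psi> I))))"
      using that unfolding p_def by (rule subsetD[OF Poly_Mapping.keys_sum])
    then obtain I where I: "I \<in> bounded_sets"
      and x: "x \<in> Poly_Mapping.keys (Poly_Mapping.single (support_monomial I) (c (\<psi> I)))" by (rule UN_E)
    have "x = support_monomial I" using x by (simp split: if_splits)
    then show ?thesis using bounded_sets_subset[OF I] by (simp only: keys_support_monomial)
  qed
  then have "p \<in> carrier P" by (simp add: mpoly_ring_simps)
  moreover have "\<Phi> p = f"
  proof (rule ext)
    fix y
    show "\<Phi> p y = f y"
    proof (cases "y \<in> Y")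
      case True
      have "\<Phi> p y = (\<Sum>I\<in>bounded_sets. scale (c (\<psi> I)) (monomial_act (support_monomial I) y))"
        unfolding p_def \<Phi>_sum sum_apply by (simp only: \<Phi>_single[OF True])
      also have "\<dots> = (\<Sum>I\<in>bounded_sets. scale (c (\<psi> I)) (johnson (\<psi> I) y))"
      proof (rule sum.cong[OF refl])
        fix I assume "I \<in> bounded_sets"
        then have "finite I" using bounded_sets_subset by blast
        then show "scale (c (\<psi> I)) (monomial_act (support_monomial I) y) = scale (c (\<psi> I)) (johnson (\<psi> I) y)"
          by (simp add: monomial_act_def square_free_support_monomial keys_support_monomial)
      qed
      also have "\<dots> = f y" using c True by (simp only: jsum_eq_sum_bounded_sets[OF True, symmetric])
      finally show ?thesis .
    next
      case False
      then show ?thesis using endomorphismsD(1)[OF f] by (simp only: \<Phi>_outside not_False_eq_True)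
    qed
  qed
  ultimately show ?thesis by blast
qed

lemma \<Phi>_eq_0D:
  assumes p: "p \<in> carrier P" and zero: "\<Phi> p = 0" and I: "I \<in> bounded_sets"
  shows "Poly_Mapping.lookup p (support_monomial I) = 0"
proof -
  have fin: "finite I" "I \<subseteq> {1..k}" "I \<subseteq> {1..}" using I bounded_sets_subset by auto
  define c where "c = (\<lambda>u. if avoids u then Poly_Mapping.lookup p (support_monomial (\<psi>_inv u)) else 0)"
  have "c (\<psi> I) = 0"
  proof (rule johnson_independent_on_Y)
    show "jsum c y = 0" if "y \<in> Y" for y
    proof -
      have "jsum c y = \<Phi> p y" unfolding c_def by (rule \<Phi>_eq_jsum[OF p that, symmetric])
      then show ?thesis by (simp only: zero zero_fun_apply)
    qed
    show "\<psi> I \<le> \<mu>\<^sub>2" using I by simp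
    show "c u = 0" if "u \<le> \<mu>\<^sub>2" "\<not> avoids u" for u using that by (simp add: c_def)
  qed
  moreover have "avoids (\<psi> I)"
    unfolding avoids_iff using \<psi>_in_U[OF fin(1,3)] I by simp
  ultimately show ?thesis using \<psi>_inv_\<psi>[OF fin(2)] by (simp add: c_def)
qed

end

context presentation
begin

abbreviation "A \<equiv> endo_algebra G Y"

definition relations :: "'k mpoly set" where
  "relations = {mpoly_var i ^ 2 | i. i \<in> {1..k}} \<union> extra_relations n k"

lemma extra_relations_eq:
  "extra_relations n k = {sqfree_monomial I | I. I \<subseteq> {1..k} \<and> k \<in> I \<and> \<mu>\<^sub>2 < \<psi> I}"
  unfolding extra_relations_def using position_ge_iff by blast

lemma relations_in_carrier: "relations \<subseteq> carrier P"
proof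
  fix p assume "p \<in> relations"
  then consider i where "i \<in> {1..k}" "p = mpoly_var i ^ 2" | I where "I \<subseteq> {1..k}" "p = sqfree_monomial I"
    unfolding relations_def extra_relations_eq by blast
  then show "p \<in> carrier P"
  proof cases
    case 1
    then show ?thesis by (simp add: mpoly_ring_simps mpoly_var_power2)
  next
    case 2
    then show ?thesis using subset_k[OF 2(1)] by (simp add: mpoly_ring_simps sqfree_monomial_eq keys_support_monomial)
  qed
qed

lemma \<Phi>_relations:
  assumes "p \<in> relations"
  shows "\<Phi> p = 0"
proof (rule ext)
  fix y
  show "\<Phi> p y = 0 y"
  proof (cases "y \<in> Y")
    case y: True
    from assms consider i where "i \<in> {1..k}" "p = mpoly_var i ^ 2"
      | I where "I \<subseteq> {1..k}" "\<mu>\<^sub>2 < \<psi> I" "p = sqfree_monomial I"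
      unfolding relations_def extra_relations_eq by blast
    then show ?thesis
    proof cases
      case 1
      have "\<not> square_free (Poly_Mapping.single i 2)"
        unfolding square_free_def by (intro notI, drule spec[of _ i]) simp
      then have "monomial_act (Poly_Mapping.single i 2) y = 0" by (simp only: monomial_act_def if_False)
      then show ?thesis
        unfolding 1(2) mpoly_var_power2 \<Phi>_single[OF y] by (simp add: scale_1)
    next
      case 2
      have I: "finite I" using subset_k[OF 2(1)] by simp
      have "monomial_act (support_monomial I) y = 0"
        using 2(2) I by (simp only: monomial_act_def square_free_support_monomial keys_support_monomial if_True johnson_eq_0)
      then show ?thesis
        unfolding 2(3) sqfree_monomial_eq[OF I] \<Phi>_single[OF y] by (simp add: scale_1)
    qed
  qed (simp only: \<Phi>_outside zero_fun_apply not_False_eq_True)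
qed

lemma \<Phi>_const:
  assumes "y \<in> Y"
  shows "\<Phi> (mpoly_const c) y = scale c y"
proof -
  have "square_free 0" by (simp add: square_free_def)
  moreover have "\<psi> {} = 0" by (simp add: \<psi>_def)
  ultimately have "monomial_act 0 y = y"
    by (simp only: monomial_act_def if_True keys_zero johnson_0[OF Y_in_M[OF assms]])
  then show ?thesis unfolding mpoly_const_def \<Phi>_single[OF assms] by (simp only:)
qed

lemma const_in_carrier: "mpoly_const c \<in> carrier P"
  by (simp add: mpoly_const_def mpoly_ring_simps)

lemma \<Phi>_ring_hom: "\<Phi> \<in> ring_hom P A"
proof (rule ring_hom_memI)
  have "\<Phi> 1 = (\<lambda>v. if v \<in> Y then v else 0)"
  proof (rule ext)
    fix v
    show "\<Phi> 1 v = (if v \<in> Y then v else 0)"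
    proof (cases "v \<in> Y")
      case True
      then show ?thesis using \<Phi>_const[OF True, of 1] by (simp add: mpoly_const_def scale_1)
    qed (simp only: \<Phi>_outside if_False not_False_eq_True)
  qed
  then show "\<Phi> \<one>\<^bsub>P\<^esub> = \<one>\<^bsub>A\<^esub>" unfolding mpoly_ring_simps endo_algebra_simps .
qed (simp_all only: mpoly_ring_simps(2,3) endo_algebra_simps \<Phi>_endomorphism \<Phi>_mult \<Phi>_add)

lemma \<Phi>_ring_hom_ring: "ring_hom_ring P A \<Phi>"
  by (rule ring_hom_ringI2[OF mpoly_ring_is_ring endo_algebra_is_ring \<Phi>_ring_hom])

lemma ideal_relations: "ideal (Idl\<^bsub>P\<^esub> relations) P"
  by (rule ring.genideal_ideal[OF mpoly_ring_is_ring relations_in_carrier])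

lemma relations_in_ideal: "p \<in> relations \<Longrightarrow> p \<in> Idl\<^bsub>P\<^esub> relations"
  using ring.genideal_self[OF mpoly_ring_is_ring relations_in_carrier] by blast

lemma ideal_mult: "p \<in> Idl\<^bsub>P\<^esub> relations \<Longrightarrow> q \<in> carrier P \<Longrightarrow> p * q \<in> Idl\<^bsub>P\<^esub> relations"
  using ideal.I_r_closed[OF ideal_relations, of p q] by (simp only: mpoly_ring_simps)

lemma ideal_zero: "0 \<in> Idl\<^bsub>P\<^esub> relations"
  using additive_subgroup.zero_closed[OF ideal.axioms(1)[OF ideal_relations]]
  by (simp only: mpoly_ring_simps)

lemma ideal_add:
  assumes "p \<in> Idl\<^bsub>P\<^esub> relations" "q \<in> Idl\<^bsub>P\<^esub> relations"
  shows "p + q \<in> Idl\<^bsub>P\<^esub> relations"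
  using additive_subgroup.a_closed[OF ideal.axioms(1)[OF ideal_relations] assms]
  by (simp only: mpoly_ring_simps)

lemma ideal_sum: "(\<And>i. i \<in> S \<Longrightarrow> f i \<in> Idl\<^bsub>P\<^esub> relations) \<Longrightarrow> (\<Sum>i\<in>S. f i) \<in> Idl\<^bsub>P\<^esub> relations"
  by (induction S rule: infinite_finite_induct) (simp_all add: ideal_zero ideal_add)

text \<open>
  A monomial that acts as zero has a repeated factor, or is square-free with \<open>\<psi> I > \<mu>\<^sub>2\<close>; it is a
  multiple of a relation in both cases.
\<close>
lemma monomial_in_ideal:
  assumes x: "Poly_Mapping.keys x \<subseteq> {1..k}" and unbounded: "x \<notin> support_monomial ` bounded_sets"
  shows "Poly_Mapping.single x c \<in> Idl\<^bsub>P\<^esub> relations"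
proof (cases "square_free x")
  case True
  let ?I = "Poly_Mapping.keys x"
  have x_eq: "x = support_monomial ?I" by (rule square_free_eq_support_monomial[OF True])
  have "?I \<notin> bounded_sets"
  proof
    assume "?I \<in> bounded_sets"
    then have "support_monomial ?I \<in> support_monomial ` bounded_sets" by (rule imageI)
    with unbounded show False unfolding x_eq[symmetric] by (rule notE)
  qed
  then have gr: "\<mu>\<^sub>2 < \<psi> ?I" using x by simp
  have "k \<in> ?I" using last_index_mem[OF x] position_ge_iff[OF x] gr by simp
  then have "sqfree_monomial ?I \<in> relations"
    unfolding relations_def extra_relations_eq using x gr by blast
  then have "sqfree_monomial ?I * mpoly_const c \<in> Idl\<^bsub>P\<^esub> relations"
    by (intro ideal_mult relations_in_ideal const_in_carrier)
  moreover have "sqfree_monomial ?I * mpoly_const c = Poly_Mapping.single x c"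
  proof -
    have "sqfree_monomial ?I = Poly_Mapping.single x (1 :: 'k)"
      unfolding sqfree_monomial_eq[OF finite_keys] x_eq[symmetric] ..
    then show ?thesis by (simp add: mpoly_const_def mult_single)
  qed
  ultimately show ?thesis by (simp only:)
next
  case False
  then obtain i where i: "2 \<le> Poly_Mapping.lookup x i" unfolding square_free_def by (metis not_less_eq_eq numeral_2_eq_2 One_nat_def)
  \<comment> \<open>split off the repeated factor \<open>x\<^sub>i\<^sup>2\<close>\<close>
  define x' where "x' = x - Poly_Mapping.single i 2"
  have x_eq: "x = Poly_Mapping.single i 2 + x'"
    by (rule poly_mapping_eqI) (use i in \<open>auto simp: x'_def lookup_add lookup_minus lookup_single when_def\<close>)
  have keys: "Poly_Mapping.keys (Poly_Mapping.single i (2::nat) + x') \<subseteq> {1..k}" using x unfolding x_eq[symmetric] .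
  then have "i \<in> {1..k}" "Poly_Mapping.keys x' \<subseteq> {1..k}" unfolding keys_add_nat by simp_all
  then have "mpoly_var i ^ 2 \<in> relations" "Poly_Mapping.single x' c \<in> carrier P"
    by (auto simp: relations_def mpoly_ring_simps)
  then have "mpoly_var i ^ 2 * Poly_Mapping.single x' c \<in> Idl\<^bsub>P\<^esub> relations"
    by (intro ideal_mult relations_in_ideal)
  then show ?thesis
    unfolding mpoly_var_power2 mult_single mult_1_left x_eq[symmetric] .
qed

text \<open>
  By independence of the surviving basis elements, a polynomial in the kernel has only monomials that act
  as zero.
\<close>
theorem kernel_\<Phi>: "a_kernel P A \<Phi> = Idl\<^bsub>P\<^esub> relations"
proof
  have kernel: "a_kernel P A \<Phi> = {p \<in> carrier P. \<Phi> p = 0}"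
    by (simp only: a_kernel_def' endo_algebra_simps)
  show "Idl\<^bsub>P\<^esub> relations \<subseteq> a_kernel P A \<Phi>"
  proof (rule ring.genideal_minimal[OF mpoly_ring_is_ring])
    show "ideal (a_kernel P A \<Phi>) P" by (rule ring_hom_ring.kernel_is_ideal[OF \<Phi>_ring_hom_ring])
    show "relations \<subseteq> a_kernel P A \<Phi>"
      unfolding kernel using relations_in_carrier \<Phi>_relations by blast
  qed
  show "a_kernel P A \<Phi> \<subseteq> Idl\<^bsub>P\<^esub> relations"
  proof
    fix p assume "p \<in> a_kernel P A \<Phi>"
    then have p: "p \<in> carrier P" and zero: "\<Phi> p = 0" unfolding kernel by simp_all
    have "(\<Sum>x\<in>Poly_Mapping.keys p. Poly_Mapping.single x (Poly_Mapping.lookup p x)) \<in> Idl\<^bsub>P\<^esub> relations"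
    proof (rule ideal_sum)
      fix x assume x: "x \<in> Poly_Mapping.keys p"
      have "x \<notin> support_monomial ` bounded_sets"
      proof
        assume "x \<in> support_monomial ` bounded_sets"
        then obtain I where I: "x = support_monomial I" "I \<in> bounded_sets" by (rule imageE)
        have "Poly_Mapping.lookup p x = 0" unfolding I(1) by (rule \<Phi>_eq_0D[OF p zero I(2)])
        with x show False by (simp add: in_keys_iff)
      qed
      then show "Poly_Mapping.single x (Poly_Mapping.lookup p x) \<in> Idl\<^bsub>P\<^esub> relations"
        by (rule monomial_in_ideal[OF carrier_PD[OF p x]])
    qed
    then show "p \<in> Idl\<^bsub>P\<^esub> relations" by (subst poly_mapping_expansion[of p])
  qed
qed

text \<open>
  The isomorphism is the inverse of the map that \<open>\<Phi>\<close> induces on the quotient. It commutes with scalars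
  because \<open>\<Phi>\<close> maps the constant \<open>c\<close> to multiplication by \<open>c\<close>.
\<close>
theorem endo_algebra_isomorphic: "algebra_isomorphic A (truncated_algebra n k)"
proof -
  interpret h: ring_hom_ring P A \<Phi> by (rule \<Phi>_ring_hom_ring)
  let ?J = "Idl\<^bsub>P\<^esub> relations" and ?h = "\<lambda>C. the_elem (\<Phi> ` C)"
  let ?Q = "P Quot ?J"
  have image: "\<Phi> ` carrier P = carrier A"
  proof
    show "\<Phi> ` carrier P \<subseteq> carrier A" unfolding endo_algebra_simps by (rule image_subsetI) (rule \<Phi>_endomorphism)
    show "carrier A \<subseteq> \<Phi> ` carrier P"
    proof
      fix f assume "f \<in> carrier A"
      then have "f \<in> endomorphisms G Y" by (simp only: endo_algebra_simps)
      then obtain p where "p \<in> carrier P" "\<Phi> p = f" using \<Phi>_surjective by blast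
      then show "f \<in> \<Phi> ` carrier P" by (intro image_eqI[of f \<Phi> p]) simp_all
    qed
  qed
  have iso: "?h \<in> ring_iso ?Q A"
    using h.FactRing_iso_set[OF image] unfolding kernel_\<Phi> .
  have ringQ: "ring ?Q" by (rule ideal.quotient_is_ring[OF ideal_relations])
  interpret Q: ring ?Q by (rule ringQ)
  define g where "g = inv_into (carrier ?Q) ?h"
  have g: "g \<in> ring_iso A ?Q"
    unfolding g_def by (rule ring_iso_set_sym[OF ringQ iso])
  have bij: "bij_betw ?h (carrier ?Q) (carrier A)" using iso by (simp add: ring_iso_def)
  have h_mult: "?h (C \<otimes>\<^bsub>?Q\<^esub> D) = ?h C \<otimes>\<^bsub>A\<^esub> ?h D" if "C \<in> carrier ?Q" "D \<in> carrier ?Q" for C D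
    using iso that by (simp add: ring_iso_def ring_hom_def)
  have g_carrier: "g f \<in> carrier ?Q" if "f \<in> carrier A" for f
    unfolding g_def using bij that by (simp add: bij_betw_def inv_into_into)
  have g_h: "g (?h C) = C" if "C \<in> carrier ?Q" for C
    unfolding g_def by (rule inv_into_f_f[OF bij_betw_imp_inj_on[OF bij] that])
  have const: "?J +>\<^bsub>P\<^esub> mpoly_const c \<in> carrier ?Q" for c
    using const_in_carrier[of c] by (auto simp: FactRing_def A_RCOSETS_def')
  have smult: "g (scale_endo c f) = (?J +>\<^bsub>P\<^esub> mpoly_const c) \<otimes>\<^bsub>?Q\<^esub> g f" if f: "f \<in> carrier A" for c f
  proof -
    let ?Z = "(?J +>\<^bsub>P\<^esub> mpoly_const c) \<otimes>\<^bsub>?Q\<^esub> g f"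
    have Z: "?Z \<in> carrier ?Q" by (rule Q.m_closed[OF const g_carrier[OF f]])
    have "?h ?Z = ?h (?J +>\<^bsub>P\<^esub> mpoly_const c) \<otimes>\<^bsub>A\<^esub> ?h (g f)"
      by (rule h_mult[OF const g_carrier[OF f]])
    also have "?h (?J +>\<^bsub>P\<^esub> mpoly_const c) = \<Phi> (mpoly_const c)"
      using h.the_elem_simp[OF const_in_carrier] unfolding kernel_\<Phi> .
    also have "?h (g f) = f"
      unfolding g_def by (rule f_inv_into_f) (use bij f in \<open>simp add: bij_betw_def\<close>)
    also have "\<Phi> (mpoly_const c) \<otimes>\<^bsub>A\<^esub> f = scale_endo c f"
      unfolding endo_algebra_simps
    proof (rule ext)
      fix y
      have f': "f \<in> endomorphisms G Y" using f by (simp only: endo_algebra_simps)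
      have "f y \<in> Y"
        using endomorphismsD(1,2)[OF f', of y] Y_closed(2) by (cases "y \<in> Y") (simp_all only: not_False_eq_True)
      then show "(\<Phi> (mpoly_const c) \<circ> f) y = scale_endo c f y"
        by (simp only: o_apply \<Phi>_const scale_endo_def)
    qed
    finally have "g (scale_endo c f) = g (?h ?Z)" by (simp only:)
    also have "\<dots> = ?Z" by (rule g_h[OF Z])
    finally show ?thesis .
  qed
  have B: "truncated_algebra n k = ring.extend ?Q \<lparr>module.smult = (\<lambda>c C. (?J +>\<^bsub>P\<^esub> mpoly_const c) \<otimes>\<^bsub>?Q\<^esub> C)\<rparr>"
    unfolding truncated_algebra_def quotient_algebra_def Let_def relations_def[symmetric] ..
  have "g \<in> algebra_iso A (truncated_algebra n k)"
    unfolding algebra_iso_def mem_Collect_eq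
  proof (intro conjI allI ballI)
    show "g \<in> ring_iso A (truncated_algebra n k)"
      using g unfolding B ring_iso_def ring_hom_def by (simp add: ring.defs)
    show "g (c \<odot>\<^bsub>A\<^esub> f) = c \<odot>\<^bsub>truncated_algebra n k\<^esub> g f" if "f \<in> carrier A" for c f
      unfolding B endo_algebra_simps smult[OF that] by (simp add: ring.defs)
  qed
  then show ?thesis by (auto simp: algebra_isomorphic_def)
qed

end

text \<open>
  By \<open>dim_endomorphisms\<close>, the dimension \<open>n\<close> counts the numbers up to \<open>\<mu>\<^sub>2\<close> whose binary digits avoid those
  of \<open>\<mu>\<^sub>1 - \<mu>\<^sub>2\<close>; so the presentation applies with \<open>a\<close> enumerating the digits that \<open>\<mu>\<^sub>1 - \<mu>\<^sub>2\<close> does not use.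
\<close>
theorem theorem3p7:
  fixes r \<mu>\<^sub>1 \<mu>\<^sub>2 n k :: nat
    and Y :: "((nat \<Rightarrow> nat) set \<Rightarrow> 'k::field) set"
    and A :: "('k, ((nat \<Rightarrow> nat) set \<Rightarrow> 'k) \<Rightarrow> (nat \<Rightarrow> nat) set \<Rightarrow> 'k) module"
  assumes "CHAR('k) = 2"
    and "r > 0"
    and "\<mu>\<^sub>1 \<ge> \<mu>\<^sub>2" and "\<mu>\<^sub>1 + \<mu>\<^sub>2 = r"
    and "is_young_module \<mu>\<^sub>1 \<mu>\<^sub>2 Y"
    and "A = endo_algebra (sym_group r) Y"
    and "vector_space.dim scale_endo (carrier A) = n"
    and "(2::real) powi (int k - 1) < real n" and "n \<le> 2 ^ k"
  shows "algebra_isomorphic A (truncated_algebra n k)"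
proof -
  interpret young_summand \<mu>\<^sub>1 \<mu>\<^sub>2 Y
    by unfold_locales (fact assms)+
  define Z where "Z = {c. \<not> bit (\<mu>\<^sub>1 - \<mu>\<^sub>2) c}"
  have "finite {c. bit (\<mu>\<^sub>1 - \<mu>\<^sub>2) c}"
    using finite_set_decode[of "\<mu>\<^sub>1 - \<mu>\<^sub>2"] by (simp add: set_decode_def bit_iff_odd)
  then have infinite: "infinite Z"
    using infinite_UNIV_nat finite_compl by (force simp: Z_def Collect_neg_eq)
  \<comment> \<open>\<open>enumerate\<close> counts from \<open>0\<close>, the variables are numbered from \<open>1\<close>\<close>
  define a where "a i = enumerate Z (i - 1)" for i
  have range: "a ` {1..} = Z"
  proof -
    have "a ` {1..} = enumerate Z ` ((\<lambda>i. i - 1) ` {1..})" by (simp add: a_def image_image)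
    also have "(\<lambda>i. i - 1) ` {1..} = (UNIV :: nat set)"
    proof (rule UNIV_eq_I[symmetric])
      fix i :: nat
      show "i \<in> (\<lambda>i. i - 1) ` {1..}" by (rule image_eqI[of _ _ "Suc i"]) simp_all
    qed
    finally show ?thesis using range_enumerate[OF infinite] by simp
  qed
  have dim: "n = card {u. u \<le> \<mu>\<^sub>2 \<and> avoids u}"
    using assms(4,6,7) dim_endomorphisms by (simp add: endo_algebra_def)
  have "avoids u \<longleftrightarrow> set_decode u \<subseteq> a ` {1..}" for u
    unfolding avoids_def range Z_def set_decode_def bit_iff_odd by blast
  then have card: "n = card {u. u \<le> \<mu>\<^sub>2 \<and> set_decode u \<subseteq> a ` {1..}}"
    using dim by simp
  have lower: "2 ^ (k - 1) < n" if "k \<noteq> 0"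
  proof -
    have "int k - 1 = int (k - 1)" using that by simp
    then have "(2::real) ^ (k - 1) < real n" using assms(8) by (simp only: power_int_of_nat)
    then have "real (2 ^ (k - 1)) < real n" by simp
    then show ?thesis by (simp only: of_nat_less_iff)
  qed
  have "presentation \<mu>\<^sub>1 \<mu>\<^sub>2 Y a n k"
  proof unfold_locales
    show "a i < a j" if "1 \<le> i" "i < j" for i j
      unfolding a_def by (rule enumerate_mono[OF _ infinite]) (use that in simp)
  qed (use card assms(9) lower range in \<open>simp_all add: Z_def\<close>)
  then have "algebra_isomorphic (endo_algebra (sym_group (\<mu>\<^sub>1 + \<mu>\<^sub>2)) Y) (truncated_algebra n k)"
    by (rule presentation.endo_algebra_isomorphic)
  then show ?thesis using assms(4,6) by simp
qed

end
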